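(* Let $(T(t))_{t\ge 0}$ be a bounded $C_0$-semigroup on a Hilbert space $X$ with generator $-A$. Assume that $E:=(-i\sigma(A))\cap\mathbb{R}$ is compact and of spectral synthesis, and moreover that the resolvent of $A$ is bounded on $i(\mathbb{R}\setminus(-\eta,\eta))$ for some $\eta>0$, i.e. $\sup_{|s|\ge\eta}\|(is+A)^{-1}\|<\infty$. (a) If $\mu$ is a finite (complex Borel) measure on $\mathbb{R}_+=[0,\infty)$ whose Fourier transform vanishes on $E$, then $$\lim_{t\to\infty}\|T(t)\hat\mu(T)\|=0,$$ where $\hat\mu(T)x:=\int_0^\infty T(s)x\,d\mu(s)$ for $x\in X$. (b) Assume that $E=\{0\}$, let $$m(s):=\sup\{\|(ir+A)^{-1}\| : |r|\ge s\},\qquad s>0,$$ and assume that $\lim_{s\to 0+}s\,m(s)=\infty$. Let $\varepsilon\in(0,1)$. Then there exist positive constants $c,C,C_\varepsilon$ such that $$c\,m^{-1}(Ct)\le\|T(t)A(I+A)^{-1}\|\le C_\varepsilon\,m^{-1}(t^{1-\varepsilon})$$ for all sufficiently large $t$.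
   Context: The generator of the semigroup is $-A$. The Fourier transform of a complex Borel measure $\mu$ of bounded variation is $\mathcal{F}\mu(\xi)=\int e^{-i\xi t}\,d\mu(t)$, and of $f\in L^1(\mathbb{R})$ is $\mathcal{F}f(\xi)=\int_{\mathbb{R}}e^{-i\xi t}f(t)\,dt$, $\xi\in\mathbb{R}$. A closed set $E\subset\mathbb{R}$ is of spectral synthesis if for every $f\in L^1(\mathbb{R})$ whose Fourier transform vanishes on $E$ there is a sequence $(f_n)$ in $L^1(\mathbb{R})$ with $\|f-f_n\|_{L^1}\to 0$ such that, for each $n$, $\mathcal{F}f_n$ vanishes in a neighbourhood of $E$. In (b), the function $m$ is continuous and decreasing, and $m^{-1}$ denotes a right inverse of $m$ (that is, $m(m^{-1}(t))=t$), defined for all sufficiently large arguments. *)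

theory Defs
  imports "HOL-Analysis.Analysis"
begin

section \<open>Complex Hilbert spaces\<close>

text \<open>
  The inner product is linear in the first argument. The class sits on top of \<^class>\<open>banach\<close>,
  so norm, limits and operator norms are those of the underlying real Banach space.
\<close>

class complex_hilbert_space = banach +
  fixes scaleC :: "complex \<Rightarrow> 'a \<Rightarrow> 'a" (infixr "*\<^sub>C" 75)
    and cinner :: "'a \<Rightarrow> 'a \<Rightarrow> complex"
  assumes scaleC_of_real: "complex_of_real r *\<^sub>C x = r *\<^sub>R x"
    and scaleC_add_right: "z *\<^sub>C (x + y) = z *\<^sub>C x + z *\<^sub>C y"
    and scaleC_add_left: "(z + w) *\<^sub>C x = z *\<^sub>C x + w *\<^sub>C x"
    and scaleC_scaleC: "z *\<^sub>C (w *\<^sub>C x) = (z * w) *\<^sub>C x"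
    and cinner_add_left: "cinner (x + y) u = cinner x u + cinner y u"
    and cinner_scaleC_left: "cinner (z *\<^sub>C x) y = z * cinner x y"
    and cinner_commute: "cinner x y = cnj (cinner y x)"
    and cinner_nonneg: "0 \<le> Re (cinner x x)"
    and norm_eq_sqrt_cinner: "norm x = sqrt (Re (cinner x x))"

instantiation complex :: complex_hilbert_space
begin

definition scaleC_complex :: "complex \<Rightarrow> complex \<Rightarrow> complex"
  where "scaleC_complex z w = z * w"

definition cinner_complex :: "complex \<Rightarrow> complex \<Rightarrow> complex"
  where "cinner_complex z w = z * cnj w"

instance
  by standard
    (simp_all add: scaleC_complex_def cinner_complex_def scaleR_conv_of_real algebra_simps
      cmod_def power2_eq_square)

end

definition bounded_clinear ::
  "('a::complex_hilbert_space \<Rightarrow> 'b::complex_hilbert_space) \<Rightarrow> bool"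
  where "bounded_clinear f \<longleftrightarrow> bounded_linear f \<and> (\<forall>z x. f (z *\<^sub>C x) = z *\<^sub>C f x)"


section \<open>Complex measures and vector-valued integrals\<close>

text \<open>
  The library's Bochner integral is restricted to second countable spaces. A Hilbert space need not
  be separable, so the library's definition is repeated without that restriction.
\<close>

definition has_strong_integral ::
  "'b measure \<Rightarrow> ('b \<Rightarrow> 'a::real_normed_vector) \<Rightarrow> 'a \<Rightarrow> bool"
  where "has_strong_integral M f y \<longleftrightarrow>
    f \<in> borel_measurable M \<and>
    (\<exists>s. (\<forall>i. Bochner_Integration.simple_bochner_integrable M (s i)) \<and>
         (\<lambda>i. \<integral>\<^sup>+x. norm (f x - s i x) \<partial>M) \<longlonglongrightarrow> 0 \<and>
         (\<lambda>i. Bochner_Integration.simple_bochner_integral M (s i)) \<longlonglongrightarrow> y)"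

definition strong_integral :: "'b measure \<Rightarrow> ('b \<Rightarrow> 'a::real_normed_vector) \<Rightarrow> 'a"
  where "strong_integral M f =
    (if \<exists>y. has_strong_integral M f y then THE y. has_strong_integral M f y else 0)"

lemma strong_integral_eq_lebesgue_integral:
  fixes f :: "'b \<Rightarrow> 'a::{real_normed_vector, second_countable_topology}"
  shows "strong_integral M f = integral\<^sup>L M f"
proof -
  have "has_strong_integral M f = has_bochner_integral M f"
    by (auto simp: fun_eq_iff has_strong_integral_def has_bochner_integral.simps)
  then show ?thesis
    by (simp add: strong_integral_def lebesgue_integral_def)
qed

text \<open>
  A complex Borel measure on the line is a countably additive complex-valued set function; its
  total variation is then automatically finite.
\<close>

definition complex_borel_measure :: "(real set \<Rightarrow> complex) \<Rightarrow> bool"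
  where "complex_borel_measure \<mu> \<longleftrightarrow>
    (\<forall>B :: nat \<Rightarrow> real set. range B \<subseteq> sets borel \<longrightarrow> disjoint_family B \<longrightarrow>
      (\<lambda>i. \<mu> (B i)) sums \<mu> (\<Union>i. B i))"

definition concentrated_on :: "(real set \<Rightarrow> complex) \<Rightarrow> real set \<Rightarrow> bool"
  where "concentrated_on \<mu> S \<longleftrightarrow> (\<forall>B\<in>sets borel. B \<inter> S = {} \<longrightarrow> \<mu> B = 0)"

text \<open>
  The positive part of the Jordan decomposition of a finite signed measure \<open>\<nu>\<close>, which maps \<open>A\<close> to
  the supremum of \<open>\<nu> B\<close> over the Borel sets \<open>B \<subseteq> A\<close>; the negative part is the positive part
  of \<open>- \<nu>\<close>. (Negative values of \<open>\<nu> B\<close> are mapped to 0 by \<open>ennreal\<close>; they do not change the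
  supremum, which includes \<open>B = {}\<close>.)
\<close>

definition positive_variation :: "(real set \<Rightarrow> real) \<Rightarrow> real measure"
  where "positive_variation \<nu> =
    measure_of UNIV (sets borel) (\<lambda>A. SUP B\<in>{B \<in> sets borel. B \<subseteq> A}. ennreal (\<nu> B))"

definition complex_integral ::
  "(real set \<Rightarrow> complex) \<Rightarrow> (real \<Rightarrow> 'a::complex_hilbert_space) \<Rightarrow> 'a"
  where "complex_integral \<mu> f =
    (strong_integral (positive_variation (\<lambda>B. Re (\<mu> B))) f
      - strong_integral (positive_variation (\<lambda>B. - Re (\<mu> B))) f)
    + \<i> *\<^sub>C (strong_integral (positive_variation (\<lambda>B. Im (\<mu> B))) f
      - strong_integral (positive_variation (\<lambda>B. - Im (\<mu> B))) f)"

lemma positive_variation_measure: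
  assumes "finite_measure M" and sets: "sets M = sets borel"
  shows "positive_variation (measure M) = M"
proof -
  interpret finite_measure M by fact
  have space: "space M = UNIV"
    using sets_eq_imp_space_eq[OF sets] by simp
  have "(SUP B\<in>{B \<in> sets borel. B \<subseteq> A}. ennreal (measure M B)) = emeasure M A"
    if "A \<in> sets borel" for A
    using that sets
    by (intro antisym SUP_least SUP_upper2[of A])
      (auto simp: emeasure_eq_measure[symmetric] intro!: emeasure_mono)
  then have "positive_variation (measure M) = measure_of UNIV (sets borel) (emeasure M)"
    unfolding positive_variation_def
    by (intro measure_of_eq) (use sets.sigma_sets_eq[of "borel :: real measure"] in auto)
  also have "\<dots> = M"
    using measure_of_of_measure[of M] by (simp add: space sets)
  finally show ?thesis .
qed


section \<open>Fourier transforms and spectral synthesis\<close>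

definition fourier_measure :: "(real set \<Rightarrow> complex) \<Rightarrow> real \<Rightarrow> complex"
  where "fourier_measure \<mu> \<xi> =
    complex_integral \<mu> (\<lambda>t. exp (- \<i> * complex_of_real \<xi> * complex_of_real t))"

definition fourier :: "(real \<Rightarrow> complex) \<Rightarrow> real \<Rightarrow> complex"
  where "fourier f \<xi> =
    (\<integral>t. exp (- \<i> * complex_of_real \<xi> * complex_of_real t) * f t \<partial>lborel)"

definition spectral_synthesis :: "real set \<Rightarrow> bool"
  where "spectral_synthesis E \<longleftrightarrow> closed E \<and>
    (\<forall>f. integrable lborel f \<longrightarrow> (\<forall>\<xi>\<in>E. fourier f \<xi> = 0) \<longrightarrow>
      (\<exists>g :: nat \<Rightarrow> real \<Rightarrow> complex.
        (\<forall>n. integrable lborel (g n)) \<and>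
        (\<lambda>n. \<integral>t. cmod (f t - g n t) \<partial>lborel) \<longlonglongrightarrow> 0 \<and>
        (\<forall>n. \<exists>U. open U \<and> E \<subseteq> U \<and> (\<forall>\<xi>\<in>U. fourier (g n) \<xi> = 0))))"


section \<open>Semigroups and their generators\<close>

text \<open>
  A semigroup is a function on the reals of which only the values at nonnegative times matter. An
  unbounded operator is a pair of a domain \<open>D\<close> and a function \<open>A\<close> of which only the values on \<open>D\<close>
  matter.
\<close>

definition c0_semigroup :: "(real \<Rightarrow> 'a::complex_hilbert_space \<Rightarrow> 'a) \<Rightarrow> bool"
  where "c0_semigroup T \<longleftrightarrow>
    (\<forall>t\<ge>0. bounded_clinear (T t)) \<and>
    (\<forall>x. T 0 x = x) \<and>
    (\<forall>s\<ge>0. \<forall>t\<ge>0. \<forall>x. T (s + t) x = T s (T t x)) \<and>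
    (\<forall>x. ((\<lambda>t. T t x) \<longlongrightarrow> x) (at_right 0))"

definition bounded_semigroup :: "(real \<Rightarrow> 'a::complex_hilbert_space \<Rightarrow> 'a) \<Rightarrow> bool"
  where "bounded_semigroup T \<longleftrightarrow> (\<exists>K. \<forall>t\<ge>0. onorm (T t) \<le> K)"

definition is_generator ::
  "(real \<Rightarrow> 'a::complex_hilbert_space \<Rightarrow> 'a) \<Rightarrow> 'a set \<Rightarrow> ('a \<Rightarrow> 'a) \<Rightarrow> bool"
  where "is_generator T D G \<longleftrightarrow>
    D = {x. \<exists>y. ((\<lambda>h. (1 / h) *\<^sub>R (T h x - x)) \<longlongrightarrow> y) (at_right 0)} \<and>
    (\<forall>x\<in>D. ((\<lambda>h. (1 / h) *\<^sub>R (T h x - x)) \<longlongrightarrow> G x) (at_right 0))"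

definition resolvent_set :: "'a::complex_hilbert_space set \<Rightarrow> ('a \<Rightarrow> 'a) \<Rightarrow> complex set"
  where "resolvent_set D A =
    {z. bij_betw (\<lambda>x. z *\<^sub>C x - A x) D UNIV \<and>
        bounded_clinear (inv_into D (\<lambda>x. z *\<^sub>C x - A x))}"

definition op_spectrum :: "'a::complex_hilbert_space set \<Rightarrow> ('a \<Rightarrow> 'a) \<Rightarrow> complex set"
  where "op_spectrum D A = - resolvent_set D A"

text \<open>
  The operator \<open>(z + A)\<^sup>-\<^sup>1\<close>, meaningful if \<open>- z \<in> resolvent_set D A\<close>.
\<close>

definition shift_inverse ::
  "'a::complex_hilbert_space set \<Rightarrow> ('a \<Rightarrow> 'a) \<Rightarrow> complex \<Rightarrow> 'a \<Rightarrow> 'a"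
  where "shift_inverse D A z = inv_into D (\<lambda>x. z *\<^sub>C x + A x)"

text \<open>The set \<open>E = (- \<i> \<sigma>(A)) \<inter> \<real>\<close>, as a set of real numbers.\<close>

definition boundary_spectrum :: "'a::complex_hilbert_space set \<Rightarrow> ('a \<Rightarrow> 'a) \<Rightarrow> real set"
  where "boundary_spectrum D A = {s. complex_of_real s \<in> (\<lambda>z. - \<i> * z) ` op_spectrum D A}"

definition resolvent_bounded_off ::
  "'a::complex_hilbert_space set \<Rightarrow> ('a \<Rightarrow> 'a) \<Rightarrow> real \<Rightarrow> bool"
  where "resolvent_bounded_off D A \<eta> \<longleftrightarrow>
    (\<forall>s. \<bar>s\<bar> \<ge> \<eta> \<longrightarrow> - (\<i> * complex_of_real s) \<in> resolvent_set D A) \<and>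
    bdd_above ((\<lambda>s. onorm (shift_inverse D A (\<i> * complex_of_real s))) ` {s. \<bar>s\<bar> \<ge> \<eta>})"

definition resolvent_growth ::
  "'a::complex_hilbert_space set \<Rightarrow> ('a \<Rightarrow> 'a) \<Rightarrow> real \<Rightarrow> real"
  where "resolvent_growth D A s =
    (SUP r\<in>{r. \<bar>r\<bar> \<ge> s}. onorm (shift_inverse D A (\<i> * complex_of_real r)))"

text \<open>
  The operator mapping \<open>x\<close> to the integral of \<open>T s x\<close> over \<open>s \<ge> 0\<close>. The indicator discards the
  irrelevant values of \<open>T\<close> at negative times.
\<close>

definition semigroup_transform ::
  "(real set \<Rightarrow> complex) \<Rightarrow> (real \<Rightarrow> 'a::complex_hilbert_space \<Rightarrow> 'a) \<Rightarrow> 'a \<Rightarrow> 'a"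
  where "semigroup_transform \<mu> T x =
    complex_integral \<mu> (\<lambda>s. indicator {0..} s *\<^sub>R T s x)"

text \<open>A right inverse of a function on the positive reals, defined for all large arguments.\<close>

definition eventual_right_inverse :: "(real \<Rightarrow> real) \<Rightarrow> (real \<Rightarrow> real) \<Rightarrow> bool"
  where "eventual_right_inverse m n \<longleftrightarrow> (\<forall>\<^sub>F t in at_top. n t > 0 \<and> m (n t) = t)"

end

theory Submission
  imports Defs "HOL-Probability.Probability" "HOL-Real_Asymp.Real_Asymp"
begin

text \<open>
  On a Hilbert space Plancherel's theorem turns bounds for the resolvent on the imaginary axis into
  square integrability of orbits, and everything below rests on one quantitative form of this.
  Let \<open>M\<close> bound the semigroup, extend \<open>T\<close> by zero to negative times, let
  \<open>\<phi> = c \<delta>\<^sub>0 + g(s) ds\<close> have total mass \<open>B\<close>, and put \<open>\<Phi>(t) = \<integral> T(t + s) d\<phi>(s)\<close>. The Fourier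
  transform of \<open>t \<mapsto> \<Phi>(t) x\<close> at \<open>s\<close> is \<open>(F\<phi>)(-s) (is + A)\<^sup>-\<^sup>1 x\<close> (read as a limit of the damped
  semigroups \<open>e\<^sup>-\<^sup>\<alpha>\<^sup>t T(t)\<close>). Suppose that \<open>\<parallel>(is + A)\<^sup>-\<^sup>1\<parallel> \<le> K\<close> wherever \<open>(F\<phi>)(-s) \<noteq> 0\<close>. There the
  resolvent at \<open>\<alpha> + is\<close> is dominated by four times the one at \<open>1/K + is\<close>, whose square integral along
  the line is, by Plancherel, at most \<open>\<pi> M\<^sup>2 K \<parallel>x\<parallel>\<^sup>2\<close>; applying Plancherel again, in the other direction,
  gives \<open>\<integral> \<parallel>\<Phi>(t) x\<parallel>\<^sup>2 dt \<le> 8 B\<^sup>2 M\<^sup>2 K \<parallel>x\<parallel>\<^sup>2\<close>. Since \<open>\<Phi>(t + \<tau>) = T(\<tau>) \<Phi>(t)\<close> up to the mass of \<open>\<phi>\<close>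
  below \<open>-t\<close>, the norm \<open>\<parallel>\<Phi>(t) x\<parallel>\<close> cannot rise again by more than the factor \<open>M\<close>, and so
  \<open>\<parallel>\<Phi>(2t)\<parallel>\<close> is at most a constant times \<open>sqrt (K/t)\<close> plus that small mass (\<open>multiplier_decay\<close>).

  Part (a). Let \<open>P\<close> be an integrable kernel whose Fourier transform is 1 on \<open>[-\<eta>, \<eta>]\<close>, and split
  \<open>T(t) \<mu>(T) = \<Phi>(t) \<mu>(T) + \<integral> P(s) T(t + s) \<mu>(T) ds\<close> with \<open>\<phi> = \<delta>\<^sub>0 - P\<close>. The estimate above applies to
  the first term, because only the frequencies \<open>|s| \<ge> \<eta>\<close> survive; this is where the bounded resolvent
  at high frequencies is used. The second term is asymptotically \<open>\<integral> f(v) T(t + v) dv\<close>, where \<open>f\<close> is the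
  convolution of \<open>P\<close> with \<open>\<mu>\<close>: an integrable function whose transform vanishes on \<open>E\<close>. Spectral
  synthesis replaces it, up to a small error in \<open>L\<^sup>1\<close>, by a function whose transform vanishes near \<open>E\<close>,
  and to that function the estimate applies again, the resolvent being bounded off a neighbourhood
  of \<open>E\<close> (\<open>katznelson_tzafriri\<close>).

  Part (b), upper bound. Use the kernel at the scale \<open>r\<close>, so that its transform is 1 on \<open>[-r, r]\<close>.
  The low frequency part of \<open>T(t) A (I + A)\<^sup>-\<^sup>1\<close> is \<open>O(r)\<close>, by one integration by parts, and the high
  frequency part of \<open>T(t)\<close> is of order \<open>sqrt (m(r)/t) + 1/(rt)\<close>. For \<open>m(r) = t\<^sup>1\<^sup>-\<^sup>\<epsilon>\<close> the latter is
  \<open>O(t\<^sup>-\<^sup>\<epsilon>\<^sup>/\<^sup>2)\<close>. Writing \<open>T(t) = T(t/k)\<^sup>k\<close> and splitting one factor at a time leaves an error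
  \<open>O(r)\<close> and a \<open>k\<close>-fold product of high frequency parts, which for \<open>k \<ge> 2/\<epsilon>\<close> is \<open>O(1/t)\<close>; the
  assumption \<open>s m(s) \<rightarrow> \<infinity>\<close> makes \<open>1/t\<close> smaller than \<open>r\<close> (\<open>upper_rate\<close>).

  Part (b), lower bound. For \<open>y\<close> in the domain, Duhamel's formula bounds
  \<open>\<parallel>y\<parallel> - \<parallel>T(t) y\<parallel>\<close> by \<open>M t \<parallel>(is + A) y\<parallel>\<close>, and \<open>is T(t) y\<close> is controlled by \<open>\<parallel>T(t) A (I + A)\<^sup>-\<^sup>1\<parallel>\<close>. If
  that norm is at most \<open>\<rho>/4\<close>, then \<open>m(\<rho>) \<le> 2 M t + O(1/\<rho>)\<close> and hence, \<open>\<rho> m(\<rho>)\<close> being large,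
  \<open>m(\<rho>) \<le> 4 M t\<close>; this is false for \<open>\<rho> = m\<^sup>-\<^sup>1(8 M t)\<close> (\<open>lower_rate\<close>).

  The space need not be separable. Vector-valued integrals are therefore handled through their inner
  products with a fixed vector, which are ordinary integrals of complex functions; only the existence
  of the integrals is shown by approximation with simple functions.
\<close>

section \<open>Complex Hilbert spaces\<close>

lemma cinner_add_right: "cinner x (y + z) = cinner x y + cinner x z"
  for x :: "'a::complex_hilbert_space"
  by (metis cinner_commute cinner_add_left complex_cnj_add)

lemma cinner_scaleC_right: "cinner x (z *\<^sub>C y) = cnj z * cinner x y"
  for x :: "'a::complex_hilbert_space"
  by (metis cinner_commute cinner_scaleC_left complex_cnj_mult)

lemma cinner_self: "cinner x x = complex_of_real ((norm x)\<^sup>2)"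
  for x :: "'a::complex_hilbert_space"
proof -
  have "Im (cinner x x) = 0"
    using cinner_commute[of x x] by (metis cnj.simps(2) equal_neg_zero)
  then show ?thesis
    by (simp add: complex_eq_iff norm_eq_sqrt_cinner cinner_nonneg)
qed

lemma cinner_scaleR_left: "cinner (r *\<^sub>R x) y = r *\<^sub>R cinner x y"
  for x :: "'a::complex_hilbert_space"
  by (metis scaleC_of_real cinner_scaleC_left scaleR_conv_of_real)

lemma cinner_scaleR_right: "cinner x (r *\<^sub>R y) = r *\<^sub>R cinner x y"
  for x :: "'a::complex_hilbert_space"
  by (metis scaleC_of_real cinner_scaleC_right scaleR_conv_of_real complex_cnj_complex_of_real)

lemma norm_scaleC: "norm (z *\<^sub>C x) = cmod z * norm x"
  for x :: "'a::complex_hilbert_space"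
proof -
  have "complex_of_real ((norm (z *\<^sub>C x))\<^sup>2) = z * cnj z * complex_of_real ((norm x)\<^sup>2)"
    by (simp only: cinner_self[symmetric] cinner_scaleC_left cinner_scaleC_right mult_ac)
  also have "\<dots> = complex_of_real ((cmod z * norm x)\<^sup>2)"
    by (simp only: complex_norm_square power_mult_distrib of_real_mult)
  finally show ?thesis
    by (metis of_real_eq_iff norm_ge_zero mult_nonneg_nonneg power2_eq_imp_eq)
qed

text \<open>
  Expand \<open>\<parallel>x - t w y\<parallel>\<^sup>2 \<ge> 0\<close> for \<open>w = (x | y)\<close> and the minimizing \<open>t = 1 / \<parallel>y\<parallel>\<^sup>2\<close>.
\<close>

lemma cinner_cauchy_schwarz: "cmod (cinner x y) \<le> norm x * norm y"
  for x :: "'a::complex_hilbert_space"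
proof (cases "y = 0")
  case True
  have "cinner x (0 *\<^sub>R y) = 0" by (simp only: cinner_scaleR_right) simp
  with True show ?thesis by simp
next
  case False
  define w where "w = cinner x y"
  define t where "t = 1 / (norm y)\<^sup>2"
  define u where "u = (- (complex_of_real t * w)) *\<^sub>C y"
  have ny: "norm y > 0" using False by simp
  have "complex_of_real ((norm (x + u))\<^sup>2) = cinner (x + u) (x + u)"
    by (rule cinner_self[symmetric])
  also have "\<dots> = complex_of_real ((norm x)\<^sup>2) + cinner x u + cinner u x + cinner u u"
    by (simp add: cinner_add_left cinner_add_right cinner_self[symmetric] del: of_real_power)
  also have "cinner x u = - complex_of_real t * (w * cnj w)"
    by (simp add: u_def cinner_scaleC_right w_def)
  also have "cinner u x = - complex_of_real t * (w * cnj w)"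
    by (simp add: u_def cinner_scaleC_left w_def cinner_commute[of y x])
  also have "cinner u u = complex_of_real (t\<^sup>2 * (norm y)\<^sup>2) * (w * cnj w)"
    by (simp add: u_def cinner_scaleC_left cinner_scaleC_right cinner_self[of y] power2_eq_square)
  also have "w * cnj w = complex_of_real ((cmod w)\<^sup>2)"
    by (simp only: complex_norm_square)
  finally have "complex_of_real ((norm (x + u))\<^sup>2) = complex_of_real ((norm x)\<^sup>2
      - 2 * t * (cmod w)\<^sup>2 + t\<^sup>2 * (norm y)\<^sup>2 * (cmod w)\<^sup>2)"
    by simp
  then have "(norm (x + u))\<^sup>2 = (norm x)\<^sup>2
      - 2 * t * (cmod w)\<^sup>2 + t\<^sup>2 * (norm y)\<^sup>2 * (cmod w)\<^sup>2"
    using of_real_eq_iff by blast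
  moreover have "t\<^sup>2 * (norm y)\<^sup>2 = t"
    using ny by (simp add: t_def power2_eq_square)
  ultimately have "0 \<le> (norm x)\<^sup>2 - t * (cmod w)\<^sup>2"
    using zero_le_power2[of "norm (x + u)"] by simp
  then have "(cmod w)\<^sup>2 \<le> (norm x * norm y)\<^sup>2"
    using ny by (simp add: t_def field_simps)
  then show ?thesis
    unfolding w_def by (rule power2_le_imp_le) simp
qed

interpretation cinner: bounded_bilinear "cinner :: 'a::complex_hilbert_space \<Rightarrow> 'a \<Rightarrow> complex"
proof
  show "\<exists>K. \<forall>a b. cmod (cinner (a::'a) b) \<le> norm a * norm b * K"
    by (rule exI[of _ 1]) (simp add: cinner_cauchy_schwarz)
qed (simp_all add: cinner_add_left cinner_add_right cinner_scaleR_left cinner_scaleR_right)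

interpretation scaleC:
  bounded_bilinear "scaleC :: complex \<Rightarrow> 'a \<Rightarrow> 'a::complex_hilbert_space"
proof
  show "\<exists>K. \<forall>a b. norm (a *\<^sub>C (b::'a)) \<le> norm a * norm b * K"
    by (rule exI[of _ 1]) (simp add: norm_scaleC)
  show "(r *\<^sub>R a) *\<^sub>C b = r *\<^sub>R (a *\<^sub>C b)" for r a and b :: 'a
    by (metis scaleC_of_real scaleC_scaleC scaleR_conv_of_real)
  show "a *\<^sub>C (r *\<^sub>R b) = r *\<^sub>R (a *\<^sub>C b)" for r a and b :: 'a
    by (metis scaleC_of_real scaleC_scaleC mult.commute)
qed (simp_all add: scaleC_add_left scaleC_add_right)

lemma scaleC_one: "1 *\<^sub>C x = (x :: 'a::complex_hilbert_space)"
  using scaleC_of_real[of 1 x] by simp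

text \<open>
  The principle by which operator norms are estimated throughout: it suffices to estimate scalar
  integrals against a test vector.
\<close>

lemma norm_le_of_cinner:
  fixes x :: "'a::complex_hilbert_space"
  assumes "\<And>y. cmod (cinner x y) \<le> B * norm y" and "0 \<le> B"
  shows "norm x \<le> B"
proof (cases "x = 0")
  case False
  have "norm x * norm x \<le> B * norm x"
    using assms(1)[of x] by (simp add: cinner_self norm_power power2_eq_square norm_mult)
  with False show ?thesis by simp
qed (use assms in simp)

lemma cinner_ext:
  fixes x z :: "'a::complex_hilbert_space"
  assumes "\<And>y. cinner x y = cinner z y"
  shows "x = z"
  using norm_le_of_cinner[of "x - z" 0] assms by (simp add: cinner.diff_left)

lemma bounded_clinear_linear: "bounded_clinear P \<Longrightarrow> bounded_linear P"
  by (simp add: bounded_clinear_def)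

lemma bounded_clinear_scaleC: "bounded_clinear P \<Longrightarrow> P (z *\<^sub>C x) = z *\<^sub>C P x"
  by (simp add: bounded_clinear_def)

section \<open>Vector-valued integrals\<close>

text \<open>
  The class of integrands: bounded, and continuous off finitely many points. It contains the orbits
  of a semigroup extended by zero to negative times, is stable under the operations needed, and is
  small enough for its members to be limits of simple functions even in a nonseparable space.
\<close>

definition tame :: "(real \<Rightarrow> 'b::real_normed_vector) \<Rightarrow> bool" where
  "tame f \<longleftrightarrow> bounded (range f) \<and> (\<exists>S. finite S \<and> continuous_on (- S) f)"

lemma tameI:
  assumes "finite S" "continuous_on (- S) f" "\<And>t. norm (f t) \<le> B"
  shows "tame f"
  using assms by (auto simp: tame_def bounded_iff)

lemma tame_bounded:
  assumes "tame f" obtains B where "\<And>t. norm (f t) \<le> B" "0 \<le> B"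
proof -
  obtain B where B: "\<And>t. norm (f t) \<le> B"
    using assms unfolding tame_def bounded_iff by auto
  moreover have "0 \<le> B" using B[of 0] norm_ge_zero order_trans by blast
  ultimately show thesis using that by blast
qed

text \<open>
  Sampling at the grid \<open>\<lfloor>n t\<rfloor> / n\<close> inside \<open>(-n, n)\<close> converges wherever the function is continuous.
  The exceptional points are sampled exactly, since they may be atoms of the measure.
\<close>

lemma tame_simple_approximation:
  fixes f :: "real \<Rightarrow> 'b::real_normed_vector"
  assumes "tame f"
  obtains \<kappa> :: "nat \<Rightarrow> real \<Rightarrow> real"
  where "\<And>n. \<kappa> n \<in> borel_measurable borel" "\<And>n. finite (range (\<kappa> n))"
    and "\<And>t. (\<lambda>n. f (\<kappa> n t)) \<longlonglongrightarrow> f t"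
proof -
  obtain S where S: "finite S" "continuous_on (- S) f"
    using assms by (auto simp: tame_def)
  define \<kappa> :: "nat \<Rightarrow> real \<Rightarrow> real" where
    "\<kappa> n t = (if t \<in> S then t else if \<bar>t\<bar> < real n then \<lfloor>real n * t\<rfloor> / real n else 0)" for n t
  have meas: "\<kappa> n \<in> borel_measurable borel" for n
  proof -
    have [measurable]: "S \<in> sets borel" using S(1) by (simp add: finite_imp_closed borel_closed)
    show ?thesis unfolding \<kappa>_def by measurable
  qed
  have fin: "finite (range (\<kappa> n))" for n
  proof (rule finite_subset)
    show "range (\<kappa> n) \<subseteq> S \<union> {0} \<union> (\<lambda>k. real_of_int k / real n) ` {- int (n * n) - 1 .. int (n * n)}"
    proof (rule image_subsetI)
      fix t :: real
      show "\<kappa> n t \<in> S \<union> {0} \<union> (\<lambda>k. real_of_int k / real n) ` {- int (n * n) - 1 .. int (n * n)}"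
      proof (cases "t \<notin> S \<and> \<bar>t\<bar> < real n")
        case True
        then have "real n * \<bar>t\<bar> \<le> real n * real n" by (intro mult_left_mono) auto
        then have "\<bar>real n * t\<bar> \<le> real (n * n)" by (simp add: abs_mult)
        then have "\<lfloor>real n * t\<rfloor> \<in> {- int (n * n) - 1 .. int (n * n)}"
          by (auto simp: floor_le_iff le_floor_iff)
        then show ?thesis using True by (auto simp: \<kappa>_def)
      qed (auto simp: \<kappa>_def)
    qed
    show "finite (S \<union> {0} \<union> (\<lambda>k. real_of_int k / real n) ` {- int (n * n) - 1 .. int (n * n)})"
      using S(1) by simp
  qed
  have "(\<lambda>n. f (\<kappa> n t)) \<longlonglongrightarrow> f t" for t
  proof (cases "t \<in> S")
    case False
    have "open (- S)" using S(1) by (simp add: finite_imp_closed open_Compl)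
    then have "isCont f t"
      using S(2) False continuous_on_eq_continuous_at by blast
    moreover have "(\<lambda>n. \<kappa> n t) \<longlonglongrightarrow> t"
    proof (rule tendstoI)
      fix e :: real assume "e > 0"
      have "\<forall>\<^sub>F n in sequentially. real n > \<bar>t\<bar> \<and> real n > 1 / e"
        by (intro eventually_conj eventually_compose_filterlim[OF eventually_gt_at_top
            filterlim_real_sequentially])
      then show "\<forall>\<^sub>F n in sequentially. dist (\<kappa> n t) t < e"
      proof eventually_elim
        case (elim n)
        then have n: "real n > 0" by auto
        have "\<bar>\<lfloor>real n * t\<rfloor> / real n - t\<bar> = \<bar>\<lfloor>real n * t\<rfloor> - real n * t\<bar> / real n"
          using n by (simp add: field_simps flip: abs_div_pos)
        also have "\<dots> \<le> 1 / real n"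
          using n by (intro divide_right_mono) linarith+
        also have "\<dots> < e" using elim n \<open>e > 0\<close> by (simp add: field_simps)
        finally show ?case using False elim by (simp add: \<kappa>_def dist_real_def)
      qed
    qed
    ultimately show ?thesis
      by (rule isCont_tendsto_compose)
  qed (simp add: \<kappa>_def)
  then show thesis using that meas fin by blast
qed

lemma tame_borel_measurable:
  fixes f :: "real \<Rightarrow> 'b::real_normed_vector"
  assumes "tame f"
  shows "f \<in> borel_measurable borel"
proof -
  obtain \<kappa> :: "nat \<Rightarrow> real \<Rightarrow> real" where \<kappa>: "\<And>n. \<kappa> n \<in> borel_measurable borel"
    "\<And>n. finite (range (\<kappa> n))" "\<And>t. (\<lambda>n. f (\<kappa> n t)) \<longlonglongrightarrow> f t"
    using tame_simple_approximation[OF assms] by metis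
  have "simple_function borel (\<lambda>t. f (\<kappa> n t))" for n
    by (intro simple_function_compose1[where f="\<kappa> n" and g = f] simple_function_borel_measurable)
       (simp_all add: \<kappa>)
  then have "(\<lambda>t. f (\<kappa> n t)) \<in> borel_measurable borel" for n
    by (rule borel_measurable_simple_function)
  then show ?thesis
    by (rule borel_measurable_LIMSEQ_metric) (rule \<kappa>(3))
qed

lemma tame_diff:
  assumes "tame f" "tame g" shows "tame (\<lambda>t. f t - g t)"
proof -
  obtain S1 where S1: "finite S1" "continuous_on (- S1) f" using assms by (auto simp: tame_def)
  obtain S2 where S2: "finite S2" "continuous_on (- S2) g" using assms by (auto simp: tame_def)
  obtain B1 B2 where B: "\<And>t. norm (f t) \<le> B1" "\<And>t. norm (g t) \<le> B2"
    using tame_bounded assms by metis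
  show ?thesis
  proof (rule tameI)
    show "finite (S1 \<union> S2)" using S1 S2 by simp
    show "continuous_on (- (S1 \<union> S2)) (\<lambda>t. f t - g t)"
      by (intro continuous_on_diff continuous_on_subset[OF S1(2)] continuous_on_subset[OF S2(2)]) auto
    show "norm (f t - g t) \<le> B1 + B2" for t
      using norm_triangle_ineq4[of "f t" "g t"] B[of t] by linarith
  qed
qed

lemma tame_linear:
  assumes "bounded_linear P" "tame f" shows "tame (\<lambda>t. P (f t))"
proof -
  obtain S where S: "finite S" "continuous_on (- S) f" using assms by (auto simp: tame_def)
  have "continuous_on (- S) (\<lambda>t. P (f t))"
    by (rule bounded_linear.continuous_on[OF assms(1) S(2)])
  moreover have "bounded (range (\<lambda>t. P (f t)))"
    using bounded_linear_image[OF _ assms(1), of "range f"] assms(2)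
    by (simp add: tame_def image_image)
  ultimately show ?thesis using S(1) by (auto simp: tame_def)
qed

lemma tame_norm:
  assumes "tame f" shows "tame (\<lambda>t. norm (f t))"
proof -
  obtain S where S: "finite S" "continuous_on (- S) f" using assms by (auto simp: tame_def)
  then show ?thesis using assms by (auto simp: tame_def bounded_iff intro!: continuous_on_norm)
qed

lemma tame_shift:
  assumes "tame f" shows "tame (\<lambda>t. f (a + t))"
proof -
  obtain S where S: "finite S" "continuous_on (- S) f" using assms by (auto simp: tame_def)
  have "continuous_on (- ((\<lambda>x. x - a) ` S)) (\<lambda>t. f (a + t))"
  proof (rule continuous_on_compose2[OF S(2)])
    show "(+) a ` (- (\<lambda>x. x - a) ` S) \<subseteq> - S"
      by (auto simp: image_iff) (metis add_diff_cancel_left')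
  qed (intro continuous_intros)
  moreover have "bounded (range (\<lambda>t. f (a + t)))"
    using assms unfolding tame_def by (auto intro: bounded_subset)
  ultimately show ?thesis using S(1) by (auto simp: tame_def)
qed

text \<open>
  Apply the operator to the approximating simple functions. The difference of a measurable and a
  simple function is handled value by value, since in a nonseparable space differences of measurable
  functions may fail to be measurable.
\<close>

lemma has_strong_integral_linear:
  fixes P :: "'a::real_normed_vector \<Rightarrow> 'b::real_normed_vector"
  assumes P: "bounded_linear P" and h: "has_strong_integral M f v"
  shows "has_strong_integral M (\<lambda>x. P (f x)) (P v)"
proof -
  interpret P: bounded_linear P by fact
  obtain s where s: "\<And>i. Bochner_Integration.simple_bochner_integrable M (s i)"
    "(\<lambda>i. \<integral>\<^sup>+x. norm (f x - s i x) \<partial>M) \<longlonglongrightarrow> 0"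
    "(\<lambda>i. Bochner_Integration.simple_bochner_integral M (s i)) \<longlonglongrightarrow> v"
    and f: "f \<in> borel_measurable M"
    using h by (auto simp: has_strong_integral_def)
  obtain K where K: "K \<ge> 0" "\<And>x. norm (P x) \<le> norm x * K"
    using P.nonneg_bounded by auto
  have "(\<lambda>x. P (f x)) \<in> borel_measurable M"
    by (rule borel_measurable_continuous_on[OF P.continuous_on[OF continuous_on_id] f])
  moreover have "Bochner_Integration.simple_bochner_integrable M (\<lambda>x. P (s i x))" for i
    by (rule Bochner_Integration.simple_bochner_integrable_compose2[where p="\<lambda>x y. P x", OF _ s(1) s(1)])
      (simp add: P.zero)
  moreover have "(\<lambda>i. \<integral>\<^sup>+x. norm (P (f x) - P (s i x)) \<partial>M) \<longlonglongrightarrow> 0"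
  proof (rule tendsto_sandwich[OF _ _ tendsto_const])
    show "\<forall>\<^sub>F i in sequentially. (\<integral>\<^sup>+x. norm (P (f x) - P (s i x)) \<partial>M)
        \<le> ennreal K * (\<integral>\<^sup>+x. norm (f x - s i x) \<partial>M)"
    proof (rule always_eventually, rule allI)
      fix i
      have le: "ennreal (norm (P (f x) - P (s i x))) \<le> ennreal K * ennreal (norm (f x - s i x))" for x
        using K(2)[of "f x - s i x"] K(1)
        by (simp add: P.diff ennreal_mult[symmetric] mult.commute ennreal_leI)
      have eq: "(\<integral>\<^sup>+x. ennreal K * ennreal (norm (f x - s i x)) \<partial>M)
          = ennreal K * (\<integral>\<^sup>+x. norm (f x - s i x) \<partial>M)"
      proof (rule nn_integral_cmult)
        have "simple_function M (s i)" using s(1) by (auto elim: Bochner_Integration.simple_bochner_integrable.cases)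
        then have fin: "finite (s i ` space M)" and
          pre: "\<And>y. y \<in> s i ` space M \<Longrightarrow> s i -` {y} \<inter> space M \<in> sets M"
          by (auto simp: simple_function_def)
        have "(\<lambda>x. \<Sum>y\<in>s i ` space M. indicator (s i -` {y} \<inter> space M) x *\<^sub>R norm (f x - y))
            \<in> borel_measurable M"
        proof (intro borel_measurable_sum borel_measurable_scaleR borel_measurable_indicator pre)
          show "(\<lambda>x. norm (f x - y)) \<in> borel_measurable M" for y
            by (rule borel_measurable_continuous_on[OF _ f]) (intro continuous_intros)
        qed
        moreover have "(\<Sum>y\<in>s i ` space M. indicator (s i -` {y} \<inter> space M) x *\<^sub>R norm (f x - y))
            = norm (f x - s i x)" if "x \<in> space M" for x
        proof -
          have "(\<Sum>y\<in>s i ` space M. indicator (s i -` {y} \<inter> space M) x *\<^sub>R norm (f x - y))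
            = (\<Sum>y\<in>{s i x}. indicator (s i -` {y} \<inter> space M) x *\<^sub>R norm (f x - y))"
            using that fin by (intro sum.mono_neutral_right) (auto simp: indicator_def)
          then show ?thesis using that by simp
        qed
        ultimately show "(\<lambda>x. ennreal (norm (f x - s i x))) \<in> borel_measurable M"
          by (intro measurable_compose[OF _ measurable_ennreal]) (simp cong: measurable_cong_simp)
      qed
      show "(\<integral>\<^sup>+x. norm (P (f x) - P (s i x)) \<partial>M)
        \<le> ennreal K * (\<integral>\<^sup>+x. norm (f x - s i x) \<partial>M)"
        unfolding eq[symmetric] by (rule nn_integral_mono) (rule le)
    qed
    show "(\<lambda>i. ennreal K * (\<integral>\<^sup>+x. norm (f x - s i x) \<partial>M)) \<longlonglongrightarrow> 0"
      using ennreal_tendsto_cmult[OF _ s(2), of "ennreal K"] by simp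
  qed simp
  moreover have "(\<lambda>i. Bochner_Integration.simple_bochner_integral M (\<lambda>x. P (s i x))) \<longlonglongrightarrow> P v"
  proof -
    have "Bochner_Integration.simple_bochner_integral M (\<lambda>x. P (s i x))
        = P (Bochner_Integration.simple_bochner_integral M (s i))" for i
      by (rule Bochner_Integration.simple_bochner_integral_linear) (use s(1) in \<open>auto simp: P.linear_axioms\<close>)
    then show ?thesis using P.tendsto[OF s(3)] by simp
  qed
  ultimately show ?thesis
    unfolding has_strong_integral_def by (intro conjI exI[of _ "\<lambda>i x. P (s i x)"]) auto
qed

text \<open>
  Simple approximations of the scalar weight, dominated by twice its modulus, and of the tame factor
  multiply to simple functions that converge in mean; their integrals are a Cauchy sequence.
\<close>

lemma has_strong_integral_weighted_ex:
  fixes f :: "real \<Rightarrow> 'a::complex_hilbert_space" and g :: "real \<Rightarrow> complex"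
  assumes sets: "sets M = sets borel" and g: "integrable M g" and f: "tame f"
  shows "\<exists>v. has_strong_integral M (\<lambda>s. g s *\<^sub>C f s) v"
proof -
  have space: "space M = UNIV" using sets_eq_imp_space_eq[OF sets] by simp
  obtain \<kappa> :: "nat \<Rightarrow> real \<Rightarrow> real" where \<kappa>: "\<And>n. \<kappa> n \<in> borel_measurable borel"
    "\<And>n. finite (range (\<kappa> n))" "\<And>t. (\<lambda>n. f (\<kappa> n t)) \<longlonglongrightarrow> f t"
    using tame_simple_approximation[OF f] by metis
  obtain B where B: "\<And>t. norm (f t) \<le> B" "0 \<le> B" using tame_bounded[OF f] by metis
  obtain q where q: "\<And>i. simple_function M (q i)" "\<And>i. emeasure M {y \<in> space M. q i y \<noteq> 0} \<noteq> \<infinity>"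
    "\<And>x. x \<in> space M \<Longrightarrow> (\<lambda>i. q i x) \<longlonglongrightarrow> g x"
    "\<And>i x. x \<in> space M \<Longrightarrow> norm (q i x) \<le> 2 * norm (g x)"
    by (rule integrable_implies_simple_function_sequence[OF g]) blast
  note q = q(1,2) q(3,4)[unfolded space, OF UNIV_I]
  define s where "s i t = q i t *\<^sub>C f (\<kappa> i t)" for i t
  have simp_f: "simple_function M (\<lambda>t. f (\<kappa> i t))" for i
  proof (rule simple_function_compose1[where f="\<kappa> i" and g = f], rule simple_function_borel_measurable)
    show "\<kappa> i \<in> borel_measurable M" using \<kappa>(1) sets by (simp cong: measurable_cong_sets)
  qed (simp add: space \<kappa>(2))
  have simp_s: "simple_function M (s i)" for i
    unfolding s_def by (rule simple_function_compose2[OF q(1) simp_f])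
  have sbi: "Bochner_Integration.simple_bochner_integrable M (s i)" for i
  proof (rule Bochner_Integration.simple_bochner_integrable.intros[OF simp_s])
    have "emeasure M {y \<in> space M. s i y \<noteq> 0} \<le> emeasure M {y \<in> space M. q i y \<noteq> 0}"
    proof (rule emeasure_mono)
      show "{y \<in> space M. q i y \<noteq> 0} \<in> sets M"
        using borel_measurable_simple_function[OF q(1)[of i]] by measurable
    qed (auto simp: s_def scaleC.zero_left)
    then show "emeasure M {y \<in> space M. s i y \<noteq> 0} \<noteq> \<infinity>"
      using q(2)[of i] by (auto simp: top_unique)
  qed
  have s_lim: "(\<lambda>i. s i t) \<longlonglongrightarrow> g t *\<^sub>C f t" for t
    unfolding s_def by (rule scaleC.tendsto[OF q(3) \<kappa>(3)])
  have s_bound: "norm (s i t) \<le> 2 * norm (g t) * B" for i t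
    unfolding s_def norm_scaleC by (intro mult_mono B q(4)) auto
  have meas: "(\<lambda>s. g s *\<^sub>C f s) \<in> borel_measurable M"
    using borel_measurable_simple_function[OF simp_s] s_lim
    by (rule borel_measurable_LIMSEQ_metric)
  have meas_diff: "(\<lambda>t. norm (g t *\<^sub>C f t - s i t)) \<in> borel_measurable M" for i
  proof (rule borel_measurable_LIMSEQ_metric)
    show "(\<lambda>t. norm (s j t - s i t)) \<in> borel_measurable M" for j
      by (rule borel_measurable_simple_function,
          rule simple_function_compose2[OF simp_s simp_s, where h="\<lambda>x y. norm (x - y)"])
    show "(\<lambda>j. norm (s j t - s i t)) \<longlonglongrightarrow> norm (g t *\<^sub>C f t - s i t)" for t
      by (intro tendsto_intros s_lim)
  qed
  have conv: "(\<lambda>i. \<integral>\<^sup>+t. norm (g t *\<^sub>C f t - s i t) \<partial>M) \<longlonglongrightarrow> 0"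
  proof -
    have "(\<lambda>i. \<integral>\<^sup>+t. norm (g t *\<^sub>C f t - s i t) \<partial>M) \<longlonglongrightarrow> (\<integral>\<^sup>+t. 0 \<partial>M)"
    proof (rule nn_integral_dominated_convergence[where w="\<lambda>t. ennreal (3 * B * norm (g t))"])
      show "(\<lambda>t. ennreal (norm (g t *\<^sub>C f t - s i t))) \<in> borel_measurable M" for i
        using meas_diff[of i] by measurable
      have "integrable M (\<lambda>t. 3 * B * norm (g t))" using g by simp
      then show "(\<integral>\<^sup>+t. ennreal (3 * B * norm (g t)) \<partial>M) < \<infinity>"
        using B(2) by (subst nn_integral_eq_integral) auto
      show "AE t in M. ennreal (norm (g t *\<^sub>C f t - s i t)) \<le> ennreal (3 * B * norm (g t))" for i
      proof (rule AE_I2, rule ennreal_leI)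
        fix t
        have "norm (g t *\<^sub>C f t - s i t) \<le> norm (g t *\<^sub>C f t) + norm (s i t)"
          by (rule norm_triangle_ineq4)
        also have "\<dots> \<le> norm (g t) * B + 2 * norm (g t) * B"
          unfolding norm_scaleC[of "g t"] by (intro add_mono mult_left_mono B s_bound) auto
        finally show "norm (g t *\<^sub>C f t - s i t) \<le> 3 * B * norm (g t)" by (simp add: algebra_simps)
      qed
      show "AE t in M. (\<lambda>i. ennreal (norm (g t *\<^sub>C f t - s i t))) \<longlonglongrightarrow> 0"
      proof (rule AE_I2)
        fix t
        have "(\<lambda>i. norm (g t *\<^sub>C f t - s i t)) \<longlonglongrightarrow> norm (g t *\<^sub>C f t - g t *\<^sub>C f t)"
          by (intro tendsto_intros s_lim)
        then show "(\<lambda>i. ennreal (norm (g t *\<^sub>C f t - s i t))) \<longlonglongrightarrow> 0"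
          using tendsto_ennrealI by fastforce
      qed
    qed (use g in measurable)
    then show ?thesis by simp
  qed
  define I where "I i = Bochner_Integration.simple_bochner_integral M (s i)" for i
  have "Cauchy I"
  proof (rule metric_CauchyI)
    fix e :: real assume e: "e > 0"
    have "\<forall>\<^sub>F i in sequentially. (\<integral>\<^sup>+t. norm (g t *\<^sub>C f t - s i t) \<partial>M) < ennreal (e / 2)"
      using order_tendstoD(2)[OF conv, of "ennreal (e/2)"] e by simp
    then obtain N where N: "\<And>i. i \<ge> N \<Longrightarrow> (\<integral>\<^sup>+t. norm (g t *\<^sub>C f t - s i t) \<partial>M) < ennreal (e / 2)"
      by (auto simp: eventually_sequentially)
    have "dist (I i) (I j) < e" if "i \<ge> N" "j \<ge> N" for i j
    proof -
      have sb: "Bochner_Integration.simple_bochner_integrable M (\<lambda>t. s i t - s j t)"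
        by (rule Bochner_Integration.simple_bochner_integrable_compose2[where p=minus, OF _ sbi sbi]) simp
      have "ennreal (norm (I i - I j)) =
          ennreal (norm (Bochner_Integration.simple_bochner_integral M (\<lambda>t. s i t - s j t)))"
        by (simp add: I_def Bochner_Integration.simple_bochner_integral_diff[OF sbi sbi])
      also have "\<dots> \<le> ennreal (Bochner_Integration.simple_bochner_integral M (\<lambda>t. norm (s i t - s j t)))"
        by (intro ennreal_leI Bochner_Integration.simple_bochner_integral_norm_bound sb)
      also have "\<dots> = (\<integral>\<^sup>+t. norm (s i t - s j t) \<partial>M)"
        by (intro Bochner_Integration.simple_bochner_integral_eq_nn_integral
            Bochner_Integration.simple_bochner_integrable_compose2[where p="\<lambda>x y. norm (x - y)", OF _ sbi sbi]) auto
      also have "\<dots> \<le> (\<integral>\<^sup>+t. ennreal (norm (g t *\<^sub>C f t - s i t)) + ennreal (norm (g t *\<^sub>C f t - s j t)) \<partial>M)"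
      proof (rule nn_integral_mono)
        fix t
        have "norm (s i t - s j t) \<le> norm (g t *\<^sub>C f t - s i t) + norm (g t *\<^sub>C f t - s j t)"
          using norm_triangle_ineq4[of "g t *\<^sub>C f t - s j t" "g t *\<^sub>C f t - s i t"] by simp
        then show "ennreal (norm (s i t - s j t)) \<le>
            ennreal (norm (g t *\<^sub>C f t - s i t)) + ennreal (norm (g t *\<^sub>C f t - s j t))"
          by (simp flip: ennreal_plus add: ennreal_leI)
      qed
      also have "\<dots> = (\<integral>\<^sup>+t. norm (g t *\<^sub>C f t - s i t) \<partial>M) + (\<integral>\<^sup>+t. norm (g t *\<^sub>C f t - s j t) \<partial>M)"
        by (intro nn_integral_add measurable_compose[OF meas_diff measurable_ennreal])
      also have "\<dots> < ennreal (e / 2) + ennreal (e / 2)"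
        using N that by (intro add_strict_mono) auto
      also have "\<dots> = ennreal e" using e by (simp flip: ennreal_plus)
      finally show ?thesis using e by (simp add: dist_norm ennreal_less_iff)
    qed
    then show "\<exists>N. \<forall>i\<ge>N. \<forall>j\<ge>N. dist (I i) (I j) < e" by blast
  qed
  then obtain v where "I \<longlonglongrightarrow> v" using Cauchy_convergent_iff convergent_def by blast
  then show ?thesis
    unfolding has_strong_integral_def I_def using meas sbi conv by blast
qed

lemma has_strong_integral_cinner:
  assumes "has_strong_integral M f v"
  shows "cinner v y = (\<integral>x. cinner (f x) y \<partial>M)"
    and "integrable M (\<lambda>x. cinner (f x) y)"
proof -
  have "has_strong_integral M (\<lambda>x. cinner (f x) y) (cinner v y)"
    by (rule has_strong_integral_linear[OF cinner.bounded_linear_left assms])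
  then have "has_bochner_integral M (\<lambda>x. cinner (f x) y) (cinner v y)"
    by (auto simp: has_strong_integral_def has_bochner_integral.simps)
  then show "cinner v y = (\<integral>x. cinner (f x) y \<partial>M)" "integrable M (\<lambda>x. cinner (f x) y)"
    by (auto simp: has_bochner_integral_iff)
qed

lemma strong_integral_eqI:
  fixes f :: "'b \<Rightarrow> 'a::complex_hilbert_space"
  assumes "has_strong_integral M f v"
  shows "strong_integral M f = v"
proof -
  have "w = v" if "has_strong_integral M f w" for w
    by (rule cinner_ext) (simp add: has_strong_integral_cinner(1)[OF assms]
        has_strong_integral_cinner(1)[OF that])
  with assms have "(THE y. has_strong_integral M f y) = v"
    by (rule the_equality)
  moreover have "\<exists>y. has_strong_integral M f y" using assms ..
  ultimately show ?thesis
    unfolding strong_integral_def by (simp only: if_True)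
qed

text \<open>
  The integral of a vector-valued function with a complex weight; the weight is a density
  with respect to Lebesgue measure or a constant coefficient of a finite measure.
\<close>

definition vint :: "real measure \<Rightarrow> (real \<Rightarrow> complex) \<Rightarrow> (real \<Rightarrow> 'a) \<Rightarrow> 'a::complex_hilbert_space"
  where "vint M g f = strong_integral M (\<lambda>s. g s *\<^sub>C f s)"

context
  fixes M :: "real measure" and g :: "real \<Rightarrow> complex"
    and f :: "real \<Rightarrow> 'a::complex_hilbert_space"
  assumes sets: "sets M = sets borel" and g: "integrable M g" and f: "tame f"
begin

lemma has_strong_integral_vint: "has_strong_integral M (\<lambda>s. g s *\<^sub>C f s) (vint M g f)"
  using has_strong_integral_weighted_ex[OF sets g f] strong_integral_eqI
  unfolding vint_def by metis

lemma cinner_vint: "cinner (vint M g f) y = (\<integral>s. g s * cinner (f s) y \<partial>M)"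
  using has_strong_integral_cinner(1)[OF has_strong_integral_vint] by (simp add: cinner_scaleC_left)

lemma integrable_weighted_cinner: "integrable M (\<lambda>s. g s * cinner (f s) y)"
  using has_strong_integral_cinner(2)[OF has_strong_integral_vint] by (simp add: cinner_scaleC_left)

lemma vint_linear:
  assumes P: "bounded_clinear P"
  shows "P (vint M g f) = vint M g (\<lambda>s. P (f s))"
proof -
  have "has_strong_integral M (\<lambda>s. P (g s *\<^sub>C f s)) (P (vint M g f))"
    by (rule has_strong_integral_linear[OF bounded_clinear_linear[OF P] has_strong_integral_vint])
  then show ?thesis
    using strong_integral_eqI[of M "\<lambda>s. P (g s *\<^sub>C f s)"]
    by (simp add: vint_def bounded_clinear_scaleC[OF P])
qed

lemma integrable_weighted_norm: "integrable M (\<lambda>s. cmod (g s) * norm (f s))"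
proof -
  obtain B where B: "\<And>t. norm (f t) \<le> B" "0 \<le> B" using tame_bounded[OF f] by metis
  have [measurable]: "(\<lambda>s. norm (f s)) \<in> borel_measurable M"
    using tame_borel_measurable[OF tame_norm[OF f]] sets by (simp cong: measurable_cong_sets)
  show ?thesis
  proof (rule Bochner_Integration.integrable_bound)
    show "integrable M (\<lambda>s. B * cmod (g s))" using g by simp
    show "AE s in M. norm (cmod (g s) * norm (f s)) \<le> norm (B * cmod (g s))"
      using B by (intro AE_I2) (auto simp: mult.commute intro!: mult_right_mono)
  qed (use g in measurable)
qed

lemma norm_vint_le: "norm (vint M g f) \<le> (\<integral>s. cmod (g s) * norm (f s) \<partial>M)"
proof (rule norm_le_of_cinner)
  fix y
  have "cmod (cinner (vint M g f) y) \<le> (\<integral>s. cmod (g s * cinner (f s) y) \<partial>M)"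
    unfolding cinner_vint by (rule integral_norm_bound)
  also have "\<dots> \<le> (\<integral>s. (cmod (g s) * norm (f s)) * norm y \<partial>M)"
  proof (rule integral_mono)
    show "integrable M (\<lambda>s. cmod (g s * cinner (f s) y))"
      using integrable_weighted_cinner by simp
    show "cmod (g s * cinner (f s) y) \<le> cmod (g s) * norm (f s) * norm y" for s
      unfolding norm_mult mult.assoc by (intro mult_left_mono cinner_cauchy_schwarz) simp
  qed (use integrable_weighted_norm in simp)
  finally show "cmod (cinner (vint M g f) y) \<le> (\<integral>s. cmod (g s) * norm (f s) \<partial>M) * norm y"
    by simp
qed (auto intro!: integral_nonneg_AE)

end

section \<open>Plancherel's theorem\<close>

abbreviation wave :: "real \<Rightarrow> real \<Rightarrow> complex" where
  "wave \<xi> t \<equiv> exp (- \<i> * complex_of_real \<xi> * complex_of_real t)"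

lemma integrable_product:
  fixes f :: "'b \<Rightarrow> complex" and g :: "'c \<Rightarrow> complex"
  assumes "sigma_finite_measure M" "sigma_finite_measure N"
    and f: "integrable M f" and g: "integrable N g"
  shows "integrable (M \<Otimes>\<^sub>M N) (\<lambda>p. f (fst p) * g (snd p))"
proof -
  interpret M: sigma_finite_measure M by fact
  interpret N: sigma_finite_measure N by fact
  interpret pair_sigma_finite M N ..
  have [measurable]: "f \<in> borel_measurable M" "g \<in> borel_measurable N" using f g by auto
  show ?thesis
  proof (rule Fubini_integrable)
    show "integrable M (\<lambda>x. \<integral>y. norm (f (fst (x, y)) * g (snd (x, y))) \<partial>N)"
      using f by (simp add: norm_mult)
    show "AE x in M. integrable N (\<lambda>y. f (fst (x, y)) * g (snd (x, y)))"
      using g by simp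
  qed measurable
qed

text \<open>
  Composition with the inner product is applied to the finitely valued approximations, since the
  Borel sets of the product space need not be generated by rectangles.
\<close>

lemma tame_pair_measurable:
  fixes F G :: "real \<Rightarrow> 'a::complex_hilbert_space"
  assumes F: "tame F" and G: "tame G"
  shows "(\<lambda>p. cinner (F (fst p)) (G (snd p))) \<in> borel_measurable (borel \<Otimes>\<^sub>M borel)"
proof -
  obtain \<kappa> :: "nat \<Rightarrow> real \<Rightarrow> real" where \<kappa>: "\<And>n. \<kappa> n \<in> borel_measurable borel"
    "\<And>n. finite (range (\<kappa> n))" "\<And>t. (\<lambda>n. F (\<kappa> n t)) \<longlonglongrightarrow> F t"
    using tame_simple_approximation[OF F] by metis
  obtain l :: "nat \<Rightarrow> real \<Rightarrow> real" where l: "\<And>n. l n \<in> borel_measurable borel"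
    "\<And>n. finite (range (l n))" "\<And>t. (\<lambda>n. G (l n t)) \<longlonglongrightarrow> G t"
    using tame_simple_approximation[OF G] by metis
  have s1: "simple_function (borel \<Otimes>\<^sub>M borel) (\<lambda>p. \<kappa> n (fst p))" for n
  proof (rule simple_function_borel_measurable)
    show "finite ((\<lambda>p. \<kappa> n (fst p)) ` space (borel \<Otimes>\<^sub>M borel))"
      by (rule finite_subset[OF _ \<kappa>(2)[of n]]) auto
  qed (use \<kappa>(1) in measurable)
  have s2: "simple_function (borel \<Otimes>\<^sub>M borel) (\<lambda>p. l n (snd p))" for n
  proof (rule simple_function_borel_measurable)
    show "finite ((\<lambda>p. l n (snd p)) ` space (borel \<Otimes>\<^sub>M borel))"
      by (rule finite_subset[OF _ l(2)[of n]]) auto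
  qed (use l(1) in measurable)
  show ?thesis
  proof (rule borel_measurable_LIMSEQ_metric)
    show "(\<lambda>p. cinner (F (\<kappa> n (fst p))) (G (l n (snd p)))) \<in> borel_measurable (borel \<Otimes>\<^sub>M borel)" for n
      by (rule borel_measurable_simple_function,
          rule simple_function_compose2[OF s1 s2, where h="\<lambda>x y. cinner (F x) (G y)"])
    show "(\<lambda>n. cinner (F (\<kappa> n (fst p))) (G (l n (snd p)))) \<longlonglongrightarrow> cinner (F (fst p)) (G (snd p))" for p
      by (intro cinner.tendsto \<kappa> l)
  qed
qed

lemma tame_continuous_AE:
  assumes "tame f" shows "AE t in lborel. isCont f t"
proof -
  obtain S where S: "finite S" "continuous_on (- S) f" using assms by (auto simp: tame_def)
  have "AE t in lborel. t \<notin> S"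
    using finite_imp_null_set_lborel[OF S(1)] by (rule AE_not_in)
  moreover have "open (- S)" using S(1) by (simp add: finite_imp_closed open_Compl)
  ultimately show ?thesis
    using S(2) by (auto elim!: eventually_mono simp: continuous_on_eq_continuous_at)
qed

lemma gaussian_integrable: "integrable lborel (\<lambda>v::real. exp (- v\<^sup>2 / 2))"
  and gaussian_integral: "(\<integral>v. exp (- (v::real)\<^sup>2 / 2) \<partial>lborel) = sqrt (2 * pi)"
proof -
  have eq: "exp (- v\<^sup>2 / 2) = sqrt (2 * pi) * std_normal_density v" for v :: real
    by (simp add: std_normal_density_def)
  have "integrable lborel std_normal_density"
    using integrable_std_normal_moment[of 0] by simp
  then show "integrable lborel (\<lambda>v::real. exp (- v\<^sup>2 / 2))" unfolding eq by simp
  have "(\<integral>v. std_normal_density v \<partial>lborel) = 1"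
    using integral_std_normal_moment_even[of 0] by simp
  then show "(\<integral>v. exp (- (v::real)\<^sup>2 / 2) \<partial>lborel) = sqrt (2 * pi)" unfolding eq by simp
qed

text \<open>
  The characteristic function of the standard normal distribution, rescaled.
\<close>

lemma gaussian_fourier:
  fixes n v :: real assumes n: "n > 0"
  shows "(\<integral>s. complex_of_real (exp (- (s / n)\<^sup>2 / 2)) * wave v s \<partial>lborel)
    = complex_of_real (sqrt (2 * pi) * n * exp (- (n * v)\<^sup>2 / 2))"
proof -
  have "(\<integral>s. complex_of_real (exp (- (s / n)\<^sup>2 / 2)) * wave v s \<partial>lborel)
    = n *\<^sub>R (\<integral>x. complex_of_real (exp (- x\<^sup>2 / 2)) * wave v (n * x) \<partial>lborel)"
    using n by (subst lborel_integral_real_affine[where c=n and t=0]) auto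
  also have "(\<lambda>x. complex_of_real (exp (- x\<^sup>2 / 2)) * wave v (n * x))
      = (\<lambda>x. complex_of_real (sqrt (2 * pi)) * (std_normal_density x *\<^sub>R iexp (- (n * v) * x)))"
    by (auto simp: std_normal_density_def scaleR_conv_of_real mult_ac simp flip: of_real_mult)
  also have "(\<integral>x. complex_of_real (sqrt (2 * pi)) * (std_normal_density x *\<^sub>R iexp (- (n * v) * x)) \<partial>lborel)
      = complex_of_real (sqrt (2 * pi)) * char std_normal_distribution (- (n * v))"
    unfolding char_def integral_mult_right_zero
    by (subst integral_density) (auto simp: normal_density_nonneg)
  finally show ?thesis
    using n by (simp add: char_std_normal_distribution scaleR_conv_of_real mult_ac)
qed

lemma gaussian_integrable_scaled:
  fixes n :: real assumes n: "n > 0"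
  shows "integrable lborel (\<lambda>s. exp (- (s / n)\<^sup>2 / 2))"
  using lborel_integrable_real_affine[OF gaussian_integrable, of "1/n" 0] n by simp

context
  fixes F Fh :: "real \<Rightarrow> 'a::complex_hilbert_space"
  assumes F: "tame F" and F_int: "integrable lborel (\<lambda>t. norm (F t))"
    and Fh: "\<And>s y. cinner (Fh s) y
      = (\<integral>t. wave s t * cinner (F t) y \<partial>lborel)"
begin

private definition H where "H p = cinner (F (fst p)) (F (snd p))" for p

private definition e :: "real \<Rightarrow> real \<Rightarrow> complex" where
  "e s t = wave s t"

private lemma e_meas: "(\<lambda>(s,t). e s t) \<in> borel_measurable (borel \<Otimes>\<^sub>M borel)"
  unfolding e_def split_beta by measurable

private lemma norm_e [simp]: "cmod (e s t) = 1"
  by (simp add: e_def norm_exp_eq_Re)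

private lemma H_meas: "H \<in> borel_measurable (borel \<Otimes>\<^sub>M borel)"
  unfolding H_def by (rule tame_pair_measurable[OF F F])

private lemma H_int: "integrable (lborel \<Otimes>\<^sub>M lborel) H"
proof (rule Bochner_Integration.integrable_bound)
  have 1: "integrable lborel (\<lambda>t. complex_of_real (norm (F t)))" using F_int by simp
  show "integrable (lborel \<Otimes>\<^sub>M lborel)
      (\<lambda>p. complex_of_real (norm (F (fst p))) * complex_of_real (norm (F (snd p))))"
    by (rule integrable_product[OF _ _ 1 1]) (rule lborel.sigma_finite_measure_axioms)+
  show "AE p in lborel \<Otimes>\<^sub>M lborel. norm (H p)
    \<le> norm (complex_of_real (norm (F (fst p))) * complex_of_real (norm (F (snd p))))"
    by (rule AE_I2) (simp add: H_def norm_mult cinner_cauchy_schwarz)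
qed (use H_meas in simp)

text \<open>
  The squared norm of the transform, written as an integral of the kernel \<open>(F t | F u)\<close> over the plane;
  this removes the vector-valued integrals from Plancherel's theorem.
\<close>

private lemma norm_Fh: "complex_of_real ((norm (Fh s))\<^sup>2)
   = (\<integral>p. e s (fst p - snd p) * H p \<partial>(lborel \<Otimes>\<^sub>M lborel))"
proof -
  have [measurable]: "H \<in> borel_measurable (borel \<Otimes>\<^sub>M borel)" by (rule H_meas)
  have em[measurable]: "(\<lambda>t. e s (f t)) \<in> borel_measurable M" if "f \<in> borel_measurable M" for f M
    unfolding e_def using that by measurable
  have int: "integrable (lborel \<Otimes>\<^sub>M lborel) (\<lambda>p. e s (fst p - snd p) * H p)"
    by (rule Bochner_Integration.integrable_bound[OF H_int]) (auto simp: norm_mult)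
  have "complex_of_real ((norm (Fh s))\<^sup>2) = (\<integral>t. e s t * cinner (F t) (Fh s) \<partial>lborel)"
    using Fh[of s "Fh s"] by (simp add: cinner_self e_def)
  also have "\<dots> = (\<integral>t. (\<integral>u. e s (t - u) * H (t, u) \<partial>lborel) \<partial>lborel)"
  proof (rule Bochner_Integration.integral_cong[OF refl])
    fix t
    have "cinner (F t) (Fh s) = cnj (\<integral>u. e s u * cinner (F u) (F t) \<partial>lborel)"
      using Fh[of s "F t"] by (simp add: cinner_commute[of "F t"] e_def)
    also have "\<dots> = (\<integral>u. cnj (e s u * cinner (F u) (F t)) \<partial>lborel)"
      by (rule Bochner_Integration.integral_cnj[symmetric])
    also have "\<dots> = (\<integral>u. cnj (e s u) * H (t, u) \<partial>lborel)"
      by (simp add: H_def cinner_commute[of "F t"])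
    finally have "e s t * cinner (F t) (Fh s) = (\<integral>u. e s t * (cnj (e s u) * H (t, u)) \<partial>lborel)"
      by simp
    also have "(\<lambda>u. e s t * (cnj (e s u) * H (t, u))) = (\<lambda>u. e s (t - u) * H (t, u))"
      by (auto simp: e_def exp_cnj algebra_simps simp flip: exp_add)
    finally show "e s t * cinner (F t) (Fh s) = (\<integral>u. e s (t - u) * H (t, u) \<partial>lborel)" .
  qed
  also have "\<dots> = (\<integral>p. e s (fst p - snd p) * H p \<partial>(lborel \<Otimes>\<^sub>M lborel))"
    using lborel_pair.integral_fst'[OF int] by simp
  finally show ?thesis .
qed

text \<open>
  The Gaussian factor makes Fubini's theorem applicable to the integral over frequencies. Its Fourier
  transform is an approximate identity in \<open>t - u\<close>, written here after the substitution
  \<open>u = t + v / n\<close>.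
\<close>

private lemma smoothed:
  fixes n :: real assumes n: "n > 0"
  shows "integrable lborel (\<lambda>s. exp (- (s / n)\<^sup>2 / 2) * (norm (Fh s))\<^sup>2)"
    and "complex_of_real (\<integral>s. exp (- (s / n)\<^sup>2 / 2) * (norm (Fh s))\<^sup>2 \<partial>lborel)
      = complex_of_real (sqrt (2 * pi)) *
        (\<integral>t. (\<integral>v. H (t, t + v / n) * complex_of_real (exp (- v\<^sup>2 / 2)) \<partial>lborel) \<partial>lborel)"
proof -
  let ?P = "lborel \<Otimes>\<^sub>M lborel :: (real \<times> real) measure"
  interpret P: sigma_finite_measure ?P
    by (rule lborel_pair.sigma_finite_measure_axioms)
  interpret LP: pair_sigma_finite lborel ?P ..
  have [measurable]: "H \<in> borel_measurable (borel \<Otimes>\<^sub>M borel)" by (rule H_meas)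
  have em[measurable]: "(\<lambda>x. e (f x) (g x)) \<in> borel_measurable M"
    if "f \<in> borel_measurable M" "g \<in> borel_measurable M" for f g and M :: "'z measure"
    unfolding e_def using that by measurable
  define w where "w s = exp (- (s / n)\<^sup>2 / 2)" for s :: real
  have [measurable]: "w \<in> borel_measurable borel" unfolding w_def by measurable
  define G where "G q = complex_of_real (w (fst q)) * (e (fst q) (fst (snd q) - snd (snd q)) * H (snd q))" for q
  have G_int: "integrable (lborel \<Otimes>\<^sub>M ?P) G"
  proof (rule Bochner_Integration.integrable_bound)
    have 1: "integrable lborel (\<lambda>s. complex_of_real (w s))"
      unfolding w_def using gaussian_integrable_scaled[OF n] by simp
    show "integrable (lborel \<Otimes>\<^sub>M ?P) (\<lambda>q. complex_of_real (w (fst q)) * H (snd q))"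
      by (rule integrable_product[OF _ _ 1 H_int])
         (rule lborel.sigma_finite_measure_axioms lborel_pair.sigma_finite_measure_axioms)+
    show "G \<in> borel_measurable (lborel \<Otimes>\<^sub>M ?P)"
      unfolding G_def by measurable
    show "AE q in lborel \<Otimes>\<^sub>M ?P. norm (G q) \<le> norm (complex_of_real (w (fst q)) * H (snd q))"
      by (rule AE_I2) (simp add: G_def norm_mult)
  qed
  have inner: "(\<integral>p. G (s, p) \<partial>?P) = complex_of_real (w s * (norm (Fh s))\<^sup>2)" for s
    by (simp add: G_def norm_Fh del: of_real_power)
  have "integrable lborel (\<lambda>s. \<integral>p. G (s, p) \<partial>?P)"
    using LP.integrable_fst'[OF G_int] .
  then show "integrable lborel (\<lambda>s. exp (- (s / n)\<^sup>2 / 2) * (norm (Fh s))\<^sup>2)"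
    unfolding inner complex_of_real_integrable_eq w_def .
  have "complex_of_real (\<integral>s. w s * (norm (Fh s))\<^sup>2 \<partial>lborel) = (\<integral>s. (\<integral>p. G (s, p) \<partial>?P) \<partial>lborel)"
    unfolding inner by (simp only: integral_complex_of_real)
  also have "\<dots> = (\<integral>p. (\<integral>s. G (s, p) \<partial>lborel) \<partial>?P)"
    using LP.Fubini_integral[of "\<lambda>s p. G (s, p)"] G_int by simp
  also have "\<dots> = (\<integral>p. H p * complex_of_real (sqrt (2 * pi) * n * exp (- (n * (fst p - snd p))\<^sup>2 / 2)) \<partial>?P)"
  proof (rule Bochner_Integration.integral_cong[OF refl])
    fix p :: "real \<times> real"
    have "(\<integral>s. G (s, p) \<partial>lborel) = (\<integral>s. H p * (complex_of_real (w s) *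
        wave (fst p - snd p) s) \<partial>lborel)"
      by (simp add: G_def e_def mult_ac)
    also have "\<dots> = H p * (\<integral>s. complex_of_real (w s) *
        wave (fst p - snd p) s \<partial>lborel)"
      by simp
    also have "\<dots> = H p * complex_of_real (sqrt (2 * pi) * n * exp (- (n * (fst p - snd p))\<^sup>2 / 2))"
      unfolding w_def using gaussian_fourier[OF n, of "fst p - snd p"] by simp
    finally show "(\<integral>s. G (s, p) \<partial>lborel)
      = H p * complex_of_real (sqrt (2 * pi) * n * exp (- (n * (fst p - snd p))\<^sup>2 / 2))" .
  qed
  also have "\<dots> = (\<integral>t. (\<integral>u. H (t, u) * complex_of_real (sqrt (2 * pi) * n * exp (- (n * (t - u))\<^sup>2 / 2)) \<partial>lborel) \<partial>lborel)"
  proof -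
    have "integrable ?P (\<lambda>p. H p * complex_of_real (sqrt (2 * pi) * n * exp (- (n * (fst p - snd p))\<^sup>2 / 2)))"
    proof (rule Bochner_Integration.integrable_bound)
      show "integrable ?P (\<lambda>p. complex_of_real (sqrt (2 * pi) * n) * H p)" using H_int by simp
      show "AE p in ?P. norm (H p * complex_of_real (sqrt (2 * pi) * n * exp (- (n * (fst p - snd p))\<^sup>2 / 2)))
        \<le> norm (complex_of_real (sqrt (2 * pi) * n) * H p)"
        using n by (intro AE_I2) (auto simp: norm_mult mult_ac intro!: mult_left_mono mult_left_le)
    qed measurable
    from lborel_pair.integral_fst'[OF this] show ?thesis by simp
  qed
  also have "\<dots> = (\<integral>t. complex_of_real (sqrt (2 * pi)) *
      (\<integral>v. H (t, t + v / n) * complex_of_real (exp (- v\<^sup>2 / 2)) \<partial>lborel) \<partial>lborel)"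
  proof (rule Bochner_Integration.integral_cong[OF refl])
    fix t
    have "(\<integral>u. H (t, u) * complex_of_real (sqrt (2 * pi) * n * exp (- (n * (t - u))\<^sup>2 / 2)) \<partial>lborel)
      = (1 / n) *\<^sub>R (\<integral>v. H (t, t + v / n) * complex_of_real (sqrt (2 * pi) * n * exp (- v\<^sup>2 / 2)) \<partial>lborel)"
      using n by (subst lborel_integral_real_affine[where c="1 / n" and t=t]) (auto simp: power2_eq_square)
    also have "\<dots> = (1 / n) *\<^sub>R (\<integral>v. complex_of_real (sqrt (2 * pi) * n) * (H (t, t + v / n) * complex_of_real (exp (- v\<^sup>2 / 2))) \<partial>lborel)"
      by (simp add: mult_ac)
    also have "\<dots> = (1 / n) *\<^sub>R (complex_of_real (sqrt (2 * pi) * n) * (\<integral>v. H (t, t + v / n) * complex_of_real (exp (- v\<^sup>2 / 2)) \<partial>lborel))"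
      by (subst integral_mult_right_zero) simp
    also have "\<dots> = complex_of_real (sqrt (2 * pi)) * (\<integral>v. H (t, t + v / n) * complex_of_real (exp (- v\<^sup>2 / 2)) \<partial>lborel)"
      using n by (simp add: scaleR_conv_of_real)
    finally show "(\<integral>u. H (t, u) * complex_of_real (sqrt (2 * pi) * n * exp (- (n * (t - u))\<^sup>2 / 2)) \<partial>lborel)
      = complex_of_real (sqrt (2 * pi)) * (\<integral>v. H (t, t + v / n) * complex_of_real (exp (- v\<^sup>2 / 2)) \<partial>lborel)" .
  qed
  finally show "complex_of_real (\<integral>s. exp (- (s / n)\<^sup>2 / 2) * (norm (Fh s))\<^sup>2 \<partial>lborel)
      = complex_of_real (sqrt (2 * pi)) *
        (\<integral>t. (\<integral>v. H (t, t + v / n) * complex_of_real (exp (- v\<^sup>2 / 2)) \<partial>lborel) \<partial>lborel)"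
    by (simp add: w_def)
qed

text \<open>
  Dominated convergence, twice. Continuity of \<open>F\<close> almost everywhere gives the pointwise limit, and
  boundedness of \<open>F\<close> the majorant.
\<close>

private lemma smoothed_limit:
  "(\<lambda>n. \<integral>t. (\<integral>v. H (t, t + v / real (Suc n)) * complex_of_real (exp (- v\<^sup>2 / 2)) \<partial>lborel) \<partial>lborel)
    \<longlonglongrightarrow> (\<integral>t. complex_of_real ((norm (F t))\<^sup>2 * sqrt (2 * pi)) \<partial>lborel)"
proof -
  have [measurable]: "H \<in> borel_measurable (borel \<Otimes>\<^sub>M borel)" by (rule H_meas)
  have nF[measurable]: "(\<lambda>t. norm (F t)) \<in> borel_measurable borel"
    by (rule tame_borel_measurable[OF tame_norm[OF F]])
  obtain B where B: "\<And>t. norm (F t) \<le> B" "0 \<le> B" using tame_bounded[OF F] by metis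
  have H_le: "cmod (H (t, u)) \<le> norm (F t) * B" for t u
    using cinner_cauchy_schwarz[of "F t" "F u"] mult_left_mono[OF B(1)[of u], of "norm (F t)"]
    by (simp add: H_def)
  have gi: "integrable lborel (\<lambda>v::real. complex_of_real (exp (- v\<^sup>2 / 2)))"
    using gaussian_integrable by simp
  show ?thesis
  proof (rule integral_dominated_convergence[where w="\<lambda>t. norm (F t) * B * sqrt (2 * pi)"])
    show "integrable lborel (\<lambda>t. norm (F t) * B * sqrt (2 * pi))" using F_int by simp
    show "AE t in lborel. (\<lambda>n. \<integral>v. H (t, t + v / real (Suc n)) * complex_of_real (exp (- v\<^sup>2 / 2)) \<partial>lborel)
      \<longlonglongrightarrow> complex_of_real ((norm (F t))\<^sup>2 * sqrt (2 * pi))"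
      using tame_continuous_AE[OF F]
    proof eventually_elim
      case (elim t)
      have "(\<lambda>n. \<integral>v. H (t, t + v / real (Suc n)) * complex_of_real (exp (- v\<^sup>2 / 2)) \<partial>lborel)
        \<longlonglongrightarrow> (\<integral>v. complex_of_real ((norm (F t))\<^sup>2) * complex_of_real (exp (- v\<^sup>2 / 2)) \<partial>lborel)"
      proof (rule integral_dominated_convergence[where w="\<lambda>v. norm (F t) * B * exp (- v\<^sup>2 / 2)"])
        show "integrable lborel (\<lambda>v::real. norm (F t) * B * exp (- v\<^sup>2 / 2))"
          using gaussian_integrable by simp
        show "AE v in lborel. (\<lambda>n. H (t, t + v / real (Suc n)) * complex_of_real (exp (- v\<^sup>2 / 2)))
          \<longlonglongrightarrow> complex_of_real ((norm (F t))\<^sup>2) * complex_of_real (exp (- v\<^sup>2 / 2))"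
        proof (intro AE_I2 tendsto_intros)
          fix v :: real
          have "(\<lambda>n. t + v / real (Suc n)) \<longlonglongrightarrow> t + 0"
            by (intro tendsto_intros LIMSEQ_Suc lim_const_over_n)
          then have "(\<lambda>n. F (t + v / real (Suc n))) \<longlonglongrightarrow> F t"
            using isCont_tendsto_compose[OF elim] by auto
          from cinner.tendsto[OF tendsto_const[of "F t"] this]
          show "(\<lambda>n. H (t, t + v / real (Suc n))) \<longlonglongrightarrow> complex_of_real ((norm (F t))\<^sup>2)"
            by (simp add: H_def cinner_self)
        qed
        show "AE v in lborel. norm (H (t, t + v / real (Suc n)) * complex_of_real (exp (- v\<^sup>2 / 2)))
          \<le> norm (F t) * B * exp (- v\<^sup>2 / 2)" for n
          using H_le by (auto simp: norm_mult intro!: mult_right_mono)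
      qed measurable
      also have "(\<integral>v. complex_of_real ((norm (F t))\<^sup>2) * complex_of_real (exp (- v\<^sup>2 / 2)) \<partial>lborel)
        = complex_of_real ((norm (F t))\<^sup>2 * sqrt (2 * pi))"
        using gaussian_integral by (simp flip: of_real_mult of_real_power)
      finally show ?case .
    qed
    show "AE t in lborel. norm (\<integral>v. H (t, t + v / real (Suc n)) * complex_of_real (exp (- v\<^sup>2 / 2)) \<partial>lborel)
      \<le> norm (F t) * B * sqrt (2 * pi)" for n
    proof (rule AE_I2)
      fix t
      have "norm (\<integral>v. H (t, t + v / real (Suc n)) * complex_of_real (exp (- v\<^sup>2 / 2)) \<partial>lborel)
        \<le> (\<integral>v. norm (F t) * B * exp (- v\<^sup>2 / 2) \<partial>lborel)"
      proof (rule Bochner_Integration.integral_norm_bound_integral)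
        show "integrable lborel (\<lambda>v. H (t, t + v / real (Suc n)) * complex_of_real (exp (- v\<^sup>2 / 2)))"
          by (rule Bochner_Integration.integrable_bound[of _ "\<lambda>v. norm (F t) * B * exp (- v\<^sup>2 / 2)"])
             (use gaussian_integrable H_le B in \<open>auto simp: norm_mult intro!: mult_right_mono\<close>)
        show "integrable lborel (\<lambda>v::real. norm (F t) * B * exp (- v\<^sup>2 / 2))"
          using gaussian_integrable by simp
      qed (use H_le in \<open>auto simp: norm_mult intro!: mult_right_mono\<close>)
      then show "norm (\<integral>v. H (t, t + v / real (Suc n)) * complex_of_real (exp (- v\<^sup>2 / 2)) \<partial>lborel)
        \<le> norm (F t) * B * sqrt (2 * pi)"
        by (simp only: integral_mult_right_zero gaussian_integral)
    qed
  qed measurable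
qed

lemma integrable_norm_square: "integrable lborel (\<lambda>t. (norm (F t))\<^sup>2)"
proof -
  have [measurable]: "(\<lambda>t. norm (F t)) \<in> borel_measurable borel"
    by (rule tame_borel_measurable[OF tame_norm[OF F]])
  obtain B where B: "\<And>t. norm (F t) \<le> B" "0 \<le> B" using tame_bounded[OF F] by metis
  show ?thesis
    by (rule Bochner_Integration.integrable_bound[of _ "\<lambda>t. B * norm (F t)"])
       (use F_int B in \<open>auto simp: power2_eq_square intro!: mult_right_mono\<close>)
qed

lemma plancherel_measurable: "(\<lambda>s. (norm (Fh s))\<^sup>2) \<in> borel_measurable borel"
proof -
  define w where "w s = exp (- (s / 1)\<^sup>2 / 2)" for s :: real
  have "(\<lambda>s. w s * (norm (Fh s))\<^sup>2) \<in> borel_measurable borel"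
    using smoothed(1)[of 1] unfolding w_def by auto
  then have "(\<lambda>s. w s * (norm (Fh s))\<^sup>2 / w s) \<in> borel_measurable borel"
    unfolding w_def by (intro borel_measurable_divide) auto
  then show ?thesis by (simp add: w_def)
qed

text \<open>
  As \<open>n \<rightarrow> \<infinity>\<close> the Gaussian factors increase to 1, so the left hand sides of the smoothed identity
  converge monotonically.
\<close>

theorem plancherel:
  "(\<integral>\<^sup>+s. ennreal ((norm (Fh s))\<^sup>2) \<partial>lborel) = ennreal (2 * pi * (\<integral>t. (norm (F t))\<^sup>2 \<partial>lborel))"
proof -
  define w where "w n s = exp (- (s / real (Suc n))\<^sup>2 / 2)" for n s
  have w_int: "integrable lborel (\<lambda>s. w n s * (norm (Fh s))\<^sup>2)" for n
    unfolding w_def by (rule smoothed(1)) simp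
  note plancherel_measurable [measurable]
  have "(\<lambda>n. complex_of_real (\<integral>s. w n s * (norm (Fh s))\<^sup>2 \<partial>lborel))
      \<longlonglongrightarrow> complex_of_real (sqrt (2 * pi)) * (\<integral>t. complex_of_real ((norm (F t))\<^sup>2 * sqrt (2 * pi)) \<partial>lborel)"
    unfolding w_def using tendsto_mult_left[OF smoothed_limit, of "complex_of_real (sqrt (2 * pi))"]
    by (subst smoothed(2)) auto
  also have "complex_of_real (sqrt (2 * pi)) * (\<integral>t. complex_of_real ((norm (F t))\<^sup>2 * sqrt (2 * pi)) \<partial>lborel)
     = complex_of_real (2 * pi * (\<integral>t. (norm (F t))\<^sup>2 \<partial>lborel))"
    unfolding integral_complex_of_real integral_mult_left_zero
    by (simp add: mult_ac flip: of_real_mult)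
  finally have "(\<lambda>n. \<integral>s. w n s * (norm (Fh s))\<^sup>2 \<partial>lborel) \<longlonglongrightarrow> 2 * pi * (\<integral>t. (norm (F t))\<^sup>2 \<partial>lborel)"
    using tendsto_Re by fastforce
  then have lim1: "(\<lambda>n. ennreal (\<integral>s. w n s * (norm (Fh s))\<^sup>2 \<partial>lborel)) \<longlonglongrightarrow> ennreal (2 * pi * (\<integral>t. (norm (F t))\<^sup>2 \<partial>lborel))"
    by (rule tendsto_ennrealI)
  have "(\<lambda>n. \<integral>\<^sup>+s. ennreal (w n s * (norm (Fh s))\<^sup>2) \<partial>lborel) \<longlonglongrightarrow> (\<integral>\<^sup>+s. ennreal ((norm (Fh s))\<^sup>2) \<partial>lborel)"
  proof (rule nn_integral_LIMSEQ)
    show "incseq (\<lambda>n s. ennreal (w n s * (norm (Fh s))\<^sup>2))"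
    proof (intro incseq_SucI le_funI ennreal_leI mult_right_mono)
      fix n s
      have "(s / real (Suc (Suc n)))\<^sup>2 \<le> (s / real (Suc n))\<^sup>2"
        unfolding power_divide by (intro divide_left_mono power_mono) auto
      then show "w n s \<le> w (Suc n) s" by (simp add: w_def)
    qed simp
    show "(\<lambda>n. ennreal (w n s * (norm (Fh s))\<^sup>2)) \<longlonglongrightarrow> ennreal ((norm (Fh s))\<^sup>2)" for s
    proof (rule tendsto_ennrealI)
      have "(\<lambda>n. s / real (Suc n)) \<longlonglongrightarrow> 0" by (intro LIMSEQ_Suc lim_const_over_n)
      then have "(\<lambda>n. w n s * (norm (Fh s))\<^sup>2) \<longlonglongrightarrow> exp (- 0\<^sup>2 / 2) * (norm (Fh s))\<^sup>2"
        unfolding w_def by (intro tendsto_intros) auto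
      then show "(\<lambda>n. w n s * (norm (Fh s))\<^sup>2) \<longlonglongrightarrow> (norm (Fh s))\<^sup>2" by simp
    qed
  qed (unfold w_def, measurable)
  moreover have "(\<integral>\<^sup>+s. ennreal (w n s * (norm (Fh s))\<^sup>2) \<partial>lborel) = ennreal (\<integral>s. w n s * (norm (Fh s))\<^sup>2 \<partial>lborel)" for n
    by (rule nn_integral_eq_integral[OF w_int]) (simp add: w_def)
  ultimately show ?thesis using LIMSEQ_unique[OF _ lim1] by simp
qed

end

section \<open>Bounded semigroups and their Laplace transforms\<close>

abbreviation exp_decay :: "real \<Rightarrow> real \<Rightarrow> real" where
  "exp_decay a t \<equiv> (if 0 \<le> t then exp (- (a * t)) else 0)"

lemma integral_exp_decay:
  fixes a :: real assumes a: "a > 0"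
  shows "integrable lborel (\<lambda>t. exp_decay a t)"
    and "(\<integral>t. exp_decay a t \<partial>lborel) = 1 / a"
proof -
  have "(\<integral>\<^sup>+t. ennreal (exp (- (a * t))) * indicator {0..} t \<partial>lborel) = ennreal (0 - (- exp (- (a * 0)) / a))"
  proof (rule nn_integral_FTC_atLeast[where F="\<lambda>t. - exp (- (a * t)) / a"])
    show "((\<lambda>t. - exp (- (a * t)) / a) \<longlongrightarrow> 0) at_top"
    proof -
      have "filterlim (\<lambda>t. - (a * t)) at_bot at_top"
        using a by (intro filterlim_uminus_at_bot_at_top[THEN filterlim_compose]
            filterlim_tendsto_pos_mult_at_top[OF tendsto_const] filterlim_ident) auto
      then have "((\<lambda>t. exp (- (a * t))) \<longlongrightarrow> 0) at_top"
        by (rule filterlim_compose[OF exp_at_bot])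
      from tendsto_divide[OF tendsto_minus[OF this] tendsto_const[of a]] a show ?thesis by simp
    qed
    show "DERIV (\<lambda>t. - exp (- (a * t)) / a) t :> exp (- (a * t))" for t
      using a by (auto intro!: derivative_eq_intros)
  qed auto
  then have eq: "(\<integral>\<^sup>+t. ennreal (exp_decay a t) \<partial>lborel) = ennreal (1 / a)"
    by (subst nn_integral_cong[of _ _ "\<lambda>t. ennreal (exp (- (a * t))) * indicator {0..} t"])
       (auto simp: indicator_def)
  have "has_bochner_integral lborel (\<lambda>t. exp_decay a t) (1 / a)"
    by (rule has_bochner_integral_nn_integral[OF _ _ _ eq]) (use a in auto)
  then show "integrable lborel (\<lambda>t. exp_decay a t)"
    "(\<integral>t. exp_decay a t \<partial>lborel) = 1 / a"
    by (auto simp: has_bochner_integral_iff)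
qed

lemma integrable_complex_indicator:
  "integrable lborel (indicator {a..<b::real} :: real \<Rightarrow> complex)"
proof -
  have "integrable lborel (\<lambda>t. complex_of_real (indicator {a..<b} t))"
    unfolding complex_of_real_integrable_eq by (cases "a \<le> b") (auto simp: integrable_indicator_iff)
  then show ?thesis by (simp add: of_real_indicator)
qed

lemma integral_complex_indicator:
  assumes "a \<le> b"
  shows "(\<integral>t. indicator {a..<b::real} t \<partial>lborel) = complex_of_real (b - a)"
proof -
  have "(\<integral>t. complex_of_real (indicator {a..<b} t) \<partial>lborel) = complex_of_real (b - a)"
    unfolding integral_complex_of_real using assms by simp
  then show ?thesis by (simp add: of_real_indicator)
qed

lemma mean_value_limit:
  assumes f: "tame f" and lim: "(f \<longlongrightarrow> x) (at_right 0)" and f0: "f 0 = x"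
  shows "((\<lambda>h. (1 / h) *\<^sub>R vint lborel (indicator {0..<h}) f) \<longlongrightarrow> x) (at_right (0::real))"
proof (rule tendstoI)
  fix e :: real assume e: "e > 0"
  have "\<forall>\<^sub>F t in at_right 0. dist (f t) x < e / 2"
    using tendstoD[OF lim, of "e/2"] e by simp
  then obtain d where d: "d > 0" "\<And>t. 0 < t \<Longrightarrow> t < d \<Longrightarrow> norm (f t - x) < e / 2"
    unfolding eventually_at_right_field dist_norm by blast
  have "dist ((1 / h) *\<^sub>R vint lborel (indicator {0..<h}) f) x < e" if h: "0 < h" "h < d" for h
  proof -
    have i_int: "integrable lborel (indicator {0..<h} :: real \<Rightarrow> complex)"
      by (rule integrable_complex_indicator)
    have tc: "tame (\<lambda>t. f t - x)"
      by (intro tame_diff f tameI[of "{}" "\<lambda>_. x" "norm x"]) auto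
    have int: "(\<integral>t. indicator {0..<h} t \<partial>lborel) = complex_of_real h"
      using h integral_complex_indicator[of 0 h] by simp
    have eq: "vint lborel (indicator {0..<h}) f - h *\<^sub>R x = vint lborel (indicator {0..<h}) (\<lambda>t. f t - x)"
    proof (rule cinner_ext)
      fix y
      have "cinner (vint lborel (indicator {0..<h}) (\<lambda>t. f t - x)) y
          = (\<integral>t. indicator {0..<h} t * cinner (f t) y - indicator {0..<h} t * cinner x y \<partial>lborel)"
        by (subst cinner_vint[OF _ i_int tc]) (auto simp: cinner.diff_left algebra_simps)
      also have "\<dots> = (\<integral>t. indicator {0..<h} t * cinner (f t) y \<partial>lborel) - (\<integral>t. indicator {0..<h} t * cinner x y \<partial>lborel)"
        using integrable_weighted_cinner[OF _ i_int f] i_int by (intro Bochner_Integration.integral_diff) auto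
      also have "(\<integral>t. indicator {0..<h} t * cinner x y \<partial>lborel) = complex_of_real h * cinner x y"
        unfolding integral_mult_left_zero int ..
      finally show "cinner (vint lborel (indicator {0..<h}) f - h *\<^sub>R x) y
        = cinner (vint lborel (indicator {0..<h}) (\<lambda>t. f t - x)) y"
        by (simp add: cinner.diff_left cinner_vint[OF _ i_int f] cinner_scaleR_left scaleR_conv_of_real)
    qed
    have le1: "norm (vint lborel (indicator {0..<h}) (\<lambda>t. f t - x))
        \<le> (\<integral>t. cmod (indicator {0..<h} t) * norm (f t - x) \<partial>lborel)"
      by (rule norm_vint_le[OF _ i_int tc]) auto
    have le2: "(\<integral>t. cmod (indicator {0..<h} t) * norm (f t - x) \<partial>lborel)
        \<le> (\<integral>t. indicator {0..<h} t * (e / 2) \<partial>lborel)"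
    proof (rule integral_mono)
      show "integrable lborel (\<lambda>t. cmod (indicator {0..<h} t) * norm (f t - x))"
        by (rule integrable_weighted_norm[OF _ i_int tc]) auto
      show "cmod (indicator {0..<h} t) * norm (f t - x) \<le> indicator {0..<h} t * (e / 2)" for t
        using d(2)[of t] h e f0 by (cases "t = 0") (auto simp: indicator_def)
    qed (use h in \<open>auto simp: integrable_indicator_iff\<close>)
    have "(\<integral>t. indicator {0..<h} t * (e / 2) \<partial>lborel) = h * (e / 2)"
      using h by simp
    with le1 le2 have "norm (vint lborel (indicator {0..<h}) f - h *\<^sub>R x) \<le> h * (e / 2)"
      unfolding eq by linarith
    moreover have "(1 / h) *\<^sub>R vint lborel (indicator {0..<h}) f - x
        = (1 / h) *\<^sub>R (vint lborel (indicator {0..<h}) f - h *\<^sub>R x)"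
      using h by (simp add: algebra_simps)
    ultimately have "norm ((1 / h) *\<^sub>R vint lborel (indicator {0..<h}) f - x) \<le> (1 / h) * (h * (e / 2))"
      using h by (simp only: norm_scaleR) (intro mult_mono; simp)
    then show ?thesis
      using h e by (simp add: dist_norm)
  qed
  then show "\<forall>\<^sub>F h in at_right 0. dist ((1 / h) *\<^sub>R vint lborel (indicator {0..<h}) f) x < e"
    using d(1) by (auto simp: eventually_at_right)
qed

text \<open>
  The generator is \<open>-A\<close> with domain \<open>D\<close>. The bound is normalized to \<open>M \<ge> 1\<close>, so that it may be
  inserted as a factor anywhere.
\<close>

locale bounded_c0_semigroup =
  fixes T :: "real \<Rightarrow> 'a::complex_hilbert_space \<Rightarrow> 'a" and M :: real
    and D :: "'a set" and A :: "'a \<Rightarrow> 'a"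
  assumes c0: "c0_semigroup T"
    and norm_T: "\<And>t x. 0 \<le> t \<Longrightarrow> norm (T t x) \<le> M * norm x"
    and M1: "1 \<le> M"
    and gen: "is_generator T D (\<lambda>x. - A x)"
begin

lemma T_clinear: "0 \<le> t \<Longrightarrow> bounded_clinear (T t)"
  using c0 by (simp add: c0_semigroup_def)

lemma T_linear: "0 \<le> t \<Longrightarrow> bounded_linear (T t)"
  by (rule bounded_clinear_linear[OF T_clinear])

lemma T_diff: "0 \<le> t \<Longrightarrow> T t (x - y) = T t x - T t y"
  using linear_diff[OF bounded_linear.linear[OF T_linear]] .

lemma T_scaleR: "0 \<le> t \<Longrightarrow> T t (r *\<^sub>R x) = r *\<^sub>R T t x"
  using linear_scale[OF bounded_linear.linear[OF T_linear]] .

lemma T_scaleC: "0 \<le> t \<Longrightarrow> T t (z *\<^sub>C x) = z *\<^sub>C T t x"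
  by (rule bounded_clinear_scaleC[OF T_clinear])

lemma T_zero [simp]: "T 0 x = x"
  using c0 by (simp add: c0_semigroup_def)

lemma T_add: "0 \<le> s \<Longrightarrow> 0 \<le> t \<Longrightarrow> T (s + t) x = T s (T t x)"
  using c0 by (simp add: c0_semigroup_def)

lemma T_at_0: "((\<lambda>t. T t x) \<longlongrightarrow> x) (at_right 0)"
  using c0 by (simp add: c0_semigroup_def)

lemma T_increment:
  assumes "0 \<le> s" "0 \<le> t"
  shows "norm (T s x - T t x) \<le> M * norm (T \<bar>s - t\<bar> x - x)"
proof -
  have "norm (T b x - T a x) \<le> M * norm (T (b - a) x - x)" if "0 \<le> a" "a \<le> b" for a b
  proof -
    have "T b x - T a x = T a (T (b - a) x - x)"
      using that T_add[of a "b - a" x] by (simp add: T_diff)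
    then show ?thesis using norm_T[OF that(1)] by simp
  qed
  from this[of s t] this[of t s] show ?thesis
    using assms by (cases "s \<le> t") (auto simp: norm_minus_commute abs_if)
qed

lemma T_continuous: "continuous_on {0..} (\<lambda>t. T t x)"
  unfolding continuous_on_def
proof
  fix t :: real assume t: "t \<in> {0..}"
  have "((\<lambda>h. T h x - x) \<longlongrightarrow> 0) (at_right 0)"
    using tendsto_diff[OF T_at_0[of x] tendsto_const[of x]] by simp
  then have "((\<lambda>h. M * norm (T h x - x)) \<longlongrightarrow> 0) (at_right 0)"
    using tendsto_mult_right[OF tendsto_norm, of "\<lambda>h. T h x - x" 0 _ M] by (simp add: mult.commute)
  moreover have "filterlim (\<lambda>s. \<bar>s - t\<bar>) (at_right 0) (at t within {0..})"
    unfolding filterlim_at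
    by (auto intro!: tendsto_eq_intros simp: eventually_at_filter)
  ultimately have "((\<lambda>s. M * norm (T \<bar>s - t\<bar> x - x)) \<longlongrightarrow> 0) (at t within {0..})"
    by (rule filterlim_compose)
  moreover have "\<forall>\<^sub>F s in at t within {0..}. norm (T s x - T t x) \<le> M * norm (T \<bar>s - t\<bar> x - x)"
    using T_increment t by (auto simp: eventually_at_filter)
  ultimately show "((\<lambda>s. T s x) \<longlongrightarrow> T t x) (at t within {0..})"
    by (subst LIM_zero_iff[symmetric]) (rule Lim_null_comparison)
qed

text \<open>
  The damped semigroup \<open>e\<^sup>-\<^sup>\<alpha>\<^sup>t T(t)\<close>, extended by zero to negative times. Its orbits are integrable over
  the line for \<open>\<alpha> > 0\<close>.
\<close>

definition damped :: "real \<Rightarrow> real \<Rightarrow> 'a \<Rightarrow> 'a" where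
  "damped \<alpha> t x = (if 0 \<le> t then exp (- (\<alpha> * t)) *\<^sub>R T t x else 0)"

lemma damped_neg: "t < 0 \<Longrightarrow> damped \<alpha> t x = 0"
  by (simp add: damped_def)

lemma norm_damped:
  "norm (damped \<alpha> t x) \<le> exp_decay \<alpha> t * (M * norm x)"
  using norm_T[of t x] by (auto simp: damped_def intro!: mult_left_mono)

lemma norm_damped_le:
  assumes "0 \<le> \<alpha>" shows "norm (damped \<alpha> t x) \<le> M * norm x"
proof -
  have "norm (damped \<alpha> t x) \<le> exp_decay \<alpha> t * (M * norm x)"
    by (rule norm_damped)
  also have "\<dots> \<le> 1 * (M * norm x)"
    using assms M1 by (intro mult_right_mono) auto
  finally show ?thesis by simp
qed

lemma damped_continuous: "continuous_on (- {0}) (\<lambda>t. damped \<alpha> t x)"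
proof -
  have "continuous_on ({0<..} \<union> {..<0}) (\<lambda>t. damped \<alpha> t x)"
  proof (rule continuous_on_open_Un)
    have "continuous_on {0<..} (\<lambda>t. exp (- (\<alpha> * t)) *\<^sub>R T t x)"
      by (intro continuous_intros continuous_on_subset[OF T_continuous]) auto
    then show "continuous_on {0<..} (\<lambda>t. damped \<alpha> t x)"
      by (rule continuous_on_eq) (auto simp: damped_def)
    show "continuous_on {..<0} (\<lambda>t. damped \<alpha> t x)"
      by (rule continuous_on_eq[OF continuous_on_const[of _ 0]]) (auto simp: damped_def)
  qed auto
  moreover have "- {0} = {0<..} \<union> {..<(0::real)}" by auto
  ultimately show ?thesis by simp
qed

lemma tame_damped: "0 \<le> \<alpha> \<Longrightarrow> tame (\<lambda>t. damped \<alpha> t x)"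
  using norm_damped_le by (intro tameI[OF _ damped_continuous]) auto

lemma damped_linear:
  assumes "0 \<le> \<alpha>" shows "bounded_linear (damped \<alpha> t)"
proof (cases "0 \<le> t")
  case True
  show ?thesis unfolding damped_def using True
    by (simp add: bounded_linear_const_scaleR T_linear)
next
  case False
  then have "damped \<alpha> t = (\<lambda>x. 0)" by (auto simp: damped_def)
  then show ?thesis by simp
qed

lemma damped_clinear:
  assumes "0 \<le> \<alpha>" shows "bounded_clinear (damped \<alpha> t)"
  using damped_linear[OF assms]
  by (auto simp: bounded_clinear_def damped_def T_scaleC scaleC.scaleR_right scaleC.zero_right)

lemma damped_damped: "0 \<le> s \<Longrightarrow> 0 \<le> t \<Longrightarrow> damped \<alpha> s (damped \<alpha> t x) = damped \<alpha> (s + t) x"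
  by (simp add: damped_def T_add T_scaleR algebra_simps flip: exp_add)

lemma T_damped: "0 \<le> s \<Longrightarrow> 0 \<le> t \<Longrightarrow> T s (damped 0 t x) = damped 0 (s + t) x"
  by (simp add: damped_def T_add)

lemma T_damped_commute: "0 \<le> s \<Longrightarrow> T s (damped \<alpha> t x) = damped \<alpha> t (T s x)"
  by (auto simp: damped_def T_scaleR T_linear linear_0[OF bounded_linear.linear] add.commute simp flip: T_add)

abbreviation laplace_kernel :: "complex \<Rightarrow> real \<Rightarrow> complex" where
  "laplace_kernel z t \<equiv> (if 0 \<le> t then exp (- (z * complex_of_real t)) else 0)"

definition laplace :: "complex \<Rightarrow> 'a \<Rightarrow> 'a" where
  "laplace z x = vint lborel (\<lambda>t. laplace_kernel z t) (\<lambda>t. damped 0 t x)"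

lemma integrable_laplace_kernel:
  assumes "Re z > 0"
  shows "integrable lborel (\<lambda>t. laplace_kernel z t)"
proof (rule Bochner_Integration.integrable_bound[OF integral_exp_decay(1)[OF assms]])
  show "AE t in lborel. norm (laplace_kernel z t)
      \<le> norm (exp_decay (Re z) t)"
    by (rule AE_I2) (simp add: norm_exp_eq_Re)
qed measurable

lemma cinner_laplace:
  assumes "Re z > 0"
  shows "cinner (laplace z x) y
    = (\<integral>t. laplace_kernel z t * cinner (damped 0 t x) y \<partial>lborel)"
  unfolding laplace_def
  by (rule cinner_vint[OF _ integrable_laplace_kernel[OF assms] tame_damped]) auto

lemma generator_limit:
  "x \<in> D \<Longrightarrow> ((\<lambda>h. (1 / h) *\<^sub>R (T h x - x)) \<longlongrightarrow> - A x) (at_right 0)"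
  using gen by (simp add: is_generator_def)

lemma generatorI:
  assumes "((\<lambda>h. (1 / h) *\<^sub>R (T h x - x)) \<longlongrightarrow> y) (at_right 0)"
  shows "x \<in> D" "A x = - y"
proof -
  show "x \<in> D" using gen assms by (auto simp: is_generator_def)
  from tendsto_unique[OF _ generator_limit[OF this] assms] show "A x = - y"
    by (simp add: equation_minus_iff)
qed

lemma D_diff:
  assumes "x \<in> D" "y \<in> D" shows "x - y \<in> D" "A (x - y) = A x - A y"
proof -
  have "((\<lambda>h. (1 / h) *\<^sub>R (T h x - x) - (1 / h) *\<^sub>R (T h y - y)) \<longlongrightarrow> - A x - - A y) (at_right 0)"
    by (intro tendsto_diff generator_limit assms)
  then have "((\<lambda>h. (1 / h) *\<^sub>R (T h (x - y) - (x - y))) \<longlongrightarrow> - A x - - A y) (at_right 0)"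
  proof (rule Lim_transform_eventually)
    show "\<forall>\<^sub>F h in at_right 0. (1 / h) *\<^sub>R (T h x - x) - (1 / h) *\<^sub>R (T h y - y)
        = (1 / h) *\<^sub>R (T h (x - y) - (x - y))"
      using eventually_at_right_less[of "0::real"]
    proof eventually_elim
      case (elim h)
      then show ?case by (simp add: T_diff algebra_simps)
    qed
  qed
  from generatorI[OF this] show "x - y \<in> D" "A (x - y) = A x - A y" by simp_all
qed

lemma tame_exp_damped:
  assumes z: "0 \<le> Re z"
  shows "tame (\<lambda>t. exp (- (z * complex_of_real t)) *\<^sub>C damped 0 t x)"
proof (rule tameI)
  show "continuous_on (- {0}) (\<lambda>t. exp (- (z * complex_of_real t)) *\<^sub>C damped 0 t x)"
    by (intro scaleC.continuous_on damped_continuous continuous_intros)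
  show "norm (exp (- (z * complex_of_real t)) *\<^sub>C damped 0 t x) \<le> 1 * (M * norm x)" for t
  proof (cases "0 \<le> t")
    case True
    then show ?thesis
      unfolding norm_scaleC by (intro mult_mono norm_damped_le) (use z in \<open>auto simp: norm_exp_eq_Re\<close>)
  qed (use M1 in \<open>simp add: damped_neg scaleC.zero_right\<close>)
qed simp

text \<open>
  Shift the variable of integration in \<open>T(h) \<integral> e\<^sup>-\<^sup>z\<^sup>t T(t) x dt\<close>: what is lost is the integral over
  \<open>[0, h)\<close>.
\<close>

lemma T_laplace_minus:
  assumes z: "Re z > 0" and h: "h > 0"
  shows "T h (laplace z x) - laplace z x
    = (exp (z * h) - 1) *\<^sub>C laplace z x
      - exp (z * h) *\<^sub>C vint lborel (indicator {0..<h}) (\<lambda>t. exp (- (z * complex_of_real t)) *\<^sub>C damped 0 t x)"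
    (is "_ = _ - _ *\<^sub>C ?w")
proof (rule cinner_ext)
  fix y
  define k where "k t = laplace_kernel z t" for t
  define u where "u t = cinner (damped 0 t x) y" for t
  have k_int: "integrable lborel k"
    unfolding k_def by (rule integrable_laplace_kernel[OF z])
  have ku_int: "integrable lborel (\<lambda>t. k t * u t)"
    unfolding u_def by (rule integrable_weighted_cinner[OF _ k_int tame_damped]) auto
  have i_int: "integrable lborel (indicator {0..<h} :: real \<Rightarrow> complex)"
    by (rule integrable_complex_indicator)
  note w_tame = tame_exp_damped[OF less_imp_le[OF z], of x]
  have h0: "0 \<le> h" using h by simp
  have L: "laplace z x = vint lborel k (\<lambda>t. damped 0 t x)"
    by (simp add: laplace_def k_def[abs_def])
  have "T h (laplace z x) = vint lborel k (\<lambda>t. T h (damped 0 t x))"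
    unfolding L by (rule vint_linear[OF sets_lborel k_int tame_damped T_clinear]) (simp_all add: h0)
  then have "cinner (T h (laplace z x)) y = (\<integral>t. k t * cinner (T h (damped 0 t x)) y \<partial>lborel)"
    using cinner_vint[OF sets_lborel k_int tame_linear[OF T_linear[OF h0] tame_damped], of 0] by simp
  also have "\<dots> = (\<integral>t. k t * u (h + t) \<partial>lborel)"
    using h T_damped[of h] by (intro Bochner_Integration.integral_cong) (auto simp: k_def u_def)
  also have "\<dots> = (\<integral>t. k (- h + t) * u t \<partial>lborel)"
    by (subst (2) lborel_integral_real_affine[where c=1 and t=h]) auto
  also have "\<dots> = (\<integral>t. exp (z * h) * (k t * u t - indicator {0..<h} t * (exp (- (z * complex_of_real t)) * u t)) \<partial>lborel)"
  proof (rule Bochner_Integration.integral_cong[OF refl])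
    fix t :: real
    have "exp (- (z * complex_of_real (- h + t))) = exp (z * h) * exp (- (z * complex_of_real t))"
      by (simp add: algebra_simps flip: exp_add)
    then show "k (- h + t) * u t = exp (z * h) * (k t * u t - indicator {0..<h} t * (exp (- (z * complex_of_real t)) * u t))"
      using h by (auto simp: k_def indicator_def)
  qed
  also have "\<dots> = exp (z * h) * (cinner (laplace z x) y - cinner ?w y)"
  proof -
    have 1: "cinner ?w y = (\<integral>t. indicator {0..<h} t * (exp (- (z * complex_of_real t)) * u t) \<partial>lborel)"
      by (subst cinner_vint[OF _ i_int w_tame]) (auto simp: u_def cinner_scaleC_left)
    have 2: "integrable lborel (\<lambda>t. indicator {0..<h} t * (exp (- (z * complex_of_real t)) * u t))"
      using integrable_weighted_cinner[OF _ i_int w_tame, of y] by (simp add: u_def cinner_scaleC_left)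
    have 3: "cinner (laplace z x) y = (\<integral>t. k t * u t \<partial>lborel)"
      using cinner_laplace[OF z] by (simp add: u_def k_def)
    show ?thesis unfolding 1 3
      by (subst Bochner_Integration.integral_diff[symmetric, OF ku_int 2]) simp
  qed
  finally show "cinner (T h (laplace z x) - laplace z x) y
    = cinner ((exp (z * h) - 1) *\<^sub>C laplace z x - exp (z * h) *\<^sub>C ?w) y"
    by (simp add: cinner.diff_left cinner_scaleC_left algebra_simps)
qed

text \<open>
  Divide the previous identity by \<open>h\<close> and let \<open>h \<rightarrow> 0\<close>.
\<close>

lemma laplace_resolvent:
  assumes z: "Re z > 0"
  shows "laplace z x \<in> D" "z *\<^sub>C laplace z x + A (laplace z x) = x"
proof -
  let ?v = "laplace z x"
  let ?f = "\<lambda>t. exp (- (z * complex_of_real t)) *\<^sub>C damped 0 t x"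
  have lim1: "((\<lambda>h::real. (exp (z * h) - 1) / h) \<longlongrightarrow> z) (at_right 0)"
  proof -
    have "((\<lambda>w. exp (z * w)) has_field_derivative z) (at 0)"
      by (auto intro!: derivative_eq_intros)
    then have "((\<lambda>w. (exp (z * w) - 1) / w) \<longlongrightarrow> z) (at 0)"
      by (simp add: has_field_derivative_iff)
    moreover have "filterlim complex_of_real (at 0) (at_right 0)"
      unfolding filterlim_at by (auto intro!: tendsto_eq_intros simp: eventually_at_filter)
    ultimately show ?thesis by (rule filterlim_compose)
  qed
  note f_tame = tame_exp_damped[OF less_imp_le[OF z], of x]
  have f_lim: "(?f \<longlongrightarrow> x) (at_right 0)"
  proof -
    have "((\<lambda>t. exp (- (z * complex_of_real t)) *\<^sub>C T t x) \<longlongrightarrow> exp (- (z * complex_of_real 0)) *\<^sub>C x) (at_right 0)"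
      by (intro scaleC.tendsto T_at_0 tendsto_intros)
    then have "((\<lambda>t. exp (- (z * complex_of_real t)) *\<^sub>C T t x) \<longlongrightarrow> x) (at_right 0)"
      by (simp add: scaleC_one)
    then show ?thesis
      by (rule Lim_transform_eventually) (auto simp: eventually_at_filter damped_def)
  qed
  have lim2: "((\<lambda>h::real. ((exp (z * h) - 1) / h) *\<^sub>C ?v
      - exp (z * h) *\<^sub>C ((1 / h) *\<^sub>R vint lborel (indicator {0..<h}) ?f))
      \<longlongrightarrow> z *\<^sub>C ?v - exp (z * complex_of_real 0) *\<^sub>C x) (at_right 0)"
    by (intro tendsto_diff scaleC.tendsto lim1 tendsto_const mean_value_limit f_tame f_lim tendsto_intros)
       (simp add: damped_def scaleC_one)
  have "((\<lambda>h. (1 / h) *\<^sub>R (T h ?v - ?v)) \<longlongrightarrow> z *\<^sub>C ?v - x) (at_right 0)"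
  proof (rule Lim_transform_eventually)
    show "((\<lambda>h::real. ((exp (z * h) - 1) / h) *\<^sub>C ?v
      - exp (z * h) *\<^sub>C ((1 / h) *\<^sub>R vint lborel (indicator {0..<h}) ?f))
      \<longlongrightarrow> z *\<^sub>C ?v - x) (at_right 0)"
      using lim2 by (simp add: scaleC_one)
    show "\<forall>\<^sub>F h in at_right 0. ((exp (z * complex_of_real h) - 1) / complex_of_real h) *\<^sub>C ?v
      - exp (z * complex_of_real h) *\<^sub>C ((1 / h) *\<^sub>R vint lborel (indicator {0..<h}) ?f)
      = (1 / h) *\<^sub>R (T h ?v - ?v)"
      using eventually_at_right_less[of "0::real"]
    proof eventually_elim
      case (elim h)
      have "((exp (z * complex_of_real h) - 1) / complex_of_real h) *\<^sub>C ?v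
        = (1 / h) *\<^sub>R ((exp (z * complex_of_real h) - 1) *\<^sub>C ?v)"
        by (simp add: scaleC_scaleC flip: scaleC_of_real)
      moreover have "exp (z * complex_of_real h) *\<^sub>C ((1 / h) *\<^sub>R vint lborel (indicator {0..<h}) ?f)
        = (1 / h) *\<^sub>R (exp (z * complex_of_real h) *\<^sub>C vint lborel (indicator {0..<h}) ?f)"
        by (rule scaleC.scaleR_right)
      ultimately show ?case
        unfolding T_laplace_minus[OF z elim] by (simp only: scaleR_diff_right)
    qed
  qed
  from generatorI[OF this] show "?v \<in> D" "z *\<^sub>C ?v + A ?v = x" by simp_all
qed

text \<open>
  The definition of the generator gives the derivative from the right. For \<open>s < t\<close> the difference
  quotient is \<open>T(s)\<close> applied to a difference quotient at 0, and the operators \<open>T(s)\<close> are uniformly bounded.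
\<close>

lemma T_has_derivative:
  assumes y: "y \<in> D" and t: "0 \<le> t"
  shows "((\<lambda>s. T s y) has_vector_derivative - T t (A y)) (at t within {0..})"
  unfolding has_vector_derivative_def has_derivative_within
proof (intro conjI bounded_linear_scaleR_left)
  define q where "q h = (1 / h) *\<^sub>R (T h y - y) + A y" for h
  have "((\<lambda>h. M * norm (q h) + M * norm (T h (A y) - A y)) \<longlongrightarrow> M * norm (- A y + A y) + M * norm (A y - A y)) (at_right 0)"
    unfolding q_def by (intro tendsto_intros generator_limit y T_at_0)
  then have "((\<lambda>h. M * norm (q h) + M * norm (T h (A y) - A y)) \<longlongrightarrow> 0) (at_right 0)" by simp
  moreover have "filterlim (\<lambda>s. \<bar>s - t\<bar>) (at_right 0) (at t within {0..})"
    unfolding filterlim_at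
    by (auto intro!: tendsto_eq_intros simp: eventually_at_filter)
  ultimately have lim: "((\<lambda>s. M * norm (q \<bar>s - t\<bar>) + M * norm (T \<bar>s - t\<bar> (A y) - A y)) \<longlongrightarrow> 0) (at t within {0..})"
    by (rule filterlim_compose)
  have key: "norm ((1 / norm (s - t)) *\<^sub>R (T s y - (T t y + (s - t) *\<^sub>R (- T t (A y)))))
      \<le> M * norm (q \<bar>s - t\<bar>) + M * norm (T \<bar>s - t\<bar> (A y) - A y)" if s: "0 \<le> s" "s \<noteq> t" for s
  proof (cases "t < s")
    case True
    define h where "h = s - t"
    have h: "h > 0" "s = t + h" using True by (auto simp: h_def)
    have "T s y = T t (T h y)" using T_add[of t h y] h t by simp
    then have "(1 / norm (s - t)) *\<^sub>R (T s y - (T t y + (s - t) *\<^sub>R (- T t (A y)))) = T t (q \<bar>s - t\<bar>)"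
      using h t unfolding q_def
      by (simp add: linear_add[OF bounded_linear.linear[OF T_linear]] T_diff T_scaleR algebra_simps)
    then have "norm ((1 / norm (s - t)) *\<^sub>R (T s y - (T t y + (s - t) *\<^sub>R (- T t (A y))))) \<le> M * norm (q \<bar>s - t\<bar>)"
      using norm_T[OF t] by simp
    then show ?thesis using M1 by (smt (verit) mult_nonneg_nonneg norm_ge_zero)
  next
    case False
    define h where "h = t - s"
    have h: "h > 0" "t = s + h" using False s by (auto simp: h_def)
    have 1: "T t y = T s (T h y)" "T t (A y) = T s (T h (A y))" using T_add[of s h] h s by auto
    have "(1 / norm (s - t)) *\<^sub>R (T s y - (T t y + (s - t) *\<^sub>R (- T t (A y))))
        = T s (- q h) - T s (T h (A y) - A y)"
      using h s(1) unfolding 1 q_def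
      by (simp add: linear_add[OF bounded_linear.linear[OF T_linear]] T_diff T_scaleR algebra_simps
          linear_neg[OF bounded_linear.linear[OF T_linear]])
    also have "norm \<dots> \<le> norm (T s (- q h)) + norm (T s (T h (A y) - A y))"
      by (rule norm_triangle_ineq4)
    also have "\<dots> \<le> M * norm (- q h) + M * norm (T h (A y) - A y)"
      by (intro add_mono norm_T s)
    finally show ?thesis using h by simp
  qed
  show "((\<lambda>s. (1 / norm (s - t)) *\<^sub>R (T s y - (T t y + (s - t) *\<^sub>R (- T t (A y))))) \<longlongrightarrow> 0) (at t within {0..})"
  proof (rule Lim_null_comparison[OF _ lim])
    show "\<forall>\<^sub>F s in at t within {0..}. norm ((1 / norm (s - t)) *\<^sub>R (T s y - (T t y + (s - t) *\<^sub>R (- T t (A y)))))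
      \<le> M * norm (q \<bar>s - t\<bar>) + M * norm (T \<bar>s - t\<bar> (A y) - A y)"
      unfolding eventually_at_filter by (rule always_eventually) (use key in auto)
  qed
qed

text \<open>
  Duhamel's formula \<open>e\<^sup>-\<^sup>z\<^sup>t T(t) y - y = - \<integral> e\<^sup>-\<^sup>z\<^sup>s T(s) (z + A) y ds\<close>, in the form of the mean value
  inequality. It gives the lower bound for the decay rate and the injectivity of \<open>I + A\<close>.
\<close>

lemma T_exp_bound:
  assumes y: "y \<in> D" and z: "0 \<le> Re z" and t: "0 \<le> t"
  shows "norm (exp (- (z * complex_of_real t)) *\<^sub>C T t y - y) \<le> M * t * norm (z *\<^sub>C y + A y)"
proof -
  let ?f = "\<lambda>s. exp (- (z * complex_of_real s)) *\<^sub>C T s y"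
  let ?f' = "\<lambda>s. exp (- (z * complex_of_real s)) *\<^sub>C (- T s (z *\<^sub>C y + A y))"
  have der: "(?f has_vector_derivative ?f' s) (at s within {0..t})" if "s \<in> {0..t}" for s
  proof -
    have s: "0 \<le> s" using that by simp
    have 1: "((\<lambda>s. exp (- (z * complex_of_real s))) has_vector_derivative - z * exp (- (z * complex_of_real s))) (at s within {0..t})"
      by (auto intro!: derivative_eq_intros has_vector_derivative_real_field)
    have 2: "((\<lambda>s. T s y) has_vector_derivative - T s (A y)) (at s within {0..t})"
      by (rule has_vector_derivative_within_subset[OF T_has_derivative[OF y s]]) auto
    have "(?f has_vector_derivative
        exp (- (z * complex_of_real s)) *\<^sub>C (- T s (A y)) + (- z * exp (- (z * complex_of_real s))) *\<^sub>C T s y)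
        (at s within {0..t})"
      by (rule scaleC.has_vector_derivative[OF 1 2])
    also have "exp (- (z * complex_of_real s)) *\<^sub>C (- T s (A y)) + (- z * exp (- (z * complex_of_real s))) *\<^sub>C T s y
       = ?f' s"
      using s by (simp add: linear_add[OF bounded_linear.linear[OF T_linear]] T_scaleC scaleC.add_right scaleC.minus_right
        scaleC.minus_left scaleC_scaleC mult.commute scaleC.diff_right)
    finally show ?thesis .
  qed
  have "norm (?f t - ?f 0) \<le> (M * norm (z *\<^sub>C y + A y)) * norm (t - 0)"
  proof (rule differentiable_bound[where S="{0..t}" and f'="\<lambda>s h. h *\<^sub>R ?f' s"])
    fix s assume s: "s \<in> {0..t}"
    show "(?f has_derivative (\<lambda>h. h *\<^sub>R ?f' s)) (at s within {0..t})"
      using der[OF s] by (simp add: has_vector_derivative_def)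
    have "norm (?f' s) \<le> 1 * (M * norm (z *\<^sub>C y + A y))"
      unfolding norm_scaleC norm_minus_cancel using s z
      by (intro mult_mono norm_T) (auto simp: norm_exp_eq_Re)
    then show "onorm (\<lambda>h. h *\<^sub>R ?f' s) \<le> M * norm (z *\<^sub>C y + A y)"
      by (intro onorm_bound) (use M1 in \<open>auto intro: mult_left_mono simp: mult.commute\<close>)
  qed (use t in auto)
  then show ?thesis using t by (simp add: scaleC_one mult_ac)
qed

end

section \<open>Convolutions and their Fourier transforms\<close>

lemma lborel_integrable_shift:
  fixes w :: "real \<Rightarrow> complex"
  assumes "integrable lborel w" shows "integrable lborel (\<lambda>t. w (t + a))"
  using lborel_integrable_real_affine[OF assms, of 1 a] by (simp add: add.commute)

lemma lborel_integral_shift: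
  fixes w :: "real \<Rightarrow> 'b::{banach,second_countable_topology}"
  shows "(\<integral>t. w (t + a) \<partial>lborel) = (\<integral>t. w t \<partial>lborel)"
  using lborel_integral_real_affine[of 1 w a] by (simp add: add.commute)

context
  fixes N :: "real measure" and g w :: "real \<Rightarrow> complex" and h :: "real \<Rightarrow> real"
  assumes sf: "sigma_finite_measure N" and sets: "sets N = sets borel"
    and g: "integrable N g" and w: "integrable lborel w" and h: "h \<in> borel_measurable borel"
begin

text \<open>
  The shift is an arbitrary measurable function of the first variable, so that the same lemmas serve
  for the correlations \<open>\<integral> g(u) w(t + u) du\<close> and for the convolution with a measure.
\<close>

lemma convolution_integrable:
  "integrable (N \<Otimes>\<^sub>M lborel) (\<lambda>(u, t). g u * w (t + h u))"
proof -
  interpret N: sigma_finite_measure N by fact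
  interpret pair_sigma_finite N lborel ..
  have [measurable]: "h \<in> borel_measurable N" "g \<in> borel_measurable N" "w \<in> borel_measurable borel"
    using h g w sets by (auto cong: measurable_cong_sets)
  show ?thesis
  proof (rule Fubini_integrable)
    show "(\<lambda>(u, t). g u * w (t + h u)) \<in> borel_measurable (N \<Otimes>\<^sub>M lborel)" by measurable
    show "AE u in N. integrable lborel (\<lambda>t. case (u, t) of (u, t) \<Rightarrow> g u * w (t + h u))"
      using lborel_integrable_shift[OF w] by simp
    have "(\<integral>t. norm (case (u, t) of (u, t) \<Rightarrow> g u * w (t + h u)) \<partial>lborel)
        = cmod (g u) * (\<integral>t. cmod (w t) \<partial>lborel)" for u
      using lborel_integral_shift[of "\<lambda>t. cmod (w t)" "h u"] by (simp add: norm_mult)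
    then show "integrable N (\<lambda>u. \<integral>t. norm (case (u, t) of (u, t) \<Rightarrow> g u * w (t + h u)) \<partial>lborel)"
      using g by simp
  qed
qed

lemma convolution_pairing:
  assumes b: "b \<in> borel_measurable borel" and B: "\<And>t. cmod (b t) \<le> B"
  shows "(\<integral>t. b t * (\<integral>u. g u * w (t + h u) \<partial>N) \<partial>lborel)
    = (\<integral>u. g u * (\<integral>v. b (v - h u) * w v \<partial>lborel) \<partial>N)"
proof -
  interpret N: sigma_finite_measure N by fact
  interpret pair_sigma_finite N lborel ..
  have [measurable]: "h \<in> borel_measurable N" "g \<in> borel_measurable N" "w \<in> borel_measurable borel"
      "b \<in> borel_measurable borel"
    using h g w b sets by (auto cong: measurable_cong_sets)
  have int: "integrable (N \<Otimes>\<^sub>M lborel) (\<lambda>(u, t). b t * (g u * w (t + h u)))"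
  proof (rule Bochner_Integration.integrable_bound)
    show "integrable (N \<Otimes>\<^sub>M lborel) (\<lambda>p. complex_of_real B * (case p of (u, t) \<Rightarrow> g u * w (t + h u)))"
      using convolution_integrable by simp
    have "0 \<le> B" using B[of 0] norm_ge_zero order_trans by blast
    then show "AE p in N \<Otimes>\<^sub>M lborel. cmod (case p of (u, t) \<Rightarrow> b t * (g u * w (t + h u)))
      \<le> cmod (complex_of_real B * (case p of (u, t) \<Rightarrow> g u * w (t + h u)))"
      by (intro AE_I2) (auto simp: norm_mult split: prod.split intro!: mult_right_mono B)
  qed measurable
  have "(\<integral>t. b t * (\<integral>u. g u * w (t + h u) \<partial>N) \<partial>lborel)
      = (\<integral>t. (\<integral>u. b t * (g u * w (t + h u)) \<partial>N) \<partial>lborel)"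
    by simp
  also have "\<dots> = (\<integral>u. (\<integral>t. b t * (g u * w (t + h u)) \<partial>lborel) \<partial>N)"
    by (rule Fubini_integral) (use int in simp)
  also have "\<dots> = (\<integral>u. g u * (\<integral>v. b (v - h u) * w v \<partial>lborel) \<partial>N)"
  proof (rule Bochner_Integration.integral_cong[OF refl])
    fix u
    have "(\<integral>t. b t * (g u * w (t + h u)) \<partial>lborel) = (\<integral>t. g u * (b ((t + h u) - h u) * w (t + h u)) \<partial>lborel)"
      by (simp add: mult_ac)
    also have "\<dots> = g u * (\<integral>v. b (v - h u) * w v \<partial>lborel)"
      using lborel_integral_shift[of "\<lambda>v. b (v - h u) * w v" "h u"] by simp
    finally show "(\<integral>t. b t * (g u * w (t + h u)) \<partial>lborel) = g u * (\<integral>v. b (v - h u) * w v \<partial>lborel)" .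
  qed
  finally show ?thesis .
qed

lemma convolution_integrable_snd: "integrable lborel (\<lambda>t. \<integral>u. g u * w (t + h u) \<partial>N)"
proof -
  interpret N: sigma_finite_measure N by fact
  interpret pair_sigma_finite N lborel ..
  show ?thesis using integrable_snd[OF convolution_integrable] .
qed

lemma convolution_fourier:
  "fourier (\<lambda>t. \<integral>u. g u * w (t + h u) \<partial>N) s
    = (\<integral>u. g u * exp (\<i> * complex_of_real s * complex_of_real (h u)) \<partial>N) * fourier w s"
proof -
  have "fourier (\<lambda>t. \<integral>u. g u * w (t + h u) \<partial>N) s
    = (\<integral>u. g u * (\<integral>v. wave s (v - h u) * w v \<partial>lborel) \<partial>N)"
    unfolding fourier_def
    by (rule convolution_pairing[where B=1]) (auto simp: norm_exp_eq_Re)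
  also have "\<dots> = (\<integral>u. (g u * exp (\<i> * complex_of_real s * complex_of_real (h u))) * fourier w s \<partial>N)"
  proof (rule Bochner_Integration.integral_cong[OF refl])
    fix u
    have E: "wave s (v - h u) * w v
      = exp (\<i> * complex_of_real s * complex_of_real (h u)) * (wave s v * w v)" for v
      by (simp add: algebra_simps exp_diff exp_minus divide_simps)
    show "g u * (\<integral>v. wave s (v - h u) * w v \<partial>lborel)
      = (g u * exp (\<i> * complex_of_real s * complex_of_real (h u))) * fourier w s"
      unfolding E fourier_def integral_mult_right_zero by (simp only: mult.assoc)
  qed
  finally show ?thesis by simp
qed

end

lemma cmod_fourier_le: "cmod (fourier g s) \<le> (\<integral>t. cmod (g t) \<partial>lborel)"
proof -
  have "cmod (fourier g s) \<le> (\<integral>t. cmod (wave s t * g t) \<partial>lborel)"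
    unfolding fourier_def by (rule integral_norm_bound)
  then show ?thesis by (simp add: norm_mult norm_exp_eq_Re)
qed

lemma vint_diff:
  fixes f1 f2 :: "real \<Rightarrow> 'a::complex_hilbert_space"
  assumes "sets N = sets borel" "integrable N g" "tame f1" "tame f2"
  shows "vint N g f1 - vint N g f2 = vint N g (\<lambda>s. f1 s - f2 s)"
proof (rule cinner_ext)
  fix y
  have "(\<lambda>s. g s * cinner (f1 s - f2 s) y) = (\<lambda>s. g s * cinner (f1 s) y - g s * cinner (f2 s) y)"
    by (simp add: cinner.diff_left algebra_simps)
  then show "cinner (vint N g f1 - vint N g f2) y = cinner (vint N g (\<lambda>s. f1 s - f2 s)) y"
    using assms by (simp add: cinner.diff_left cinner_vint tame_diff integrable_weighted_cinner)
qed

lemma vint_diff_weight: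
  fixes f :: "real \<Rightarrow> 'a::complex_hilbert_space"
  assumes "sets N = sets borel" "integrable N g1" "integrable N g2" "tame f"
  shows "vint N g1 f - vint N g2 f = vint N (\<lambda>s. g1 s - g2 s) f"
proof (rule cinner_ext)
  fix y
  have "(\<lambda>s. (g1 s - g2 s) * cinner (f s) y) = (\<lambda>s. g1 s * cinner (f s) y - g2 s * cinner (f s) y)"
    by (simp add: algebra_simps)
  then show "cinner (vint N g1 f - vint N g2 f) y = cinner (vint N (\<lambda>s. g1 s - g2 s) f) y"
    using assms by (simp add: cinner.diff_left cinner_vint integrable_weighted_cinner)
qed

lemma convolution_pairing':
  fixes N :: "real measure" and g w b :: "real \<Rightarrow> complex"
  assumes sf: "sigma_finite_measure N" and sets: "sets N = sets borel"
    and g: "integrable N g" and w: "integrable lborel w" and h: "h \<in> borel_measurable borel"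
    and b: "b \<in> borel_measurable borel" and B: "\<And>t. cmod (b t) \<le> B"
  shows "(\<integral>t. b t * (\<integral>u. g u * w (t + h u) \<partial>N) \<partial>lborel)
    = (\<integral>v. w v * (\<integral>u. g u * b (v - h u) \<partial>N) \<partial>lborel)"
    and "integrable lborel (\<lambda>v. w v * (\<integral>u. g u * b (v - h u) \<partial>N))"
proof -
  interpret N: sigma_finite_measure N by fact
  interpret pair_sigma_finite N lborel ..
  have [measurable]: "h \<in> borel_measurable N" "g \<in> borel_measurable N" "w \<in> borel_measurable borel"
      "b \<in> borel_measurable borel"
    using h g w b sets by (auto cong: measurable_cong_sets)
  have int: "integrable (N \<Otimes>\<^sub>M lborel) (\<lambda>(u, v). g u * (b (v - h u) * w v))"
  proof (rule Bochner_Integration.integrable_bound)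
    show "integrable (N \<Otimes>\<^sub>M lborel) (\<lambda>p. complex_of_real B * (g (fst p) * w (snd p)))"
      using integrable_product[OF sf lborel.sigma_finite_measure_axioms g w] by simp
    have "0 \<le> B" using B[of 0] norm_ge_zero order_trans by blast
    then show "AE p in N \<Otimes>\<^sub>M lborel. cmod (case p of (u, v) \<Rightarrow> g u * (b (v - h u) * w v))
      \<le> cmod (complex_of_real B * (g (fst p) * w (snd p)))"
    proof (intro AE_I2)
      fix p :: "real \<times> real"
      obtain u v where p: "p = (u, v)" by (cases p)
      have "cmod (b (v - h u)) * (cmod (g u) * cmod (w v)) \<le> B * (cmod (g u) * cmod (w v))"
        by (intro mult_right_mono B) auto
      then show "cmod (case p of (u, v) \<Rightarrow> g u * (b (v - h u) * w v))
        \<le> cmod (complex_of_real B * (g (fst p) * w (snd p)))"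
        using \<open>0 \<le> B\<close> by (simp add: p norm_mult mult_ac)
    qed
  qed measurable
  have "(\<integral>t. b t * (\<integral>u. g u * w (t + h u) \<partial>N) \<partial>lborel)
      = (\<integral>u. g u * (\<integral>v. b (v - h u) * w v \<partial>lborel) \<partial>N)"
    by (rule convolution_pairing[OF sf sets g w h b B])
  also have "\<dots> = (\<integral>u. (\<integral>v. g u * (b (v - h u) * w v) \<partial>lborel) \<partial>N)" by simp
  also have "\<dots> = (\<integral>v. (\<integral>u. g u * (b (v - h u) * w v) \<partial>N) \<partial>lborel)"
    by (rule Fubini_integral[symmetric]) (use int in simp)
  also have "(\<lambda>v. \<integral>u. g u * (b (v - h u) * w v) \<partial>N) = (\<lambda>v. w v * (\<integral>u. g u * b (v - h u) \<partial>N))"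
    by (subst integral_mult_right_zero[symmetric]) (simp add: mult_ac)
  finally show "(\<integral>t. b t * (\<integral>u. g u * w (t + h u) \<partial>N) \<partial>lborel)
    = (\<integral>v. w v * (\<integral>u. g u * b (v - h u) \<partial>N) \<partial>lborel)" .
  have "integrable lborel (\<lambda>v. \<integral>u. g u * (b (v - h u) * w v) \<partial>N)"
    using integrable_snd[OF int] .
  also have "(\<lambda>v. \<integral>u. g u * (b (v - h u) * w v) \<partial>N) = (\<lambda>v. w v * (\<integral>u. g u * b (v - h u) \<partial>N))"
    by (subst integral_mult_right_zero[symmetric]) (simp add: mult_ac)
  finally show "integrable lborel (\<lambda>v. w v * (\<integral>u. g u * b (v - h u) \<partial>N))" .
qed

text \<open>
  The mass that is cut off when the semigroup is started at time \<open>-t\<close>.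
\<close>

definition tail :: "(real \<Rightarrow> complex) \<Rightarrow> real \<Rightarrow> real" where
  "tail g t = (\<integral>s. indicator {..<-t} s * cmod (g s) \<partial>lborel)"

section \<open>Fourier multipliers of a semigroup\<close>

context bounded_c0_semigroup
begin

abbreviation axis_shift :: "real \<Rightarrow> 'a \<Rightarrow> 'a" where
  "axis_shift s v \<equiv> (\<i> * complex_of_real s) *\<^sub>C v + A v"

text \<open>
  The operator \<open>\<integral> T(t + s) d\<phi>(s)\<close> for \<open>\<phi> = c \<delta>\<^sub>0 + g(s) ds\<close> and the damped semigroup. The point mass is
  needed to express \<open>\<delta>\<^sub>0 - P\<close>, which removes low frequencies from \<open>T\<close>.
\<close>

definition multiplier :: "complex \<Rightarrow> (real \<Rightarrow> complex) \<Rightarrow> real \<Rightarrow> real \<Rightarrow> 'a \<Rightarrow> 'a" where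
  "multiplier c g \<alpha> t x = c *\<^sub>C damped \<alpha> t x + vint lborel g (\<lambda>s. damped \<alpha> (t + s) x)"

lemma cinner_damped_measurable [measurable]:
  assumes "0 \<le> \<alpha>" shows "(\<lambda>t. cinner (damped \<alpha> t x) y) \<in> borel_measurable borel"
  by (rule tame_borel_measurable[OF tame_linear[OF cinner.bounded_linear_left tame_damped[OF assms]]])

context
  fixes c :: complex and g :: "real \<Rightarrow> complex"
  assumes g: "integrable lborel g"
begin

private definition B where "B = cmod c + (\<integral>t. cmod (g t) \<partial>lborel)"

private lemma B_nonneg: "0 \<le> B"
  by (simp add: B_def)

private lemma g_meas [measurable]: "g \<in> borel_measurable borel" using g by auto

lemma cinner_multiplier:
  assumes "0 \<le> \<alpha>"
  shows "cinner (multiplier c g \<alpha> t x) y = c * cinner (damped \<alpha> t x) y + (\<integral>s. g s * cinner (damped \<alpha> (t + s) x) y \<partial>lborel)"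
  unfolding multiplier_def cinner.add_left cinner_scaleC_left
  by (subst cinner_vint[OF _ g tame_shift[OF tame_damped[OF assms]]]) auto

private lemma norm_multiplier_conv:
  assumes "0 \<le> \<alpha>"
  shows "norm (multiplier c g \<alpha> t x) \<le> cmod c * norm (damped \<alpha> t x) + (\<integral>s. cmod (g s) * norm (damped \<alpha> (t + s) x) \<partial>lborel)"
  unfolding multiplier_def
  by (rule order_trans[OF norm_triangle_ineq], intro add_mono norm_vint_le g tame_shift[OF tame_damped[OF assms]])
     (auto simp: norm_scaleC)

lemma norm_multiplier:
  assumes "0 \<le> \<alpha>"
  shows "norm (multiplier c g \<alpha> t x) \<le> (cmod c + (\<integral>t. cmod (g t) \<partial>lborel)) * (M * norm x)"
proof -
  have "(\<integral>s. cmod (g s) * norm (damped \<alpha> (t + s) x) \<partial>lborel) \<le> (\<integral>s. cmod (g s) * (M * norm x) \<partial>lborel)"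
  proof (rule integral_mono)
    show "integrable lborel (\<lambda>s. cmod (g s) * norm (damped \<alpha> (t + s) x))"
      by (rule integrable_weighted_norm[OF _ g tame_shift[OF tame_damped[OF assms]]]) auto
  qed (use g norm_damped_le[OF assms] in \<open>auto intro!: mult_left_mono\<close>)
  then show ?thesis
    using norm_multiplier_conv[OF assms, of t x] mult_left_mono[OF norm_damped_le[OF assms, of t x], of "cmod c"]
    by (simp add: algebra_simps)
qed

text \<open>
  The integral term is continuous in \<open>t\<close> by dominated convergence; the term with the point mass jumps
  at 0 only.
\<close>

private lemma tame_multiplier:
  assumes "0 \<le> \<alpha>" shows "tame (\<lambda>t. multiplier c g \<alpha> t x)"
proof (rule tameI)
  show "norm (multiplier c g \<alpha> t x) \<le> B * (M * norm x)" for t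
    unfolding B_def by (rule norm_multiplier[OF assms])
  have "isCont (\<lambda>t. vint lborel g (\<lambda>s. damped \<alpha> (t + s) x)) t" for t
    unfolding continuous_at_sequentially o_def
  proof (intro allI impI)
    fix r assume r: "r \<longlonglongrightarrow> t"
    have tm: "tame (\<lambda>s. damped \<alpha> (a + s) x)" for a by (rule tame_shift[OF tame_damped[OF assms]])
    have "(\<lambda>n. \<integral>s. cmod (g s) * norm (damped \<alpha> (r n + s) x - damped \<alpha> (t + s) x) \<partial>lborel) \<longlonglongrightarrow> (\<integral>s. 0 \<partial>(lborel::real measure))"
    proof (rule integral_dominated_convergence[where w="\<lambda>s. cmod (g s) * (2 * (M * norm x))"])
      show "(\<lambda>s. cmod (g s) * norm (damped \<alpha> (r n + s) x - damped \<alpha> (t + s) x)) \<in> borel_measurable lborel" for n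
        using integrable_weighted_norm[OF _ g tame_diff[OF tm tm], of "r n" t] by auto
      show "integrable lborel (\<lambda>s. cmod (g s) * (2 * (M * norm x)))" using g by auto
      show "AE s in lborel. norm (cmod (g s) * norm (damped \<alpha> (r n + s) x - damped \<alpha> (t + s) x)) \<le> cmod (g s) * (2 * (M * norm x))" for n
      proof (rule AE_I2)
        fix s
        have "norm (damped \<alpha> (r n + s) x - damped \<alpha> (t + s) x) \<le> 2 * (M * norm x)"
          using norm_triangle_ineq4[of "damped \<alpha> (r n + s) x" "damped \<alpha> (t + s) x"]
            norm_damped_le[OF assms, of "r n + s" x] norm_damped_le[OF assms, of "t + s" x] by linarith
        then show "norm (cmod (g s) * norm (damped \<alpha> (r n + s) x - damped \<alpha> (t + s) x)) \<le> cmod (g s) * (2 * (M * norm x))"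
          by (simp add: mult_left_mono)
      qed
      have "AE s in lborel. s \<notin> {-t}"
        using finite_imp_null_set_lborel[of "{-t}"] by (intro AE_not_in) auto
      then show "AE s in lborel. (\<lambda>n. cmod (g s) * norm (damped \<alpha> (r n + s) x - damped \<alpha> (t + s) x)) \<longlonglongrightarrow> 0"
      proof eventually_elim
        case (elim s)
        have "isCont (\<lambda>t. damped \<alpha> t x) (t + s)"
          using damped_continuous[of \<alpha> x] elim
          by (subst (asm) continuous_on_eq_continuous_at) (auto simp: open_Compl)
        then have "(\<lambda>n. damped \<alpha> (r n + s) x) \<longlonglongrightarrow> damped \<alpha> (t + s) x"
          by (rule isCont_tendsto_compose) (intro tendsto_intros r)
        then have "(\<lambda>n. cmod (g s) * norm (damped \<alpha> (r n + s) x - damped \<alpha> (t + s) x)) \<longlonglongrightarrow> cmod (g s) * norm (damped \<alpha> (t + s) x - damped \<alpha> (t + s) x)"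
          by (intro tendsto_intros)
        then show ?case by simp
      qed
    qed simp
    then have "(\<lambda>n. \<integral>s. cmod (g s) * norm (damped \<alpha> (r n + s) x - damped \<alpha> (t + s) x) \<partial>lborel) \<longlonglongrightarrow> 0" by simp
    moreover have "norm (vint lborel g (\<lambda>s. damped \<alpha> (r n + s) x) - vint lborel g (\<lambda>s. damped \<alpha> (t + s) x))
        \<le> (\<integral>s. cmod (g s) * norm (damped \<alpha> (r n + s) x - damped \<alpha> (t + s) x) \<partial>lborel)" for n
      unfolding vint_diff[OF sets_lborel g tm tm]
      by (rule norm_vint_le[OF _ g tame_diff[OF tm tm]]) auto
    ultimately show "(\<lambda>n. vint lborel g (\<lambda>s. damped \<alpha> (r n + s) x)) \<longlonglongrightarrow> vint lborel g (\<lambda>s. damped \<alpha> (t + s) x)"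
      by (subst LIM_zero_iff[symmetric]) (rule Lim_null_comparison, rule always_eventually, rule allI)
  qed
  then show "continuous_on (- {0}) (\<lambda>t. multiplier c g \<alpha> t x)"
    unfolding multiplier_def
    by (intro continuous_on_add scaleC.continuous_on continuous_on_const damped_continuous
        continuous_at_imp_continuous_on) auto
qed simp

private lemma cinner_damped_integrable:
  assumes "0 < \<alpha>" shows "integrable lborel (\<lambda>t. cinner (damped \<alpha> t x) y)"
proof (rule Bochner_Integration.integrable_bound)
  show "integrable lborel (\<lambda>t. exp_decay \<alpha> t * (M * norm x * norm y))"
    using integral_exp_decay(1)[OF assms] by auto
  show "AE t in lborel. norm (cinner (damped \<alpha> t x) y)
    \<le> norm (exp_decay \<alpha> t * (M * norm x * norm y))"
  proof (rule AE_I2)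
    fix t
    have "norm (cinner (damped \<alpha> t x) y) \<le> norm (damped \<alpha> t x) * norm y" by (rule cinner_cauchy_schwarz)
    also have "\<dots> \<le> exp_decay \<alpha> t * (M * norm x) * norm y"
      by (intro mult_right_mono norm_damped) auto
    also have "\<dots> \<le> norm (exp_decay \<alpha> t * (M * norm x * norm y))"
      by (simp add: mult.assoc)
    finally show "norm (cinner (damped \<alpha> t x) y)
      \<le> norm (exp_decay \<alpha> t * (M * norm x * norm y))" .
  qed
qed (use assms in \<open>simp add: cinner_damped_measurable\<close>)

private lemma multiplier_norm_integrable:
  assumes "0 < \<alpha>" shows "integrable lborel (\<lambda>t. norm (multiplier c g \<alpha> t x))"
proof -
  define b where "b t = exp_decay \<alpha> t * (M * norm x)" for t
  have b: "integrable lborel b"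
    unfolding b_def using integral_exp_decay(1)[OF assms] by auto
  have [measurable]: "b \<in> borel_measurable borel" using b by auto
  have b_le: "norm (damped \<alpha> t x) \<le> b t" for t unfolding b_def by (rule norm_damped)
  have b_bound: "norm (b t) \<le> M * norm x" for t
    using M1 assms by (auto simp: b_def abs_mult intro!: mult_left_le_one_le)
  have ci: "integrable lborel (\<lambda>t. \<integral>s. complex_of_real (cmod (g s)) * complex_of_real (b (t + s)) \<partial>lborel)"
    by (rule convolution_integrable_snd[of lborel _ _ "\<lambda>s. s"])
       (use g b lborel.sigma_finite_measure_axioms in auto)
  then have ci: "integrable lborel (\<lambda>t. \<integral>s. cmod (g s) * b (t + s) \<partial>lborel)"
    unfolding of_real_mult[symmetric] integral_complex_of_real complex_of_real_integrable_eq .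
  show ?thesis
  proof (rule Bochner_Integration.integrable_bound)
    show "integrable lborel (\<lambda>t. cmod c * b t + (\<integral>s. cmod (g s) * b (t + s) \<partial>lborel))"
      using b ci by auto
    show "(\<lambda>t. norm (multiplier c g \<alpha> t x)) \<in> borel_measurable lborel"
      using tame_borel_measurable[OF tame_norm[OF tame_multiplier]] assms by simp
    show "AE t in lborel. norm (norm (multiplier c g \<alpha> t x)) \<le> norm (cmod c * b t + (\<integral>s. cmod (g s) * b (t + s) \<partial>lborel))"
    proof (rule AE_I2)
      fix t
      have "(\<integral>s. cmod (g s) * norm (damped \<alpha> (t + s) x) \<partial>lborel) \<le> (\<integral>s. cmod (g s) * b (t + s) \<partial>lborel)"
      proof (rule integral_mono)
        show "integrable lborel (\<lambda>s. cmod (g s) * norm (damped \<alpha> (t + s) x))"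
          by (rule integrable_weighted_norm[OF _ g tame_shift[OF tame_damped]]) (use assms in auto)
        show "integrable lborel (\<lambda>s. cmod (g s) * b (t + s))"
          by (rule Bochner_Integration.integrable_bound[of _ "\<lambda>s. cmod (g s) * (M * norm x)"])
             (use g b_bound M1 in \<open>auto simp: abs_mult intro!: mult_left_mono\<close>)
      qed (intro mult_left_mono b_le norm_ge_zero)
      moreover have "cmod c * norm (damped \<alpha> t x) \<le> cmod c * b t"
        by (intro mult_left_mono b_le norm_ge_zero)
      ultimately show "norm (norm (multiplier c g \<alpha> t x)) \<le> norm (cmod c * b t + (\<integral>s. cmod (g s) * b (t + s) \<partial>lborel))"
        using norm_multiplier_conv[of \<alpha> t x] assms by simp
    qed
  qed
qed

lemma laplace_damped:
  assumes "0 < \<alpha>"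
  shows "cinner (laplace (Complex \<alpha> s) x) y
    = (\<integral>t. wave s t * cinner (damped \<alpha> t x) y \<partial>lborel)"
proof (subst cinner_laplace)
  have "exp (- (Complex \<alpha> s * complex_of_real t))
     = wave s t * complex_of_real (exp (- (\<alpha> * t)))" for t
    by (simp add: complex_eq_iff exp_of_real[symmetric] Complex_eq algebra_simps flip: exp_add)
  then show "(\<integral>t. (if 0 \<le> t then exp (- (Complex \<alpha> s * complex_of_real t)) else 0) * cinner (damped 0 t x) y \<partial>lborel)
    = (\<integral>t. wave s t * cinner (damped \<alpha> t x) y \<partial>lborel)"
    by (intro Bochner_Integration.integral_cong)
       (auto simp: damped_def cinner_scaleR_left scaleR_conv_of_real cinner.zero_left)
qed (use assms in simp)

text \<open>
  On the Fourier side the multiplier acts by multiplication with the transform of \<open>\<phi>\<close>. The sign of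
  the frequency is reversed because \<open>T(t + s)\<close> is a correlation rather than a convolution.
\<close>

private lemma fourier_multiplier:
  assumes \<alpha>: "0 < \<alpha>"
  shows "cinner ((c + fourier g (- s)) *\<^sub>C laplace (Complex \<alpha> s) x) y
    = (\<integral>t. wave s t * cinner (multiplier c g \<alpha> t x) y \<partial>lborel)"
proof -
  define w where "w t = cinner (damped \<alpha> t x) y" for t
  have w: "integrable lborel w" unfolding w_def by (rule cinner_damped_integrable[OF \<alpha>])
  have Ew: "fourier w s = cinner (laplace (Complex \<alpha> s) x) y"
    unfolding fourier_def w_def laplace_damped[OF \<alpha>] ..
  have cw: "integrable lborel (\<lambda>t. \<integral>u. g u * w (t + u) \<partial>lborel)"
    by (rule convolution_integrable_snd[of lborel _ _ "\<lambda>s. s"])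
       (use g w lborel.sigma_finite_measure_axioms in auto)
  have E_int: "integrable lborel (\<lambda>t. wave s t * f t)"
    if "integrable lborel f" for f
    by (rule Bochner_Integration.integrable_bound[OF that]) (use that in \<open>auto simp: norm_mult norm_exp_eq_Re\<close>)
  have "(\<integral>t. wave s t * cinner (multiplier c g \<alpha> t x) y \<partial>lborel)
    = (\<integral>t. c * (wave s t * w t)
       + wave s t * (\<integral>u. g u * w (t + u) \<partial>lborel) \<partial>lborel)"
    using \<alpha> by (simp add: cinner_multiplier w_def algebra_simps)
  also have "\<dots> = c * fourier w s + fourier (\<lambda>t. \<integral>u. g u * w (t + u) \<partial>lborel) s"
    unfolding fourier_def by (subst Bochner_Integration.integral_add) (use E_int[OF w] E_int[OF cw] in auto)
  also have "fourier (\<lambda>t. \<integral>u. g u * w (t + u) \<partial>lborel) s = fourier g (- s) * fourier w s"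
    by (subst convolution_fourier[of lborel _ _ "\<lambda>s. s"])
       (use g w lborel.sigma_finite_measure_axioms in \<open>auto simp: fourier_def mult_ac\<close>)
  finally show ?thesis
    by (simp add: Ew cinner_scaleC_left algebra_simps)
qed

context
  fixes K :: real
  assumes K: "0 < K"
    and mult: "\<And>s. c + fourier g (- s) = 0 \<or> (\<forall>v\<in>D. norm v \<le> K * norm (axis_shift s v))"
begin

text \<open>
  Write \<open>a\<close> and \<open>b\<close> for the vectors on the two sides. They lie in the domain, and \<open>is + A\<close> maps
  \<open>a - b\<close> to \<open>b/K - \<alpha> a\<close>. The lower bound for \<open>is + A\<close> then yields \<open>\<parallel>a - b\<parallel> \<le> \<parallel>b\<parallel> + \<parallel>a\<parallel> / 2\<close>. The comparison with the abscissa \<open>1/K\<close> gives a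
  constant \<open>K\<close>, not \<open>K\<^sup>2\<close>, in the square integral below; the rate in (b) depends on this.
\<close>

private lemma laplace_compare:
  assumes \<alpha>: "0 < \<alpha>" "\<alpha> * K \<le> 1 / 2"
    and s: "\<forall>v\<in>D. norm v \<le> K * norm (axis_shift s v)"
  shows "norm (laplace (Complex \<alpha> s) x) \<le> 4 * norm (laplace (Complex (1 / K) s) x)"
proof -
  let ?a = "laplace (Complex \<alpha> s) x" and ?b = "laplace (Complex (1 / K) s) x"
  have eq: "(\<i> * complex_of_real s) *\<^sub>C laplace (Complex r s) x + A (laplace (Complex r s) x) = x - r *\<^sub>R laplace (Complex r s) x"
    "laplace (Complex r s) x \<in> D" if "r > 0" for r
  proof -
    have "Complex r s *\<^sub>C laplace (Complex r s) x + A (laplace (Complex r s) x) = x"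
      "laplace (Complex r s) x \<in> D"
      using laplace_resolvent[of "Complex r s" x] that by auto
    then show "(\<i> * complex_of_real s) *\<^sub>C laplace (Complex r s) x + A (laplace (Complex r s) x) = x - r *\<^sub>R laplace (Complex r s) x"
      "laplace (Complex r s) x \<in> D"
      by (simp_all add: Complex_eq scaleC.add_left scaleC_of_real algebra_simps)
  qed
  have r: "\<alpha> > 0" "1 / K > 0" using \<alpha> K by auto
  have "(\<i> * complex_of_real s) *\<^sub>C (?a - ?b) + A (?a - ?b) = (1 / K) *\<^sub>R ?b - \<alpha> *\<^sub>R ?a"
  proof -
    have "(\<i> * complex_of_real s) *\<^sub>C (?a - ?b) + A (?a - ?b)
      = ((\<i> * complex_of_real s) *\<^sub>C ?a + A ?a) - ((\<i> * complex_of_real s) *\<^sub>C ?b + A ?b)"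
      unfolding D_diff(2)[OF eq(2)[OF r(1)] eq(2)[OF r(2)]] scaleC.diff_right by simp
    also have "\<dots> = (x - \<alpha> *\<^sub>R ?a) - (x - (1 / K) *\<^sub>R ?b)"
      unfolding eq(1)[OF r(1)] eq(1)[OF r(2)] ..
    finally show ?thesis by simp
  qed
  moreover have "?a - ?b \<in> D" using D_diff(1) eq(2) r by blast
  ultimately have "norm (?a - ?b) \<le> K * norm ((1 / K) *\<^sub>R ?b - \<alpha> *\<^sub>R ?a)"
    using s by metis
  also have "\<dots> \<le> K * ((1 / K) * norm ?b + \<alpha> * norm ?a)"
    using K \<alpha> norm_triangle_ineq4[of "(1 / K) *\<^sub>R ?b" "\<alpha> *\<^sub>R ?a"] by (intro mult_left_mono) auto
  also have "\<dots> = norm ?b + (\<alpha> * K) * norm ?a" using K by (simp add: algebra_simps)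
  also have "\<dots> \<le> norm ?b + 1 / 2 * norm ?a"
    using \<alpha> by (intro add_left_mono mult_right_mono) auto
  finally have "norm (?a - ?b) \<le> norm ?b + 1 / 2 * norm ?a" .
  then show ?thesis using norm_triangle_ineq2[of ?a ?b] by linarith
qed

text \<open>
  Plancherel's theorem for the multiplier and for the orbit damped by \<open>e\<^sup>-\<^sup>t\<^sup>/\<^sup>K\<close>.
\<close>

private lemma multiplier_L2:
  assumes \<alpha>: "0 < \<alpha>" "\<alpha> * K \<le> 1 / 2"
  shows "(\<integral>t. (norm (multiplier c g \<alpha> t x))\<^sup>2 \<partial>lborel) \<le> 8 * B\<^sup>2 * M\<^sup>2 * K * (norm x)\<^sup>2"
proof -
  define \<beta> where "\<beta> = 1 / K"
  have \<beta>: "0 < \<beta>" using K by (simp add: \<beta>_def)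
  have "(\<integral>\<^sup>+s. ennreal ((norm ((c + fourier g (- s)) *\<^sub>C laplace (Complex \<alpha> s) x))\<^sup>2) \<partial>lborel)
      = ennreal (2 * pi * (\<integral>t. (norm (multiplier c g \<alpha> t x))\<^sup>2 \<partial>lborel))"
    by (rule plancherel[OF tame_multiplier multiplier_norm_integrable fourier_multiplier]) (use \<alpha> in auto)
  moreover have damped_int: "integrable lborel (\<lambda>t. norm (damped \<beta> t x))"
  proof (rule Bochner_Integration.integrable_bound)
    show "integrable lborel (\<lambda>t. exp_decay \<beta> t * (M * norm x))"
      using integral_exp_decay(1)[OF \<beta>] by auto
    show "AE t in lborel. norm (norm (damped \<beta> t x)) \<le> norm (exp_decay \<beta> t * (M * norm x))"
      unfolding real_norm_def abs_norm_cancel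
      by (intro AE_I2 order_trans[OF norm_damped abs_ge_self])
    show "(\<lambda>t. norm (damped \<beta> t x)) \<in> borel_measurable lborel"
      using tame_borel_measurable[OF tame_norm[OF tame_damped]] \<beta> by simp
  qed
  moreover have "(\<integral>\<^sup>+s. ennreal ((norm (laplace (Complex \<beta> s) x))\<^sup>2) \<partial>lborel)
      = ennreal (2 * pi * (\<integral>t. (norm (damped \<beta> t x))\<^sup>2 \<partial>lborel))"
    by (rule plancherel[OF tame_damped damped_int laplace_damped]) (use \<beta> in auto)
  moreover have "ennreal ((norm ((c + fourier g (- s)) *\<^sub>C laplace (Complex \<alpha> s) x))\<^sup>2)
      \<le> ennreal (16 * B\<^sup>2) * ennreal ((norm (laplace (Complex \<beta> s) x))\<^sup>2)" for s
  proof -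
    have le: "cmod (c + fourier g (- s)) \<le> B"
      unfolding B_def using norm_triangle_ineq[of c "fourier g (- s)"] cmod_fourier_le[of g "- s"] by linarith
    have "norm ((c + fourier g (- s)) *\<^sub>C laplace (Complex \<alpha> s) x) \<le> B * (4 * norm (laplace (Complex \<beta> s) x))"
    proof (cases "c + fourier g (- s) = 0")
      case False
      then show ?thesis unfolding norm_scaleC \<beta>_def
        using mult[of s] by (intro mult_mono le laplace_compare[OF \<alpha>] B_nonneg) auto
    qed (simp add: scaleC.zero_left B_nonneg)
    then have "(norm ((c + fourier g (- s)) *\<^sub>C laplace (Complex \<alpha> s) x))\<^sup>2 \<le> (B * (4 * norm (laplace (Complex \<beta> s) x)))\<^sup>2"
      by (intro power_mono) auto
    then show ?thesis
      by (simp add: power_mult_distrib ennreal_leI mult_ac flip: ennreal_mult)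
  qed
  then have "(\<integral>\<^sup>+s. ennreal ((norm ((c + fourier g (- s)) *\<^sub>C laplace (Complex \<alpha> s) x))\<^sup>2) \<partial>lborel)
      \<le> (\<integral>\<^sup>+s. ennreal (16 * B\<^sup>2) * ennreal ((norm (laplace (Complex \<beta> s) x))\<^sup>2) \<partial>lborel)"
    by (intro nn_integral_mono)
  moreover have "(\<integral>\<^sup>+s. ennreal (16 * B\<^sup>2) * ennreal ((norm (laplace (Complex \<beta> s) x))\<^sup>2) \<partial>lborel)
      = ennreal (16 * B\<^sup>2) * (\<integral>\<^sup>+s. ennreal ((norm (laplace (Complex \<beta> s) x))\<^sup>2) \<partial>lborel)"
  proof (rule nn_integral_cmult)
    show "(\<lambda>s. ennreal ((norm (laplace (Complex \<beta> s) x))\<^sup>2)) \<in> borel_measurable lborel"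
      using plancherel_measurable[OF tame_damped damped_int laplace_damped] \<beta> by simp
  qed
  ultimately have "ennreal (2 * pi * (\<integral>t. (norm (multiplier c g \<alpha> t x))\<^sup>2 \<partial>lborel))
      \<le> ennreal (16 * B\<^sup>2) * ennreal (2 * pi * (\<integral>t. (norm (damped \<beta> t x))\<^sup>2 \<partial>lborel))"
    by simp
  then have "2 * pi * (\<integral>t. (norm (multiplier c g \<alpha> t x))\<^sup>2 \<partial>lborel)
      \<le> 16 * B\<^sup>2 * (2 * pi * (\<integral>t. (norm (damped \<beta> t x))\<^sup>2 \<partial>lborel))"
    by (subst (asm) ennreal_mult[symmetric]) (auto simp: ennreal_le_iff intro!: mult_nonneg_nonneg)
  then have "(\<integral>t. (norm (multiplier c g \<alpha> t x))\<^sup>2 \<partial>lborel) \<le> 16 * B\<^sup>2 * (\<integral>t. (norm (damped \<beta> t x))\<^sup>2 \<partial>lborel)"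
    by simp
  also have "\<dots> \<le> 16 * B\<^sup>2 * ((M * norm x)\<^sup>2 * (K / 2))"
  proof (rule mult_left_mono)
    have sq: "(norm (damped \<beta> t x))\<^sup>2 \<le> exp_decay (2 * \<beta>) t * (M * norm x)\<^sup>2" for t
    proof -
      have "(norm (damped \<beta> t x))\<^sup>2 \<le> (exp_decay \<beta> t * (M * norm x))\<^sup>2"
        by (intro power_mono norm_damped) auto
      then show ?thesis by (auto simp: power_mult_distrib mult.assoc simp flip: exp_double)
    qed
    have "(\<integral>t. (norm (damped \<beta> t x))\<^sup>2 \<partial>lborel) \<le> (\<integral>t. exp_decay (2 * \<beta>) t * (M * norm x)\<^sup>2 \<partial>lborel)"
    proof (rule integral_mono')
      show "integrable lborel (\<lambda>t. exp_decay (2 * \<beta>) t * (M * norm x)\<^sup>2)"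
        using integral_exp_decay(1)[of "2 * \<beta>"] \<beta> by auto
    qed (use sq in auto)
    also have "\<dots> = (M * norm x)\<^sup>2 * (K / 2)"
      unfolding integral_mult_left_zero using integral_exp_decay(2)[of "2 * \<beta>"] \<beta> by (simp add: \<beta>_def)
    finally show "(\<integral>t. (norm (damped \<beta> t x))\<^sup>2 \<partial>lborel) \<le> (M * norm x)\<^sup>2 * (K / 2)" .
  qed simp
  finally show ?thesis by (simp add: power_mult_distrib mult_ac)
qed

text \<open>
  The semigroup law fails only for the part of \<open>\<phi>\<close> below \<open>-\<sigma>\<close>, where the extension by zero is seen.
\<close>

private lemma multiplier_shift:
  assumes \<alpha>: "0 \<le> \<alpha>" and t: "0 \<le> t" "t \<le> \<sigma>" and \<tau>: "0 \<le> \<tau>"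
  shows "norm (multiplier c g \<alpha> (\<tau> + \<sigma>) x) \<le> M * norm (multiplier c g \<alpha> \<sigma> x) + M * tail g t * norm x"
proof -
  define f1 where "f1 s = damped \<alpha> (\<tau> + \<sigma> + s) x" for s
  define f2 where "f2 s = damped \<alpha> \<tau> (damped \<alpha> (\<sigma> + s) x)" for s
  have tm1: "tame f1" unfolding f1_def by (rule tame_shift[OF tame_damped[OF \<alpha>]])
  have tm: "tame (\<lambda>s. damped \<alpha> (\<sigma> + s) x)" by (rule tame_shift[OF tame_damped[OF \<alpha>]])
  have tm2: "tame f2" unfolding f2_def by (rule tame_linear[OF damped_linear[OF \<alpha>] tm])
  have "damped \<alpha> \<tau> (multiplier c g \<alpha> \<sigma> x) = c *\<^sub>C damped \<alpha> (\<tau> + \<sigma>) x + vint lborel g f2"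
    unfolding multiplier_def f2_def
    using t \<tau> by (simp add: linear_add[OF bounded_linear.linear[OF damped_linear[OF \<alpha>]]]
      bounded_clinear_scaleC[OF damped_clinear[OF \<alpha>]] damped_damped vint_linear[OF sets_lborel g tm damped_clinear[OF \<alpha>]])
  moreover have P: "multiplier c g \<alpha> (\<tau> + \<sigma>) x = c *\<^sub>C damped \<alpha> (\<tau> + \<sigma>) x + vint lborel g f1"
    by (simp only: multiplier_def f1_def[abs_def])
  ultimately have "multiplier c g \<alpha> (\<tau> + \<sigma>) x = damped \<alpha> \<tau> (multiplier c g \<alpha> \<sigma> x) + vint lborel g (\<lambda>s. f1 s - f2 s)"
    unfolding vint_diff[OF sets_lborel g tm1 tm2, symmetric] by (simp add: P)
  then have "norm (multiplier c g \<alpha> (\<tau> + \<sigma>) x) \<le> norm (damped \<alpha> \<tau> (multiplier c g \<alpha> \<sigma> x)) + norm (vint lborel g (\<lambda>s. f1 s - f2 s))"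
    by (simp add: norm_triangle_ineq)
  also have "\<dots> \<le> M * norm (multiplier c g \<alpha> \<sigma> x) + M * tail g t * norm x"
  proof (rule add_mono[OF norm_damped_le[OF \<alpha>]])
    have "norm (vint lborel g (\<lambda>s. f1 s - f2 s)) \<le> (\<integral>s. cmod (g s) * norm (f1 s - f2 s) \<partial>lborel)"
      by (rule norm_vint_le[OF _ g tame_diff[OF tm1 tm2]]) auto
    also have "\<dots> \<le> (\<integral>s. (indicator {..<-t} s * cmod (g s)) * (M * norm x) \<partial>lborel)"
    proof (rule integral_mono)
      show "integrable lborel (\<lambda>s. cmod (g s) * norm (f1 s - f2 s))"
        by (rule integrable_weighted_norm[OF _ g tame_diff[OF tm1 tm2]]) auto
      show "integrable lborel (\<lambda>s. (indicator {..<-t} s * cmod (g s)) * (M * norm x))"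
        using integrable_mult_indicator[of "{..<-t}" lborel "\<lambda>s. cmod (g s)"] g
        by (intro integrable_mult_left) auto
      show "cmod (g s) * norm (f1 s - f2 s) \<le> (indicator {..<-t} s * cmod (g s)) * (M * norm x)" for s
      proof (cases "0 \<le> \<sigma> + s")
        case True
        then have "f1 s = f2 s" using damped_damped[of \<tau> "\<sigma> + s" \<alpha> x] \<tau> by (simp add: f1_def f2_def add.assoc)
        then show ?thesis using M1 by simp
      next
        case False
        then have "f2 s = 0" using \<tau> by (simp add: f2_def damped_neg linear_0[OF bounded_linear.linear[OF damped_linear[OF \<alpha>]]])
        moreover have "norm (f1 s) \<le> M * norm x" unfolding f1_def by (rule norm_damped_le[OF \<alpha>])
        moreover have "s < - t" using False t by simp
        ultimately show ?thesis by (simp add: mult_left_mono)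
      qed
    qed
    also have "\<dots> = M * tail g t * norm x"
      unfolding integral_mult_left_zero tail_def by simp
    finally show "norm (vint lborel g (\<lambda>s. f1 s - f2 s)) \<le> M * tail g t * norm x" .
  qed
  finally show ?thesis .
qed

text \<open>
  Up to the tail and the factor \<open>M\<close>, each value on \<open>[t, 2t]\<close> bounds the value at \<open>2t\<close>; so \<open>t\<close> times the
  square of the latter is bounded by the square integral.
\<close>

private lemma multiplier_decay_damped:
  assumes \<alpha>: "0 < \<alpha>" "\<alpha> * K \<le> 1 / 2" and t: "0 < t"
  shows "norm (multiplier c g \<alpha> (2 * t) x) \<le> (3 * B * M\<^sup>2 * sqrt (K / t) + M * tail g t) * norm x"
proof -
  \<comment> \<open>The part of the norm at \<open>2 t\<close> that the cut-off mass does not explain.\<close>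
  define a where "a = norm (multiplier c g \<alpha> (2 * t) x) - M * tail g t * norm x"
  have "a \<le> 3 * B * M\<^sup>2 * sqrt (K / t) * norm x"
  proof (cases "a \<le> 0")
    case True
    moreover have "0 \<le> 3 * B * M\<^sup>2 * sqrt (K / t) * norm x"
      using K t B_nonneg by (intro mult_nonneg_nonneg) auto
    ultimately show ?thesis by linarith
  next
    case False
    have sq: "a\<^sup>2 \<le> M\<^sup>2 * (norm (multiplier c g \<alpha> \<sigma> x))\<^sup>2" if "\<sigma> \<in> {t..2*t}" for \<sigma>
    proof -
      have "norm (multiplier c g \<alpha> (2 * t) x) \<le> M * norm (multiplier c g \<alpha> \<sigma> x) + M * tail g t * norm x"
        using multiplier_shift[of \<alpha> t \<sigma> "2 * t - \<sigma>" x] that \<alpha> t by simp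
      then have "a \<le> M * norm (multiplier c g \<alpha> \<sigma> x)" by (simp add: a_def)
      then show ?thesis using False power_mono[of a "M * norm (multiplier c g \<alpha> \<sigma> x)" 2]
        by (simp add: power_mult_distrib)
    qed
    have "t * a\<^sup>2 = (\<integral>\<sigma>. indicator {t..2*t} \<sigma> * a\<^sup>2 \<partial>lborel)" using t by simp
    also have "\<dots> \<le> (\<integral>\<sigma>. M\<^sup>2 * (norm (multiplier c g \<alpha> \<sigma> x))\<^sup>2 \<partial>lborel)"
    proof (rule integral_mono')
      show "integrable lborel (\<lambda>\<sigma>. M\<^sup>2 * (norm (multiplier c g \<alpha> \<sigma> x))\<^sup>2)"
        using integrable_norm_square[OF tame_multiplier multiplier_norm_integrable fourier_multiplier] \<alpha> by auto
      show "indicator {t..2*t} \<sigma> * a\<^sup>2 \<le> M\<^sup>2 * (norm (multiplier c g \<alpha> \<sigma> x))\<^sup>2" for \<sigma>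
        using sq[of \<sigma>] by (auto simp: indicator_def)
    qed simp
    also have "\<dots> \<le> M\<^sup>2 * (8 * B\<^sup>2 * M\<^sup>2 * K * (norm x)\<^sup>2)"
      using multiplier_L2[OF \<alpha>] by (simp add: mult_left_mono)
    also have "\<dots> \<le> M\<^sup>2 * (9 * B\<^sup>2 * M\<^sup>2 * K * (norm x)\<^sup>2)"
      using K by (intro mult_left_mono mult_right_mono) auto
    finally have "a\<^sup>2 \<le> M\<^sup>2 * (9 * B\<^sup>2 * M\<^sup>2 * K * (norm x)\<^sup>2) / t"
      using t by (simp add: field_simps)
    also have "\<dots> = (3 * B * M\<^sup>2 * sqrt (K / t) * norm x)\<^sup>2"
      using K t by (simp add: power_mult_distrib power2_eq_square[of "M\<^sup>2"] power2_eq_square[of M])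
    finally show ?thesis
      by (rule power2_le_imp_le) (use K t B_nonneg in \<open>auto intro!: mult_nonneg_nonneg\<close>)
  qed
  then show ?thesis by (simp add: a_def algebra_simps)
qed

text \<open>
  Remove the damping by letting \<open>\<alpha> \<rightarrow> 0\<close> in the inner products with a test vector; the estimate does
  not depend on \<open>\<alpha>\<close>.
\<close>

theorem multiplier_decay:
  assumes t: "0 < t"
  shows "norm (multiplier c g 0 (2 * t) x)
    \<le> (3 * (cmod c + (\<integral>t. cmod (g t) \<partial>lborel)) * M\<^sup>2 * sqrt (K / t) + M * tail g t) * norm x" (is "_ \<le> ?R")
proof (rule norm_le_of_cinner)
  fix y
  define \<alpha> where "\<alpha> n = 1 / (2 * K * real (Suc n))" for n
  have \<alpha>: "0 < \<alpha> n" "\<alpha> n * K \<le> 1 / 2" for n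
  proof -
    show "0 < \<alpha> n" using K by (simp add: \<alpha>_def)
    have "\<alpha> n * K = 1 / (2 * real (Suc n))" using K by (simp add: \<alpha>_def del: of_nat_Suc)
    also have "\<dots> \<le> 1 / 2" by (simp add: field_simps)
    finally show "\<alpha> n * K \<le> 1 / 2" .
  qed
  have lim0: "\<alpha> \<longlonglongrightarrow> 0"
  proof -
    have "(\<lambda>n. 1 / (2 * K) / real (Suc n)) \<longlonglongrightarrow> 0"
      by (intro LIMSEQ_Suc lim_const_over_n)
    then show ?thesis by (simp add: \<alpha>_def[abs_def])
  qed
  have damped_lim: "(\<lambda>n. cinner (damped (\<alpha> n) s x) y) \<longlonglongrightarrow> cinner (damped 0 s x) y" for s
  proof -
    have "(\<lambda>n. exp (- (\<alpha> n * s)) *\<^sub>R T s x) \<longlonglongrightarrow> exp (- (0 * s)) *\<^sub>R T s x"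
      by (intro tendsto_intros lim0)
    then have "(\<lambda>n. damped (\<alpha> n) s x) \<longlonglongrightarrow> damped 0 s x" by (simp add: damped_def)
    then show ?thesis by (intro cinner.tendsto tendsto_const)
  qed
  have "(\<lambda>n. cinner (multiplier c g (\<alpha> n) (2 * t) x) y) \<longlonglongrightarrow> cinner (multiplier c g 0 (2 * t) x) y"
  proof -
    have "(\<lambda>n. \<integral>s. g s * cinner (damped (\<alpha> n) (2 * t + s) x) y \<partial>lborel) \<longlonglongrightarrow> (\<integral>s. g s * cinner (damped 0 (2 * t + s) x) y \<partial>lborel)"
    proof (rule integral_dominated_convergence[where w="\<lambda>s. cmod (g s) * (M * norm x * norm y)"])
      show "integrable lborel (\<lambda>s. cmod (g s) * (M * norm x * norm y))" using g by auto
      show "AE s in lborel. norm (g s * cinner (damped (\<alpha> n) (2 * t + s) x) y) \<le> cmod (g s) * (M * norm x * norm y)" for n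
      proof (rule AE_I2)
        fix s
        have "cmod (cinner (damped (\<alpha> n) (2 * t + s) x) y) \<le> M * norm x * norm y"
          using cinner_cauchy_schwarz[of "damped (\<alpha> n) (2 * t + s) x" y]
            mult_right_mono[OF norm_damped_le[of "\<alpha> n" "2 * t + s" x], of "norm y"] \<alpha>(1)[of n] by simp
        then show "norm (g s * cinner (damped (\<alpha> n) (2 * t + s) x) y) \<le> cmod (g s) * (M * norm x * norm y)"
          by (simp add: norm_mult mult_left_mono)
      qed
      show "(\<lambda>s. g s * cinner (damped (\<alpha> n) (2 * t + s) x) y) \<in> borel_measurable lborel" for n
        using integrable_weighted_cinner[OF _ g tame_shift[OF tame_damped]] \<alpha>(1)[of n] by (auto simp: less_imp_le)
      show "(\<lambda>s. g s * cinner (damped 0 (2 * t + s) x) y) \<in> borel_measurable lborel"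
        using integrable_weighted_cinner[OF _ g tame_shift[OF tame_damped]] by auto
      show "AE s in lborel. (\<lambda>n. g s * cinner (damped (\<alpha> n) (2 * t + s) x) y) \<longlonglongrightarrow> g s * cinner (damped 0 (2 * t + s) x) y"
        by (intro AE_I2 tendsto_intros damped_lim)
    qed
    then show ?thesis
      using \<alpha>(1) by (simp add: cinner_multiplier less_imp_le) (intro tendsto_intros damped_lim)
  qed
  then have "(\<lambda>n. cmod (cinner (multiplier c g (\<alpha> n) (2 * t) x) y)) \<longlonglongrightarrow> cmod (cinner (multiplier c g 0 (2 * t) x) y)"
    by (rule tendsto_norm)
  moreover have "cmod (cinner (multiplier c g (\<alpha> n) (2 * t) x) y) \<le> ?R * norm y" for n
    using cinner_cauchy_schwarz[of "multiplier c g (\<alpha> n) (2 * t) x" y]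
      mult_right_mono[OF multiplier_decay_damped[OF \<alpha>[of n] t, of x], of "norm y"] by (simp add: B_def)
  ultimately show "cmod (cinner (multiplier c g 0 (2 * t) x) y) \<le> ?R * norm y"
    by (intro LIMSEQ_le_const2) auto
next
  have "0 \<le> norm (multiplier c g (1 / (2 * K)) (2 * t) x)" by simp
  also have "\<dots> \<le> ?R"
    using multiplier_decay_damped[of "1 / (2 * K)" t x] K t by (simp add: B_def)
  finally show "0 \<le> ?R" .
qed

end

end

end

section \<open>A summability kernel\<close>

lemma integrable_one_over_one_plus_square: "integrable lborel (\<lambda>s::real. 1 / (1 + s\<^sup>2))"
  using integrable_inverse_1_plus_square
  by (simp add: set_integrable_def inverse_eq_divide einterval_def)

lemma one_minus_cos_le: "1 - cos x \<le> x\<^sup>2 / 2" for x :: real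
proof -
  have "1 - cos x = 2 * (sin (x / 2))\<^sup>2"
    using cos_double_sin[of "x / 2"] by simp
  also have "\<dots> \<le> 2 * (x / 2)\<^sup>2"
    by (intro mult_left_mono, subst abs_le_square_iff[symmetric], rule abs_sin_x_le_abs_x) simp
  finally show ?thesis by (simp add: power_divide)
qed

text \<open>
  The Fejer kernel up to normalization. Its total mass enters as a normalizing constant, through
  the scaling law below.
\<close>

definition fejer :: "real \<Rightarrow> real" where
  "fejer s = (1 - cos s) / s\<^sup>2"

lemma fejer_nonneg: "0 \<le> fejer s"
  by (simp add: fejer_def)

lemma fejer_measurable [measurable]: "fejer \<in> borel_measurable borel"
  unfolding fejer_def[abs_def] by measurable

lemma fejer_integrable: "integrable lborel fejer"
proof (rule Bochner_Integration.integrable_bound)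
  show "integrable lborel (\<lambda>s::real. 4 * (1 / (1 + s\<^sup>2)))"
    using integrable_one_over_one_plus_square by (rule integrable_mult_right)
  show "AE s in lborel. norm (fejer s) \<le> norm (4 * (1 / (1 + s\<^sup>2)))"
  proof (rule AE_I2)
    fix s :: real
    have "fejer s \<le> 4 / (1 + s\<^sup>2)"
    proof (cases "s = 0")
      case False
      have "(1 - cos s) * (1 + s\<^sup>2) \<le> s\<^sup>2 / 2 + 2 * s\<^sup>2"
      proof -
        have "(1 - cos s) * s\<^sup>2 \<le> 2 * s\<^sup>2" by (intro mult_right_mono) auto
        then show ?thesis using one_minus_cos_le[of s] by (simp add: algebra_simps)
      qed
      also have "\<dots> \<le> 4 * s\<^sup>2" by simp
      finally have "(1 - cos s) * (1 + s\<^sup>2) \<le> 4 * s\<^sup>2" .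
      moreover have "1 + s\<^sup>2 > 0" by (simp add: add_pos_nonneg)
      ultimately show ?thesis using False by (simp add: fejer_def field_simps)
    qed (simp add: fejer_def)
    then show "norm (fejer s) \<le> norm (4 * (1 / (1 + s\<^sup>2)))"
      using fejer_nonneg[of s] by simp
  qed
qed simp

definition fejer_mass :: real where
  "fejer_mass = (\<integral>s. fejer s \<partial>lborel)"

lemma fejer_mass_pos: "0 < fejer_mass"
proof -
  have "0 < (1 - cos 1) / (4::real)"
    using cos_monotone_0_pi[of 0 1] pi_gt3 by simp
  also have "\<dots> = (\<integral>s. indicator {1..2::real} s * ((1 - cos 1) / (4::real)) \<partial>lborel)" by simp
  also have "\<dots> \<le> fejer_mass"
    unfolding fejer_mass_def
  proof (rule integral_mono'[OF fejer_integrable])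
    fix s :: real
    show "indicator {1..2::real} s * ((1 - cos 1) / 4) \<le> fejer s"
    proof (cases "s \<in> {1..2}")
      case True
      have "cos s \<le> cos 1" using True pi_gt3 by (intro cos_monotone_0_pi_le) auto
      moreover have "s\<^sup>2 \<le> 2\<^sup>2" using True by (intro power_mono) auto
      moreover have "cos (1::real) \<le> 1" by simp
      ultimately have "(1 - cos 1) / 4 \<le> (1 - cos s) / s\<^sup>2"
        using True by (intro frac_le) auto
      then show ?thesis using True by (simp add: fejer_def)
    qed (simp add: fejer_nonneg)
  qed (simp add: fejer_nonneg)
  finally show ?thesis .
qed

text \<open>
  The integral is a multiple of \<open>|a|\<close> by scaling alone; differences of such functions of \<open>a\<close> are the
  piecewise linear Fourier transforms wanted below.
\<close>

lemma fejer_scaled: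
  "integrable lborel (\<lambda>s. (1 - cos (a * s)) / s\<^sup>2)"
  "(\<integral>s. (1 - cos (a * s)) / s\<^sup>2 \<partial>lborel) = \<bar>a\<bar> * fejer_mass"
proof -
  have *: "integrable lborel (\<lambda>s. (1 - cos (a * s)) / s\<^sup>2) \<and>
      (\<integral>s. (1 - cos (a * s)) / s\<^sup>2 \<partial>lborel) = \<bar>a\<bar> * fejer_mass"
  proof (cases "a = 0")
    case False
    have eq: "(\<lambda>s. (1 - cos (a * s)) / s\<^sup>2) = (\<lambda>s. a\<^sup>2 * fejer (0 + a * s))"
      using False by (auto simp: fejer_def power_mult_distrib)
    have "\<bar>a\<bar> * (\<integral>s. fejer (0 + a * s) \<partial>lborel) = fejer_mass"
      unfolding fejer_mass_def using lborel_integral_real_affine[of a fejer 0] False by simp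
    then have "\<bar>a\<bar> * (\<bar>a\<bar> * (\<integral>s. fejer (0 + a * s) \<partial>lborel)) = \<bar>a\<bar> * fejer_mass" by simp
    then have "(\<integral>s. a\<^sup>2 * fejer (0 + a * s) \<partial>lborel) = \<bar>a\<bar> * fejer_mass"
      by (simp add: power2_eq_square mult.assoc[symmetric])
    moreover have "integrable lborel (\<lambda>s. a\<^sup>2 * fejer (0 + a * s))"
      using lborel_integrable_real_affine[OF fejer_integrable False, of 0] by (rule integrable_mult_right)
    ultimately show ?thesis unfolding eq by blast
  qed simp
  then show "integrable lborel (\<lambda>s. (1 - cos (a * s)) / s\<^sup>2)"
    "(\<integral>s. (1 - cos (a * s)) / s\<^sup>2 \<partial>lborel) = \<bar>a\<bar> * fejer_mass" by auto
qed

lemma abs_sinc_le: "\<bar>sinc x\<bar> \<le> 1" "x \<noteq> 0 \<Longrightarrow> \<bar>sinc x\<bar> \<le> 1 / \<bar>x\<bar>"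
  using abs_sin_x_le_abs_x[of x] abs_sin_le_one[of x] by (auto simp: divide_le_eq divide_right_mono)

text \<open>
  The derivative of \<open>sinc\<close> away from 0; at 0 it has the value 0 by the convention for division, which
  does no harm to integrals.
\<close>

definition sinc' :: "real \<Rightarrow> real" where
  "sinc' x = (x * cos x - sin x) / x\<^sup>2"

lemma DERIV_sinc:
  assumes "x \<noteq> 0" shows "(sinc has_field_derivative sinc' x) (at x)"
proof -
  have "((\<lambda>x. sin x / x) has_field_derivative sinc' x) (at x)"
    using assms unfolding sinc'_def
    by (auto intro!: derivative_eq_intros simp: power2_eq_square mult.commute)
  moreover have "\<forall>\<^sub>F y in nhds x. sin y / y = sinc y"
    using t1_space_nhds[OF assms] by (auto elim!: eventually_mono)
  ultimately show ?thesis
    using assms by (subst (asm) DERIV_cong_ev[OF refl _ refl]) auto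
qed

lemma abs_sinc'_le: "\<bar>sinc' x\<bar> \<le> 2" "x \<noteq> 0 \<Longrightarrow> \<bar>sinc' x\<bar> \<le> 2 / \<bar>x\<bar>"
proof -
  have ge: "\<bar>sinc' x\<bar> \<le> 2 / \<bar>x\<bar>" if "1 \<le> \<bar>x\<bar>"
  proof -
    have "\<bar>x * cos x - sin x\<bar> \<le> \<bar>x\<bar> * \<bar>cos x\<bar> + \<bar>sin x\<bar>"
      by (metis abs_mult abs_triangle_ineq4)
    also have "\<dots> \<le> \<bar>x\<bar> * 1 + 1" by (intro add_mono mult_left_mono) auto
    also have "\<dots> \<le> 2 * \<bar>x\<bar>" using that by simp
    finally have "\<bar>sinc' x\<bar> \<le> (2 * \<bar>x\<bar>) / x\<^sup>2"
      unfolding sinc'_def abs_divide by (auto intro: divide_right_mono)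
    also have "x\<^sup>2 = \<bar>x\<bar> * \<bar>x\<bar>" by (simp add: power2_eq_square)
    also have "(2 * \<bar>x\<bar>) / (\<bar>x\<bar> * \<bar>x\<bar>) = 2 / \<bar>x\<bar>"
      by (rule nonzero_mult_divide_mult_cancel_right) (use that in auto)
    finally show ?thesis .
  qed
  have pos: "\<bar>y * cos y - sin y\<bar> \<le> y * y\<^sup>2" if y: "0 < y" for y :: real
  proof -
    have "\<exists>z>0. z < y \<and> (y * cos y - sin y) - (0 * cos 0 - sin 0) = (y - 0) * (- z * sin z)"
      by (rule MVT2) (use y in \<open>auto intro!: derivative_eq_intros\<close>)
    then obtain z where z: "0 < z" "z < y" "y * cos y - sin y = y * (- z * sin z)" by auto
    have "\<bar>z * sin z\<bar> \<le> y * y"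
      unfolding abs_mult using z abs_sin_x_le_abs_x[of z] by (intro mult_mono) auto
    then show ?thesis unfolding z(3) using y by (simp add: abs_mult power2_eq_square)
  qed
  have le: "\<bar>sinc' x\<bar> \<le> \<bar>x\<bar>" if "x \<noteq> 0"
  proof -
    have "\<bar>x * cos x - sin x\<bar> \<le> \<bar>x\<bar> * x\<^sup>2"
      using pos[of x] pos[of "- x"] that by (cases "x > 0") (auto simp: abs_minus_commute)
    then show ?thesis using that by (simp add: sinc'_def abs_divide divide_le_eq)
  qed
  show "\<bar>sinc' x\<bar> \<le> 2"
  proof (cases "1 \<le> \<bar>x\<bar>")
    case True
    then have "2 / \<bar>x\<bar> \<le> 2" by (simp add: divide_le_eq)
    then show ?thesis using ge[OF True] by linarith
  next
    case False
    then show ?thesis using le by (cases "x = 0") (auto simp: sinc'_def)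
  qed
  show "\<bar>sinc' x\<bar> \<le> 2 / \<bar>x\<bar>" if "x \<noteq> 0"
  proof (cases "1 \<le> \<bar>x\<bar>")
    case False
    then have "\<bar>x\<bar> \<le> 2 / \<bar>x\<bar>" using that mult_mono[of "\<bar>x\<bar>" 1 "\<bar>x\<bar>" 1] by (simp add: le_divide_eq)
    then show ?thesis using le[OF that] by linarith
  qed (rule ge)
qed

text \<open>
  The de la Vallee Poussin kernel: the difference \<open>cos s - cos 2s\<close> over a multiple of \<open>s\<^sup>2\<close>, written as a
  product of two \<open>sinc\<close> functions to make it continuous at 0. Its Fourier transform is a trapezoid.
\<close>

definition vp_kernel :: "real \<Rightarrow> real" where
  "vp_kernel s = 3 / (2 * fejer_mass) * (sinc (3 * s / 2) * sinc (s / 2))"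

definition vp_kernel' :: "real \<Rightarrow> real" where
  "vp_kernel' s = 3 / (2 * fejer_mass) *
    (3 / 2 * (sinc' (3 * s / 2) * sinc (s / 2)) + 1 / 2 * (sinc (3 * s / 2) * sinc' (s / 2)))"

definition vp_const :: real where "vp_const = 16 / fejer_mass"

lemma vp_const_pos: "0 < vp_const"
  using fejer_mass_pos by (simp add: vp_const_def)

lemma vp_kernel_continuous: "continuous_on S vp_kernel"
  unfolding vp_kernel_def by (intro continuous_intros) auto

lemma vp_kernel_measurable [measurable]: "vp_kernel \<in> borel_measurable borel"
  by (rule borel_measurable_continuous_onI[OF vp_kernel_continuous])

lemma vp_kernel_eq:
  assumes "s \<noteq> 0"
  shows "vp_kernel s = (cos s - cos (2 * s)) / (fejer_mass * s\<^sup>2)"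
proof -
  have "cos s - cos (2 * s) = 2 * sin (3 * s / 2) * sin (s / 2)"
    using cos_diff_cos[of s "2 * s"] by (simp add: field_simps)
  then show ?thesis
    using assms fejer_mass_pos by (simp add: vp_kernel_def field_simps power2_eq_square)
qed

lemma DERIV_vp_kernel:
  assumes "s \<noteq> 0" shows "(vp_kernel has_field_derivative vp_kernel' s) (at s)"
proof -
  have 1: "((\<lambda>s. sinc (3 * s / 2)) has_field_derivative sinc' (3 * s / 2) * (3 / 2)) (at s)"
    by (rule DERIV_chain2[OF DERIV_sinc]) (use assms in \<open>auto intro!: derivative_eq_intros\<close>)
  have 2: "((\<lambda>s. sinc (s / 2)) has_field_derivative sinc' (s / 2) * (1 / 2)) (at s)"
    by (rule DERIV_chain2[OF DERIV_sinc]) (use assms in \<open>auto intro!: derivative_eq_intros\<close>)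
  show ?thesis unfolding vp_kernel_def vp_kernel'_def
    by (rule DERIV_cong[OF DERIV_cmult[OF DERIV_mult'[OF 1 2]]]) (simp add: algebra_simps)
qed

text \<open>
  Bounds by a constant near 0 and by an inverse square far away combine to an integrable bound.
\<close>

lemma one_over_le:
  fixes s b c :: real
  assumes "b \<le> c" "s \<noteq> 0 \<Longrightarrow> b \<le> c / s\<^sup>2" "0 \<le> c"
  shows "b \<le> 2 * c / (1 + s\<^sup>2)"
proof (cases "\<bar>s\<bar> \<le> 1")
  case True
  then have "s\<^sup>2 \<le> 1" by (simp add: abs_square_le_1)
  then have "c \<le> 2 * c / (1 + s\<^sup>2)"
    using assms(3) mult_left_mono[of "1 + s\<^sup>2" 2 c] by (simp add: le_divide_eq add_pos_nonneg)
  then show ?thesis using assms(1) by linarith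
next
  case False
  then have s: "s \<noteq> 0" "1 \<le> s\<^sup>2" by (auto simp: one_le_power abs_square_le_1 not_le less_imp_le power2_ge_1_iff)
  have "c / s\<^sup>2 \<le> 2 * c / (1 + s\<^sup>2)"
    using s assms(3) mult_left_mono[of 1 "s\<^sup>2" c] by (simp add: divide_simps add_pos_nonneg algebra_simps)
  then show ?thesis using assms(2)[OF s(1)] by linarith
qed

lemma abs_vp_kernel_le: "\<bar>vp_kernel s\<bar> \<le> vp_const / (1 + s\<^sup>2)"
proof -
  let ?f = fejer_mass
  have m: "0 < ?f" by (rule fejer_mass_pos)
  have ps: "\<bar>vp_kernel s\<bar> = 3 / (2 * ?f) * (\<bar>sinc (3 * s / 2)\<bar> * \<bar>sinc (s / 2)\<bar>)"
    unfolding vp_kernel_def abs_mult using m by simp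
  have "\<bar>vp_kernel s\<bar> \<le> 2 * (8 / ?f) / (1 + s\<^sup>2)"
  proof (rule one_over_le)
    have "\<bar>vp_kernel s\<bar> \<le> 3 / (2 * ?f) * (1 * 1)"
      unfolding ps using m by (intro mult_left_mono mult_mono abs_sinc_le) auto
    also have "\<dots> \<le> 8 / ?f" using m by (simp add: divide_simps)
    finally show "\<bar>vp_kernel s\<bar> \<le> 8 / ?f" .
    show "\<bar>vp_kernel s\<bar> \<le> 8 / ?f / s\<^sup>2" if s: "s \<noteq> 0"
    proof -
      have "\<bar>vp_kernel s\<bar> \<le> 3 / (2 * ?f) * ((1 / \<bar>3 * s / 2\<bar>) * (1 / \<bar>s / 2\<bar>))"
        unfolding ps using m s by (intro mult_left_mono mult_mono abs_sinc_le) auto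
      also have "\<dots> = 2 / ?f / s\<^sup>2" using m s by (simp add: abs_mult divide_simps power2_eq_square)
      also have "\<dots> \<le> 8 / ?f / s\<^sup>2" using m by (intro divide_right_mono) auto
      finally show ?thesis .
    qed
  qed (use m in simp)
  then show ?thesis by (simp add: vp_const_def)
qed

lemma abs_vp_kernel'_le: "\<bar>vp_kernel' s\<bar> \<le> vp_const / (1 + s\<^sup>2)"
proof -
  let ?f = fejer_mass
  have m: "0 < ?f" by (rule fejer_mass_pos)
  let ?b = "3 / 2 * (\<bar>sinc' (3 * s / 2)\<bar> * \<bar>sinc (s / 2)\<bar>) + 1 / 2 * (\<bar>sinc (3 * s / 2)\<bar> * \<bar>sinc' (s / 2)\<bar>)"
  have ps: "\<bar>vp_kernel' s\<bar> \<le> 3 / (2 * ?f) * ?b"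
  proof -
    have "\<bar>3 / 2 * (sinc' (3 * s / 2) * sinc (s / 2)) + 1 / 2 * (sinc (3 * s / 2) * sinc' (s / 2))\<bar> \<le> ?b"
      by (rule order_trans[OF abs_triangle_ineq]) (simp add: abs_mult)
    then show ?thesis unfolding vp_kernel'_def abs_mult[of "3 / (2 * ?f)"] using m
      by (intro mult_mono) auto
  qed
  have "\<bar>vp_kernel' s\<bar> \<le> 2 * (8 / ?f) / (1 + s\<^sup>2)"
  proof (rule one_over_le)
    have "3 / (2 * ?f) * ?b \<le> 3 / (2 * ?f) * (3 / 2 * (2 * 1) + 1 / 2 * (1 * 2))"
      using m by (intro mult_left_mono mult_mono add_mono abs_sinc_le abs_sinc'_le) auto
    also have "\<dots> \<le> 8 / ?f" using m by (simp add: divide_simps)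
    finally show "\<bar>vp_kernel' s\<bar> \<le> 8 / ?f" using ps by linarith
    show "\<bar>vp_kernel' s\<bar> \<le> 8 / ?f / s\<^sup>2" if s: "s \<noteq> 0"
    proof -
      have "3 / (2 * ?f) * ?b \<le> 3 / (2 * ?f) * (3 / 2 * ((2 / \<bar>3 * s / 2\<bar>) * (1 / \<bar>s / 2\<bar>))
          + 1 / 2 * ((1 / \<bar>3 * s / 2\<bar>) * (2 / \<bar>s / 2\<bar>)))"
        using m s by (intro mult_left_mono mult_mono add_mono abs_sinc_le abs_sinc'_le) auto
      also have "\<dots> = 8 / ?f / s\<^sup>2" using m s by (simp add: abs_mult divide_simps power2_eq_square)
      finally show ?thesis using ps by linarith
    qed
  qed (use m in simp)
  then show ?thesis by (simp add: vp_const_def)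
qed

lemma vp_kernel_integrable: "integrable lborel vp_kernel"
proof (rule Bochner_Integration.integrable_bound)
  show "integrable lborel (\<lambda>s. vp_const * (1 / (1 + s\<^sup>2)))"
    using integrable_one_over_one_plus_square by (rule integrable_mult_right)
  show "AE s in lborel. norm (vp_kernel s) \<le> norm (vp_const * (1 / (1 + s\<^sup>2)))"
    using abs_vp_kernel_le vp_const_pos by (intro AE_I2) (simp add: abs_mult add_nonneg_nonneg)
qed simp

lemma vp_kernel_minus: "vp_kernel (- s) = vp_kernel s"
  by (simp add: vp_kernel_def)

text \<open>
  The product formula writes the integrand through \<open>(1 - cos (a s)) / s\<^sup>2\<close> with \<open>a\<close> equal to \<open>2 \<plusminus> \<xi>\<close> and
  \<open>1 \<plusminus> \<xi>\<close>, and \<open>|2 + \<xi>| + |2 - \<xi>| - |1 + \<xi>| - |1 - \<xi>| = 2\<close> for \<open>|\<xi>| \<le> 1\<close>.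
\<close>

lemma integral_vp_kernel_cos:
  assumes "\<bar>\<xi>\<bar> \<le> 1" shows "(\<integral>s. cos (\<xi> * s) * vp_kernel s \<partial>lborel) = 1"
proof -
  have m: "0 < fejer_mass" by (rule fejer_mass_pos)
  let ?J = "\<lambda>a s. (1 - cos (a * s)) / s\<^sup>2"
  have AE: "AE s in lborel. cos (\<xi> * s) * vp_kernel s
      = 1 / (2 * fejer_mass) * (?J (2 + \<xi>) s + ?J (2 - \<xi>) s - ?J (1 + \<xi>) s - ?J (1 - \<xi>) s)"
  proof -
    have "AE s in lborel. s \<notin> {0::real}"
      by (intro AE_not_in finite_imp_null_set_lborel) auto
    then show ?thesis
    proof eventually_elim
      case (elim s)
      \<comment> \<open>Product formula for cosines; the constants 1 are added in pairs of opposite sign.\<close>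
      have "2 * (cos (\<xi> * s) * (cos s - cos (2 * s)))
        = cos ((1 + \<xi>) * s) + cos ((1 - \<xi>) * s) - cos ((2 + \<xi>) * s) - cos ((2 - \<xi>) * s)"
        by (simp add: algebra_simps cos_add cos_diff)
      moreover have "cos (\<xi> * s) * vp_kernel s = 2 * (cos (\<xi> * s) * (cos s - cos (2 * s))) / (2 * fejer_mass * s\<^sup>2)"
        using elim m by (simp add: vp_kernel_eq)
      ultimately have "cos (\<xi> * s) * vp_kernel s = (cos ((1 + \<xi>) * s) + cos ((1 - \<xi>) * s) - cos ((2 + \<xi>) * s) - cos ((2 - \<xi>) * s)) / (2 * fejer_mass * s\<^sup>2)"
        by simp
      also have "\<dots> = 1 / (2 * fejer_mass) * (?J (2 + \<xi>) s + ?J (2 - \<xi>) s - ?J (1 + \<xi>) s - ?J (1 - \<xi>) s)"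
        using m by (simp add: add_divide_distrib diff_divide_distrib algebra_simps)
      finally show ?case .
    qed
  qed
  have "(\<integral>s. cos (\<xi> * s) * vp_kernel s \<partial>lborel)
     = (\<integral>s. 1 / (2 * fejer_mass) * (?J (2 + \<xi>) s + ?J (2 - \<xi>) s - ?J (1 + \<xi>) s - ?J (1 - \<xi>) s) \<partial>lborel)"
    by (rule integral_cong_AE[OF _ _ AE]) measurable
  also have "\<dots> = 1 / (2 * fejer_mass) * (\<integral>s. ?J (2 + \<xi>) s + ?J (2 - \<xi>) s - ?J (1 + \<xi>) s - ?J (1 - \<xi>) s \<partial>lborel)"
    by (rule integral_mult_right_zero)
  also have "(\<integral>s. ?J (2 + \<xi>) s + ?J (2 - \<xi>) s - ?J (1 + \<xi>) s - ?J (1 - \<xi>) s \<partial>lborel)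
     = (\<integral>s. ?J (2 + \<xi>) s \<partial>lborel) + (\<integral>s. ?J (2 - \<xi>) s \<partial>lborel) - (\<integral>s. ?J (1 + \<xi>) s \<partial>lborel) - (\<integral>s. ?J (1 - \<xi>) s \<partial>lborel)"
    by (simp only: Bochner_Integration.integral_diff Bochner_Integration.integral_add fejer_scaled(1)
      Bochner_Integration.integrable_add Bochner_Integration.integrable_diff)
  also have "\<dots> = (\<bar>2 + \<xi>\<bar> + \<bar>2 - \<xi>\<bar> - \<bar>1 + \<xi>\<bar> - \<bar>1 - \<xi>\<bar>) * fejer_mass"
    unfolding fejer_scaled(2) by (simp add: algebra_simps)
  also have "\<dots> = 2 * fejer_mass" using assms by (simp add: abs_if split: if_splits)
  finally show ?thesis using m by simp
qed

lemma integral_vp_kernel_sin: "(\<integral>s. sin (\<xi> * s) * vp_kernel s \<partial>lborel) = 0"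
  using lborel_integral_real_affine[of "-1" "\<lambda>s. sin (\<xi> * s) * vp_kernel s" 0] by (simp add: vp_kernel_minus)

definition dilated_kernel :: "real \<Rightarrow> real \<Rightarrow> complex" where
  "dilated_kernel r s = complex_of_real (r * vp_kernel (r * s))"

lemma dilated_kernel_integrable:
  assumes "r > 0" shows "integrable lborel (dilated_kernel r)"
  unfolding dilated_kernel_def complex_of_real_integrable_eq
  using lborel_integrable_real_affine[OF vp_kernel_integrable, of r 0] assms by simp

lemma dilated_kernel_mass:
  assumes "r > 0" shows "(\<integral>s. cmod (dilated_kernel r s) \<partial>lborel) = (\<integral>s. \<bar>vp_kernel s\<bar> \<partial>lborel)"
  using assms lborel_integral_real_affine[of r "\<lambda>s. \<bar>vp_kernel s\<bar>" 0] by (simp add: dilated_kernel_def abs_mult norm_mult)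

lemma fourier_dilated_kernel:
  assumes r: "r > 0" and \<xi>: "\<bar>\<xi>\<bar> \<le> r"
  shows "fourier (dilated_kernel r) \<xi> = 1"
proof -
  define \<zeta> where "\<zeta> = \<xi> / r"
  have \<zeta>: "\<bar>\<zeta>\<bar> \<le> 1" using r \<xi> by (simp add: \<zeta>_def)
  have "fourier (dilated_kernel r) \<xi> = r *\<^sub>R (\<integral>s. wave \<zeta> (0 + r * s) * complex_of_real (vp_kernel (0 + r * s)) \<partial>lborel)"
    unfolding fourier_def dilated_kernel_def integral_scaleR_right[symmetric]
    by (intro Bochner_Integration.integral_cong)
       (use r in \<open>auto simp: \<zeta>_def scaleR_conv_of_real mult.assoc\<close>)
  also have "\<dots> = (\<integral>s. wave \<zeta> s * complex_of_real (vp_kernel s) \<partial>lborel)"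
    using lborel_integral_real_affine[of r "\<lambda>s. wave \<zeta> s * complex_of_real (vp_kernel s)" 0] r by simp
  also have "\<dots> = (\<integral>s. complex_of_real (cos (\<zeta> * s) * vp_kernel s) - \<i> * complex_of_real (sin (\<zeta> * s) * vp_kernel s) \<partial>lborel)"
    by (intro Bochner_Integration.integral_cong)
       (auto simp: complex_eq_iff exp_eq_polar cis.ctr Re_exp Im_exp)
  also have "\<dots> = (\<integral>s. complex_of_real (cos (\<zeta> * s) * vp_kernel s) \<partial>lborel) - (\<integral>s. \<i> * complex_of_real (sin (\<zeta> * s) * vp_kernel s) \<partial>lborel)"
  proof (rule Bochner_Integration.integral_diff)
    have "integrable lborel (\<lambda>s. cos (\<zeta> * s) * vp_kernel s)"
      by (rule Bochner_Integration.integrable_bound[OF vp_kernel_integrable]) (auto simp: abs_mult intro!: mult_left_le_one_le)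
    then show "integrable lborel (\<lambda>s. complex_of_real (cos (\<zeta> * s) * vp_kernel s))"
      unfolding complex_of_real_integrable_eq .
    have "integrable lborel (\<lambda>s. sin (\<zeta> * s) * vp_kernel s)"
      by (rule Bochner_Integration.integrable_bound[OF vp_kernel_integrable]) (auto simp: abs_mult intro!: mult_left_le_one_le)
    then show "integrable lborel (\<lambda>s. \<i> * complex_of_real (sin (\<zeta> * s) * vp_kernel s))"
      unfolding complex_of_real_integrable_eq[symmetric] by (rule integrable_mult_right)
  qed
  also have "\<dots> = 1"
    unfolding integral_mult_right_zero integral_complex_of_real integral_vp_kernel_cos[OF \<zeta>] integral_vp_kernel_sin by simp
  finally show ?thesis .
qed

lemma tail_tendsto:
  assumes g: "integrable lborel g" shows "(tail g \<longlongrightarrow> 0) at_top"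
proof -
  have "((\<lambda>t. \<integral>s. indicator {..<-t} s * cmod (g s) \<partial>lborel) \<longlongrightarrow> (\<integral>s. 0 \<partial>(lborel::real measure))) at_top"
  proof (rule integral_dominated_convergence_at_top[where w="\<lambda>s. cmod (g s)"])
    show "\<forall>\<^sub>F t in at_top. AE s in lborel. norm (indicator {..<-t} s * cmod (g s)) \<le> cmod (g s)"
      by (intro always_eventually allI AE_I2) (auto simp: indicator_def)
    show "AE s in lborel. ((\<lambda>t. indicator {..<-t} s * cmod (g s)) \<longlongrightarrow> 0) at_top"
    proof (rule AE_I2)
      fix s :: real
      have "\<forall>\<^sub>F t in at_top. indicator {..<-t} s * cmod (g s) = 0"
        using eventually_ge_at_top[of "- s"] by eventually_elim (auto simp: indicator_def)
      then show "((\<lambda>t. indicator {..<-t} s * cmod (g s)) \<longlongrightarrow> 0) at_top"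
        by (rule tendsto_eventually)
    qed
  qed (use g in auto)
  then show ?thesis by (simp add: tail_def[abs_def])
qed

lemma tail_dilated_kernel:
  assumes r: "0 < r" and t: "0 < t"
  shows "tail (dilated_kernel r) t \<le> vp_const / (r * t)"
proof -
  have nn: "(\<integral>\<^sup>+s. ennreal (1 / s\<^sup>2) * indicator {t..} s \<partial>lborel) = ennreal (0 - (- 1 / t))"
  proof (rule nn_integral_FTC_atLeast)
    show "((\<lambda>s::real. - 1 / s) \<longlongrightarrow> 0) at_top"
      by (rule real_tendsto_divide_at_top[OF tendsto_const filterlim_ident])
    show "DERIV (\<lambda>s. - 1 / s) s :> 1 / s\<^sup>2" if "t \<le> s" for s
      using that t by (auto intro!: derivative_eq_intros simp: power2_eq_square)
  qed auto
  have eq: "(\<integral>\<^sup>+s. ennreal (indicator {t..} s * (1 / s\<^sup>2)) \<partial>lborel) = ennreal (1 / t)"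
    using nn by (subst nn_integral_cong[of _ _ "\<lambda>s. ennreal (1 / s\<^sup>2) * indicator {t..} s"])
       (auto simp: indicator_def)
  have hb: "has_bochner_integral lborel (\<lambda>s. indicator {t..} s * (1 / s\<^sup>2)) (1 / t)"
    by (rule has_bochner_integral_nn_integral[OF _ _ _ eq]) (use t in auto)
  have "tail (dilated_kernel r) t = (\<integral>s. indicator {..<-t} (- s) * cmod (dilated_kernel r (- s)) \<partial>lborel)"
    unfolding tail_def
    using lborel_integral_real_affine[of "-1" "\<lambda>s. indicator {..<-t} s * cmod (dilated_kernel r s)" 0] by simp
  also have "\<dots> \<le> (\<integral>s. vp_const / r * (indicator {t..} s * (1 / s\<^sup>2)) \<partial>lborel)"
  proof (rule integral_mono')
    show "integrable lborel (\<lambda>s. vp_const / r * (indicator {t..} s * (1 / s\<^sup>2)))"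
      using hb by (intro integrable_mult_right) (simp add: has_bochner_integral_iff)
    fix s :: real
    show "0 \<le> vp_const / r * (indicator {t..} s * (1 / s\<^sup>2))"
      using vp_const_pos r by (intro mult_nonneg_nonneg) auto
    show "indicator {..<-t} (- s) * cmod (dilated_kernel r (- s)) \<le> vp_const / r * (indicator {t..} s * (1 / s\<^sup>2))"
    proof (cases "t < s")
      case True
      have s: "0 < s" using True t by simp
      have "\<bar>vp_kernel (r * s)\<bar> \<le> vp_const / (1 + (r * s)\<^sup>2)" by (rule abs_vp_kernel_le)
      also have "\<dots> \<le> vp_const / (r * s)\<^sup>2"
        using r s vp_const_pos by (intro divide_left_mono mult_pos_pos) (auto simp: add_pos_nonneg)
      finally have "r * \<bar>vp_kernel (r * s)\<bar> \<le> r * (vp_const / (r * s)\<^sup>2)"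
        using r by (intro mult_left_mono) auto
      also have "\<dots> = vp_const / r * (1 / s\<^sup>2)"
        using r s by (simp add: power2_eq_square field_simps)
      finally show ?thesis using True r
        by (simp add: dilated_kernel_def abs_mult norm_mult vp_kernel_minus)
    qed (use vp_const_pos r in \<open>auto simp: indicator_def\<close>)
  qed
  also have "\<dots> = vp_const / r * (1 / t)"
    unfolding integral_mult_right_zero using hb by (simp add: has_bochner_integral_iff)
  finally show ?thesis by simp
qed

context bounded_c0_semigroup
begin

lemma T_has_derivative_at:
  assumes "y \<in> D" "0 < t"
  shows "((\<lambda>s. T s y) has_vector_derivative - T t (A y)) (at t)"
proof -
  have "at t within {0..} = at t" using assms(2) by (intro at_within_interior) simp
  then show ?thesis using T_has_derivative[OF assms(1), of t] assms(2) by simp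
qed

text \<open>
  Integrate by parts: \<open>T(t + s) A y\<close> is minus a derivative in \<open>s\<close>, and the derivative of the dilated
  kernel has \<open>L\<^sup>1\<close> norm of order \<open>r\<close>. Thus the low frequency part of \<open>T(t) A\<close> is of size \<open>r\<close>.
\<close>

lemma dilated_kernel_generator_bound:
  assumes r: "0 < r" and t: "0 \<le> t" and y: "y \<in> D"
  shows "norm (vint lborel (dilated_kernel r) (\<lambda>s. damped 0 (t + s) (A y))) \<le> 6 * vp_const * M * r * norm y"
proof (rule norm_le_of_cinner)
  fix w
  define q where "q s = dilated_kernel r s * cinner (T (t + s) (A y)) w" for s
  define C where "C = vp_const * (M * norm y * norm w)"
  have C: "0 \<le> C" using vp_const_pos M1 by (simp add: C_def)
  have T_shift: "continuous_on {-t..N} (\<lambda>s. T (t + s) x)" for N x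
    by (rule continuous_on_compose2[OF T_continuous]) (auto intro!: continuous_intros)
  have dilated_kernel_cont: "continuous_on S (dilated_kernel r)" for S
    unfolding dilated_kernel_def
    by (intro continuous_intros continuous_on_compose2[OF vp_kernel_continuous[of UNIV], of _ "\<lambda>s. r * s"]) auto
  have u_le: "cmod (cinner (T (t + s) x) w) \<le> M * norm x * norm w" if "-t \<le> s" for s x
    using cinner_cauchy_schwarz[of "T (t + s) x" w] mult_right_mono[OF norm_T[of "t + s" x], of "norm w"] that
    by simp
  have key: "cmod (integral {-t..N} q) \<le> 6 * r * C" "q integrable_on {-t..N}"
    "set_integrable lborel {-t..N} q" if N: "0 \<le> N" for N
  proof -
    define \<phi> where "\<phi> s = dilated_kernel r s * cinner (T (t + s) y) w" for s
    define p where "p s = complex_of_real (r\<^sup>2 * vp_kernel' (r * s)) * cinner (T (t + s) y) w" for s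
    have q_cont: "continuous_on {-t..N} q"
      unfolding q_def by (intro continuous_intros dilated_kernel_cont cinner.continuous_on T_shift)
    show q_int: "q integrable_on {-t..N}" by (rule integrable_continuous_interval[OF q_cont])
    show "set_integrable lborel {-t..N} q" by (rule borel_integrable_atLeastAtMost'[OF q_cont])
    have ftc: "((\<lambda>s. p s - q s) has_integral (\<phi> N - \<phi> (-t))) {-t..N}"
    proof (rule fundamental_theorem_of_calculus_interior_strong[of "{0}"])
      show "continuous_on {-t..N} \<phi>"
        unfolding \<phi>_def by (intro continuous_intros dilated_kernel_cont cinner.continuous_on T_shift)
      fix s assume s: "s \<in> {-t<..<N} - {0}"
      have "((\<lambda>s. r * vp_kernel (r * s)) has_field_derivative r * (vp_kernel' (r * s) * r)) (at s)"
        by (intro DERIV_cmult DERIV_chain2[OF DERIV_vp_kernel]) (use s r in \<open>auto intro!: derivative_eq_intros\<close>)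
      then have 1: "(dilated_kernel r has_vector_derivative complex_of_real (r * (vp_kernel' (r * s) * r))) (at s)"
        unfolding dilated_kernel_def[abs_def] has_real_derivative_iff_has_vector_derivative
        by (rule bounded_linear.has_vector_derivative[OF bounded_linear_of_real])
      have "((\<lambda>s. T s y) \<circ> (\<lambda>s. t + s) has_vector_derivative (1 *\<^sub>R - T (t + s) (A y))) (at s)"
        using s by (intro vector_diff_chain_at T_has_derivative_at[OF y]) (auto intro!: derivative_eq_intros)
      then have "((\<lambda>s. T (t + s) y) has_vector_derivative - T (t + s) (A y)) (at s)"
        by (simp add: o_def)
      then have 2: "((\<lambda>s. cinner (T (t + s) y) w) has_vector_derivative cinner (- T (t + s) (A y)) w) (at s)"
        by (rule bounded_linear.has_vector_derivative[OF cinner.bounded_linear_left])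
      show "(\<phi> has_vector_derivative (p s - q s)) (at s)"
        unfolding \<phi>_def
        by (rule has_vector_derivative_eq_rhs[OF has_vector_derivative_mult[OF 1 2]])
           (simp add: p_def q_def cinner.minus_left power2_eq_square mult_ac)
    qed (use t N in auto)
    have p_int: "p integrable_on {-t..N}"
      using integrable_add[OF has_integral_integrable[OF ftc] q_int] by simp
    have q_eq: "integral {-t..N} q = integral {-t..N} p - (\<phi> N - \<phi> (-t))"
      using integral_unique[OF ftc] integral_diff[OF p_int q_int] by (simp add: algebra_simps)
    have p_le: "cmod (integral {-t..N} p) \<le> r * C * pi"
    proof -
      have at: "((\<lambda>s. C * (r\<^sup>2 / (1 + (r * s)\<^sup>2))) has_integral (C * (r * arctan (r * N)) - C * (r * arctan (r * (-t))))) {-t..N}"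
      proof (rule fundamental_theorem_of_calculus)
        fix s
        have "((\<lambda>s. C * (r * arctan (r * s))) has_field_derivative C * (r\<^sup>2 / (1 + (r * s)\<^sup>2))) (at s within {-t..N})"
          by (auto intro!: derivative_eq_intros simp: power2_eq_square divide_inverse)
        then show "((\<lambda>s. C * (r * arctan (r * s))) has_vector_derivative C * (r\<^sup>2 / (1 + (r * s)\<^sup>2))) (at s within {-t..N})"
          by (simp add: has_real_derivative_iff_has_vector_derivative)
      qed (use t N in auto)
      have "cmod (integral {-t..N} p) \<le> integral {-t..N} (\<lambda>s. C * (r\<^sup>2 / (1 + (r * s)\<^sup>2)))"
      proof (rule Henstock_Kurzweil_Integration.integral_norm_bound_integral[OF p_int has_integral_integrable[OF at]])
        fix s assume s: "s \<in> {-t..N}"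
        have "cmod (p s) = r\<^sup>2 * \<bar>vp_kernel' (r * s)\<bar> * cmod (cinner (T (t + s) y) w)"
          by (simp only: p_def norm_mult norm_of_real abs_mult) simp
        also have "\<dots> \<le> r\<^sup>2 * (vp_const / (1 + (r * s)\<^sup>2)) * (M * norm y * norm w)"
          using s vp_const_pos by (intro mult_mono u_le mult_left_mono abs_vp_kernel'_le) auto
        finally show "cmod (p s) \<le> C * (r\<^sup>2 / (1 + (r * s)\<^sup>2))"
          by (simp add: C_def field_simps)
      qed
      also have "\<dots> = r * C * (arctan (r * N) + arctan (r * t))"
        using integral_unique[OF at] by (simp add: algebra_simps arctan_minus)
      also have "\<dots> \<le> r * C * pi"
        using arctan_ubound[of "r * N"] arctan_ubound[of "r * t"] r C by (intro mult_left_mono) auto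
      finally show ?thesis .
    qed
    have phi: "cmod (\<phi> s) \<le> r * C" if "-t \<le> s" for s
    proof -
      have "vp_const / (1 + (r * s)\<^sup>2) \<le> vp_const" using vp_const_pos by (simp add: divide_le_eq add_pos_nonneg)
      then have "\<bar>vp_kernel (r * s)\<bar> \<le> vp_const" using abs_vp_kernel_le[of "r * s"] by linarith
      then have "cmod (\<phi> s) \<le> (r * vp_const) * (M * norm y * norm w)"
        unfolding \<phi>_def norm_mult using r that vp_const_pos
        by (intro mult_mono u_le) (auto simp: dilated_kernel_def norm_mult)
      then show ?thesis by (simp add: C_def mult_ac)
    qed
    have "cmod (\<phi> N) \<le> r * C" "cmod (\<phi> (-t)) \<le> r * C"
      using phi[of N] phi[of "-t"] t N by simp_all
    with p_le have "cmod (integral {-t..N} q) \<le> r * C * pi + (r * C + r * C)"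
      using norm_triangle_ineq4[of "integral {-t..N} p" "\<phi> N - \<phi> (-t)"]
        norm_triangle_ineq4[of "\<phi> N" "\<phi> (-t)"] unfolding q_eq by linarith
    also have "\<dots> \<le> 6 * r * C"
      using pi_less_4 r C mult_left_mono[of pi 4 "r * C"] by simp
    finally show "cmod (integral {-t..N} q) \<le> 6 * r * C" .
  qed
  have lim: "(\<lambda>n. integral {-t..real n} q) \<longlonglongrightarrow> cinner (vint lborel (dilated_kernel r) (\<lambda>s. damped 0 (t + s) (A y))) w"
  proof -
    have q_damped: "dilated_kernel r s * cinner (damped 0 (t + s) (A y)) w = indicator {-t..} s *\<^sub>R q s" for s
      by (auto simp: damped_def q_def indicator_def cinner.zero_left)
    have "(\<lambda>n. \<integral>s. indicator {-t..real n} s *\<^sub>R q s \<partial>lborel) \<longlonglongrightarrow> (\<integral>s. indicator {-t..} s *\<^sub>R q s \<partial>lborel)"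
    proof (rule integral_dominated_convergence[where w="\<lambda>s. cmod (dilated_kernel r s) * (M * norm (A y) * norm w)"])
      show "integrable lborel (\<lambda>s. cmod (dilated_kernel r s) * (M * norm (A y) * norm w))"
        using dilated_kernel_integrable[OF r] by (intro integrable_mult_left) auto
      show "(\<lambda>s. indicator {-t..} s *\<^sub>R q s) \<in> borel_measurable lborel"
        using integrable_weighted_cinner[OF _ dilated_kernel_integrable[OF r] tame_shift[OF tame_damped], of 0 t "A y" w]
        unfolding q_damped by auto
      show "(\<lambda>s. indicator {-t..real n} s *\<^sub>R q s) \<in> borel_measurable lborel" for n
        using key(3)[of "real n"] by (auto simp: set_integrable_def)
      show "AE s in lborel. norm (indicator {-t..real n} s *\<^sub>R q s) \<le> cmod (dilated_kernel r s) * (M * norm (A y) * norm w)" for n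
      proof (rule AE_I2)
        fix s
        show "norm (indicator {-t..real n} s *\<^sub>R q s) \<le> cmod (dilated_kernel r s) * (M * norm (A y) * norm w)"
          using u_le[of s "A y"] M1 by (cases "s \<in> {-t..real n}") (auto simp: q_def norm_mult intro!: mult_left_mono)
      qed
      show "AE s in lborel. (\<lambda>n. indicator {-t..real n} s *\<^sub>R q s) \<longlonglongrightarrow> indicator {-t..} s *\<^sub>R q s"
      proof (intro AE_I2 tendsto_eventually)
        fix s
        have "\<forall>\<^sub>F n in sequentially. real n \<ge> s"
          using filterlim_real_sequentially by (simp add: filterlim_at_top)
        then show "\<forall>\<^sub>F n in sequentially. indicator {-t..real n} s *\<^sub>R q s = indicator {-t..} s *\<^sub>R q s"
          by eventually_elim (auto simp: indicator_def)
      qed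
    qed
    moreover have "(\<integral>s. indicator {-t..real n} s *\<^sub>R q s \<partial>lborel) = integral {-t..real n} q" for n
      using set_borel_integral_eq_integral(2)[OF key(3)[of "real n"]] by (simp add: set_lebesgue_integral_def)
    moreover have "cinner (vint lborel (dilated_kernel r) (\<lambda>s. damped 0 (t + s) (A y))) w = (\<integral>s. indicator {-t..} s *\<^sub>R q s \<partial>lborel)"
      by (subst cinner_vint[OF _ dilated_kernel_integrable[OF r] tame_shift[OF tame_damped]]) (auto simp: q_damped)
    ultimately show ?thesis by simp
  qed
  have "cmod (cinner (vint lborel (dilated_kernel r) (\<lambda>s. damped 0 (t + s) (A y))) w) \<le> 6 * r * C"
    by (rule LIMSEQ_le_const2[OF tendsto_norm[OF lim]]) (use key(1) in auto)
  then show "cmod (cinner (vint lborel (dilated_kernel r) (\<lambda>s. damped 0 (t + s) (A y))) w) \<le> 6 * vp_const * M * r * norm y * norm w"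
    by (simp add: C_def mult_ac)
qed (use vp_const_pos M1 r in auto)

end

section \<open>Jordan decomposition of a signed measure\<close>

context
  fixes \<nu> :: "real set \<Rightarrow> real"
  assumes ca: "\<And>B :: nat \<Rightarrow> real set. range B \<subseteq> sets borel \<Longrightarrow> disjoint_family B \<Longrightarrow>
      (\<lambda>i. \<nu> (B i)) sums \<nu> (\<Union>i. B i)"
begin

private lemma nu_empty: "\<nu> {} = 0"
proof -
  have "(\<lambda>i::nat. \<nu> {}) sums \<nu> (\<Union>i::nat. {})"
    by (rule ca) (auto simp: disjoint_family_on_def)
  then have "summable (\<lambda>i::nat. \<nu> {})" by (rule sums_summable)
  then show ?thesis by (simp add: summable_const_iff)
qed

private lemma nu_Un:
  assumes "A \<in> sets borel" "B \<in> sets borel" "A \<inter> B = {}"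
  shows "\<nu> (A \<union> B) = \<nu> A + \<nu> B"
proof -
  have "(\<lambda>i. \<nu> (binaryset A B i)) sums \<nu> (\<Union>i. binaryset A B i)"
    by (rule ca) (use assms in \<open>auto simp: range_binaryset_eq disjoint_family_on_def binaryset_def\<close>)
  then have "(\<lambda>i. \<nu> (binaryset A B i)) sums \<nu> (A \<union> B)" by (simp add: UN_binaryset_eq)
  moreover have "(\<lambda>i. \<nu> (binaryset A B i)) sums (\<nu> A + \<nu> B)"
    by (rule binaryset_sums[of \<nu>, OF nu_empty])
  ultimately show ?thesis by (rule sums_unique2)
qed

private lemma nu_split:
  assumes "A \<in> sets borel" "B \<in> sets borel"
  shows "\<nu> A = \<nu> (A \<inter> B) + \<nu> (A - B)"
  using nu_Un[of "A \<inter> B" "A - B"] assms by (simp add: Int_Diff_Un Int_Diff_disjoint)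

private definition unbounded_within where
  "unbounded_within A \<longleftrightarrow> A \<in> sets borel \<and> (\<forall>C. \<exists>B\<in>sets borel. B \<subseteq> A \<and> C < \<bar>\<nu> B\<bar>)"

text \<open>
  Choose a subset \<open>B\<close> with \<open>|\<nu> B| > |\<nu> A| + 1\<close>. Then \<open>B\<close> and \<open>A - B\<close> both have measure at least 1 in
  modulus, and \<open>\<nu>\<close> is unbounded within one of them; remove the other.
\<close>

private lemma unbounded_within_step:
  assumes "unbounded_within A" shows "\<exists>A'. unbounded_within A' \<and> A' \<subseteq> A \<and> 1 \<le> \<bar>\<nu> (A - A')\<bar>"
proof -
  have A: "A \<in> sets borel" using assms by (simp add: unbounded_within_def)
  obtain B where B: "B \<in> sets borel" "B \<subseteq> A" "\<bar>\<nu> A\<bar> + 1 < \<bar>\<nu> B\<bar>"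
    using assms unfolding unbounded_within_def by blast
  have split: "\<nu> A = \<nu> B + \<nu> (A - B)"
    using nu_split[OF A B(1)] B(2) by (simp add: Int_absorb1)
  have AB: "A - B \<in> sets borel" "A - (A - B) = B" using A B by auto
  have "unbounded_within B \<or> unbounded_within (A - B)"
  proof (rule ccontr)
    assume "\<not> ?thesis"
    then obtain C1 C2 where C: "\<And>S. S \<in> sets borel \<Longrightarrow> S \<subseteq> B \<Longrightarrow> \<bar>\<nu> S\<bar> \<le> C1"
      "\<And>S. S \<in> sets borel \<Longrightarrow> S \<subseteq> A - B \<Longrightarrow> \<bar>\<nu> S\<bar> \<le> C2"
      using B(1) AB(1) unfolding unbounded_within_def by (meson not_le)
    obtain S where S: "S \<in> sets borel" "S \<subseteq> A" "C1 + C2 < \<bar>\<nu> S\<bar>"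
      using assms unfolding unbounded_within_def by blast
    have "\<nu> S = \<nu> (S \<inter> B) + \<nu> (S - B)" by (rule nu_split[OF S(1) B(1)])
    moreover have "\<bar>\<nu> (S \<inter> B)\<bar> \<le> C1" "\<bar>\<nu> (S - B)\<bar> \<le> C2"
      using S B by (auto intro!: C)
    ultimately show False using S(3) by linarith
  qed
  then show ?thesis
  proof
    assume "unbounded_within B"
    then show ?thesis using B split by (intro exI[of _ B]) auto
  next
    assume "unbounded_within (A - B)"
    then show ?thesis using B AB by (intro exI[of _ "A - B"]) auto
  qed
qed

text \<open>
  Otherwise the step above could be iterated, and would produce disjoint sets of measure at least 1 in
  modulus, although the measures of disjoint sets form a convergent series.
\<close>

private lemma nu_bounded: "\<exists>C. \<forall>B\<in>sets borel. \<bar>\<nu> B\<bar> \<le> C"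
proof (rule ccontr)
  assume "\<not> ?thesis"
  then have "unbounded_within UNIV" unfolding unbounded_within_def by (auto simp: not_le)
  then have "\<exists>A. \<forall>n::nat. unbounded_within (A n) \<and> (A (Suc n) \<subseteq> A n \<and> 1 \<le> \<bar>\<nu> (A n - A (Suc n))\<bar>)"
    using unbounded_within_step by (intro dependent_nat_choice) auto
  then obtain A where A: "\<And>n::nat. unbounded_within (A n)" "\<And>n. A (Suc n) \<subseteq> A n" "\<And>n. 1 \<le> \<bar>\<nu> (A n - A (Suc n))\<bar>"
    by blast
  have anti: "A m \<subseteq> A n" if "n \<le> m" for n m
    using that A(2) by (rule lift_Suc_antimono_le[rotated])
  have "(\<lambda>n. \<nu> (A n - A (Suc n))) sums \<nu> (\<Union>n. A n - A (Suc n))"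
  proof (rule ca)
    show "range (\<lambda>n. A n - A (Suc n)) \<subseteq> sets borel" using A(1) by (auto simp: unbounded_within_def)
    show "disjoint_family (\<lambda>n. A n - A (Suc n))"
      unfolding disjoint_family_on_def
    proof (intro ballI impI)
      fix m n :: nat assume "m \<noteq> n"
      then consider "Suc m \<le> n" | "Suc n \<le> m" by linarith
      then show "(A m - A (Suc m)) \<inter> (A n - A (Suc n)) = {}"
        by cases (use anti in blast)+
    qed
  qed
  then have "(\<lambda>n. \<nu> (A n - A (Suc n))) \<longlonglongrightarrow> 0"
    using sums_summable summable_LIMSEQ_zero by blast
  then have "\<forall>\<^sub>F n in sequentially. dist (\<nu> (A n - A (Suc n))) 0 < 1"
    by (rule tendstoD) simp
  then have "\<forall>\<^sub>F n in sequentially. \<bar>\<nu> (A n - A (Suc n))\<bar> < 1"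
    by (simp add: dist_real_def)
  then show False using A(3) by (auto simp: eventually_sequentially not_le[symmetric])
qed

private definition pv where
  "pv A = (SUP B\<in>{B \<in> sets borel. B \<subseteq> A}. ennreal (\<nu> B))"

text \<open>
  Subsets of negative measure are replaced by the empty set before the measures are added.
\<close>

private lemma pv_super:
  assumes "A \<in> sets borel" "B \<in> sets borel" "A \<inter> B = {}"
  shows "pv A + pv B \<le> pv (A \<union> B)"
proof -
  have le: "ennreal (\<nu> S) + ennreal (\<nu> R) \<le> pv (A \<union> B)"
    if S: "S \<in> sets borel" "S \<subseteq> A" and R: "R \<in> sets borel" "R \<subseteq> B" for S R
  proof -
    define S' where "S' = (if 0 \<le> \<nu> S then S else {})"
    define R' where "R' = (if 0 \<le> \<nu> R then R else {})"
    have S': "S' \<in> sets borel" "S' \<subseteq> A" "0 \<le> \<nu> S'" "ennreal (\<nu> S) = ennreal (\<nu> S')"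
      using S by (auto simp: S'_def nu_empty ennreal_neg)
    have R': "R' \<in> sets borel" "R' \<subseteq> B" "0 \<le> \<nu> R'" "ennreal (\<nu> R) = ennreal (\<nu> R')"
      using R by (auto simp: R'_def nu_empty ennreal_neg)
    have "ennreal (\<nu> S) + ennreal (\<nu> R) = ennreal (\<nu> (S' \<union> R'))"
      using S' R' assms by (subst nu_Un) auto
    also have "\<dots> \<le> pv (A \<union> B)"
      unfolding pv_def using S' R' by (intro SUP_upper) auto
    finally show ?thesis .
  qed
  have ne: "{S \<in> sets borel. S \<subseteq> X} \<noteq> {}" for X :: "real set" by auto
  show ?thesis
    unfolding pv_def[of A] pv_def[of B]
    by (subst ennreal_SUP_add_left[OF ne, symmetric], rule SUP_least,
        subst ennreal_SUP_add_right[OF ne], rule SUP_least) (use le in auto)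
qed

private lemma ennreal_sum_le: "ennreal (\<Sum>i<n. x i) \<le> (\<Sum>i<(n::nat). ennreal (x i))"
proof (induction n)
  case (Suc n)
  have "ennreal (a + b) \<le> ennreal a + ennreal b" for a b :: real
    by (cases "0 \<le> a"; cases "0 \<le> b") (auto simp: ennreal_neg ennreal_leI simp flip: ennreal_plus)
  then have "ennreal (\<Sum>i<Suc n. x i) \<le> ennreal (\<Sum>i<n. x i) + ennreal (x n)" by simp
  also have "\<dots> \<le> (\<Sum>i<Suc n. ennreal (x i))" using Suc.IH by (simp add: add_right_mono)
  finally show ?case .
qed simp

text \<open>
  Superadditivity of the supremum gives one inequality; for the other, a subset of the union is cut
  into its parts.
\<close>

private lemma pv_countably_additive: "countably_additive (sets borel) pv"
  unfolding countably_additive_def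
proof (intro allI impI)
  fix A :: "nat \<Rightarrow> real set"
  assume A: "range A \<subseteq> sets borel" "disjoint_family A"
  show "(\<Sum>i. pv (A i)) = pv (\<Union>i. A i)"
  proof (rule antisym)
    have fin: "(\<Sum>i<n. pv (A i)) \<le> pv (\<Union>i<n. A i)" for n
    proof (induction n)
      case (Suc n)
      have "A i \<inter> A n = {}" if "i < n" for i
        using A(2) that unfolding disjoint_family_on_def by (metis UNIV_I less_irrefl)
      then have disj: "(\<Union>i<n. A i) \<inter> A n = {}" by blast
      have "(\<Sum>i<Suc n. pv (A i)) \<le> pv (\<Union>i<n. A i) + pv (A n)"
        using Suc.IH by (simp add: add_right_mono)
      also have "\<dots> \<le> pv ((\<Union>i<n. A i) \<union> A n)"
        using A(1) by (intro pv_super disj) auto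
      finally show ?case by (simp add: lessThan_Suc Un_commute)
    qed simp
    have "pv (\<Union>i<n. A i) \<le> pv (\<Union>i. A i)" for n
      unfolding pv_def by (rule SUP_subset_mono) auto
    with fin show "(\<Sum>i. pv (A i)) \<le> pv (\<Union>i. A i)"
      unfolding suminf_eq_SUP by (intro SUP_least) (meson order_trans)
    show "pv (\<Union>i. A i) \<le> (\<Sum>i. pv (A i))"
      unfolding pv_def[of "\<Union>i. A i"]
    proof (rule SUP_least, clarify)
      fix B :: "real set" assume B: "B \<in> sets borel" "B \<subseteq> (\<Union>i. A i)"
      have "(\<lambda>i. \<nu> (A i \<inter> B)) sums \<nu> (\<Union>i. A i \<inter> B)"
        by (rule ca) (use A B in \<open>auto simp: disjoint_family_on_def\<close>)
      also have "(\<Union>i. A i \<inter> B) = B" using B by auto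
      finally have "(\<lambda>n. ennreal (\<Sum>i<n. \<nu> (A i \<inter> B))) \<longlonglongrightarrow> ennreal (\<nu> B)"
        unfolding sums_def by (rule tendsto_ennrealI)
      moreover have "ennreal (\<Sum>i<n. \<nu> (A i \<inter> B)) \<le> (\<Sum>i. pv (A i))" for n
      proof -
        have "ennreal (\<Sum>i<n. \<nu> (A i \<inter> B)) \<le> (\<Sum>i<n. ennreal (\<nu> (A i \<inter> B)))"
          by (rule ennreal_sum_le)
        also have "\<dots> \<le> (\<Sum>i<n. pv (A i))"
          unfolding pv_def using A B by (intro sum_mono SUP_upper) auto
        also have "\<dots> \<le> (\<Sum>i. pv (A i))" by (rule sum_le_suminf) auto
        finally show ?thesis .
      qed
      ultimately show "ennreal (\<nu> B) \<le> (\<Sum>i. pv (A i))"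
        by (intro LIMSEQ_le_const2) auto
    qed
  qed
qed

private lemma emeasure_positive_variation:
  assumes "A \<in> sets borel" shows "emeasure (positive_variation \<nu>) A = pv A"
proof -
  have "positive_variation \<nu> = measure_of UNIV (sets borel) pv"
    by (simp add: positive_variation_def pv_def[abs_def])
  moreover have "emeasure (measure_of UNIV (sets borel) pv) A = pv A"
  proof (rule emeasure_measure_of_sigma[OF _ _ pv_countably_additive assms])
    show "sigma_algebra UNIV (sets (borel :: real measure))"
      using sets.sigma_algebra_axioms[of "borel :: real measure"] by simp
    show "positive (sets borel) pv"
      by (simp add: positive_def pv_def nu_empty)
  qed
  ultimately show ?thesis by simp
qed

lemma sets_positive_variation: "sets (positive_variation \<nu>) = sets borel"
  using sets.sigma_sets_eq[of "borel :: real measure"]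
  by (simp add: positive_variation_def sets_measure_of)

lemma finite_positive_variation: "finite_measure (positive_variation \<nu>)"
proof
  obtain C where C: "\<And>B. B \<in> sets borel \<Longrightarrow> \<bar>\<nu> B\<bar> \<le> C" using nu_bounded by blast
  have "space (positive_variation \<nu>) = UNIV"
    using sets_eq_imp_space_eq[OF sets_positive_variation] by simp
  then have "emeasure (positive_variation \<nu>) (space (positive_variation \<nu>)) = pv UNIV"
    by (simp add: emeasure_positive_variation)
  also have "\<dots> \<le> ennreal C"
    unfolding pv_def using C by (intro SUP_least ennreal_leI) (auto simp: abs_le_iff)
  finally show "emeasure (positive_variation \<nu>) (space (positive_variation \<nu>)) \<noteq> \<infinity>"
    by (auto simp: top_unique)
qed

lemma AE_positive_variation:
  assumes S: "S \<in> sets borel" and null: "\<And>B. B \<in> sets borel \<Longrightarrow> B \<inter> S = {} \<Longrightarrow> \<nu> B = 0"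
  shows "AE u in positive_variation \<nu>. u \<in> S"
proof (rule AE_I')
  have "emeasure (positive_variation \<nu>) (- S) = pv (- S)"
    using S by (intro emeasure_positive_variation) auto
  also have "\<dots> = 0"
    unfolding pv_def using null by (intro antisym SUP_least) (auto simp: subset_Compl_self_eq disjoint_eq_subset_Compl)
  finally show "- S \<in> null_sets (positive_variation \<nu>)"
    using S by (auto simp: null_sets_def sets_positive_variation)
qed auto

end

section \<open>Resolvent bounds on the imaginary axis\<close>

text \<open>
  The resolvent set is defined through \<open>z - A\<close>, whereas the resolvents that occur are inverses of
  \<open>z + A\<close>.
\<close>

lemma resolvent_set_shift:
  fixes A :: "'a::complex_hilbert_space \<Rightarrow> 'a"
  assumes "- z \<in> resolvent_set D A"
  shows "bij_betw (\<lambda>x. z *\<^sub>C x + A x) D UNIV" "bounded_clinear (shift_inverse D A z)"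
proof -
  let ?F = "\<lambda>x. (- z) *\<^sub>C x - A x" and ?G = "\<lambda>x. z *\<^sub>C x + A x"
  have F: "bij_betw ?F D UNIV" "bounded_clinear (inv_into D ?F)"
    using assms by (auto simp: resolvent_set_def)
  have G: "?G = uminus \<circ> ?F" by (auto simp: scaleC.minus_left)
  have "bij_betw (uminus :: 'a \<Rightarrow> 'a) UNIV UNIV"
    by (rule bij_betw_byWitness[where f'=uminus]) auto
  with F(1) show bij: "bij_betw ?G D UNIV" unfolding G by (rule bij_betw_trans)
  have "shift_inverse D A z = (\<lambda>y. inv_into D ?F (- y))"
  proof
    fix y
    have v: "inv_into D ?F (- y) \<in> D" "?F (inv_into D ?F (- y)) = - y"
      using F(1) by (auto simp: bij_betw_def intro: inv_into_into f_inv_into_f[of _ ?F])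
    then have "?G (inv_into D ?F (- y)) = y"
      using fun_cong[OF G, of "inv_into D ?F (- y)"] by simp
    then show "shift_inverse D A z y = inv_into D ?F (- y)"
      unfolding shift_inverse_def using bij v(1) by (intro inv_into_f_eq) (auto simp: bij_betw_def)
  qed
  then show "bounded_clinear (shift_inverse D A z)"
    using F(2) bounded_linear_compose[OF _ bounded_linear_minus[OF bounded_linear_ident], of "inv_into D ?F"]
    unfolding bounded_clinear_def by (simp add: scaleC.minus_right[symmetric])
qed

lemma shift_inverse_lower_bound:
  fixes A :: "'a::complex_hilbert_space \<Rightarrow> 'a"
  assumes z: "- z \<in> resolvent_set D A" and v: "v \<in> D"
  shows "norm v \<le> onorm (shift_inverse D A z) * norm (z *\<^sub>C v + A v)"
proof -
  have "shift_inverse D A z (z *\<^sub>C v + A v) = v"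
    unfolding shift_inverse_def
    using resolvent_set_shift(1)[OF z] inv_into_f_f[OF _ v, of "\<lambda>x. z *\<^sub>C x + A x"]
    by (auto simp: bij_betw_def)
  then show ?thesis
    using onorm[OF bounded_clinear_linear[OF resolvent_set_shift(2)[OF z]], of "z *\<^sub>C v + A v"] by simp
qed

lemma shift_inverse_norm_le:
  fixes A :: "'a::complex_hilbert_space \<Rightarrow> 'a"
  assumes bij: "bij_betw (\<lambda>x. z *\<^sub>C x + A x) D UNIV"
    and K: "\<And>v. v \<in> D \<Longrightarrow> norm v \<le> K * norm (z *\<^sub>C v + A v)"
  shows "norm (shift_inverse D A z y) \<le> K * norm y"
proof -
  have "shift_inverse D A z y \<in> D" "z *\<^sub>C shift_inverse D A z y + A (shift_inverse D A z y) = y"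
    unfolding shift_inverse_def using bij
    by (auto simp: bij_betw_def intro: inv_into_into f_inv_into_f[of _ "\<lambda>x. z *\<^sub>C x + A x"])
  then show ?thesis using K by metis
qed

lemma not_boundary_spectrum:
  assumes "- s \<notin> boundary_spectrum D A"
  shows "- (\<i> * complex_of_real s) \<in> resolvent_set D A"
proof (rule ccontr)
  assume "\<not> ?thesis"
  then have "- \<i> * - (\<i> * complex_of_real s) \<in> (\<lambda>z. - \<i> * z) ` op_spectrum D A"
    unfolding op_spectrum_def by (intro imageI) simp
  moreover have "- \<i> * - (\<i> * complex_of_real s) = complex_of_real (- s)"
    by (simp add: complex_eq_iff)
  ultimately show False using assms unfolding boundary_spectrum_def by simp
qed

text \<open>
  Uniform invertibility on a closed set of frequencies that misses the spectrum. For large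
  frequencies this is assumed; on the remaining compact set, lower bounds for \<open>is + A\<close> persist near each
  point with twice the constant.
\<close>

lemma boundary_spectrum_closed_bound:
  fixes A :: "'a::complex_hilbert_space \<Rightarrow> 'a"
  assumes S: "closed S" "\<And>s. s \<in> S \<Longrightarrow> - s \<notin> boundary_spectrum D A"
    and off: "resolvent_bounded_off D A \<eta>"
  obtains K where "0 < K"
    "\<And>s v. s \<in> S \<Longrightarrow> v \<in> D \<Longrightarrow> norm v \<le> K * norm ((\<i> * complex_of_real s) *\<^sub>C v + A v)"
proof -
  obtain K0 where K0: "\<And>s. \<bar>s\<bar> \<ge> \<eta> \<Longrightarrow> onorm (shift_inverse D A (\<i> * complex_of_real s)) \<le> K0"
    using off unfolding resolvent_bounded_off_def bdd_above_def by auto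
  \<comment> \<open>Adding 1 makes the radius \<open>1 / (2 k)\<close> positive and finite.\<close>
  define k where "k s = \<bar>onorm (shift_inverse D A (\<i> * complex_of_real s))\<bar> + 1" for s
  have k: "0 < k s" for s by (simp add: k_def)
  have near: "norm v \<le> (2 * k s0) * norm ((\<i> * complex_of_real s) *\<^sub>C v + A v)"
    if s0: "s0 \<in> S" and s: "s \<in> ball s0 (1 / (2 * k s0))" and v: "v \<in> D" for s0 s v
  proof -
    have "norm v \<le> onorm (shift_inverse D A (\<i> * complex_of_real s0)) * norm ((\<i> * complex_of_real s0) *\<^sub>C v + A v)"
      by (rule shift_inverse_lower_bound[OF not_boundary_spectrum[OF S(2)[OF s0]] v])
    also have "\<dots> \<le> k s0 * norm ((\<i> * complex_of_real s0) *\<^sub>C v + A v)"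
      by (intro mult_right_mono) (auto simp: k_def)
    also have "(\<i> * complex_of_real s0) *\<^sub>C v + A v
        = ((\<i> * complex_of_real s) *\<^sub>C v + A v) + (\<i> * complex_of_real (s0 - s)) *\<^sub>C v"
      by (simp add: scaleC_add_left[symmetric] algebra_simps)
    also have "k s0 * norm \<dots> \<le> k s0 * (norm ((\<i> * complex_of_real s) *\<^sub>C v + A v) + \<bar>s0 - s\<bar> * norm v)"
      using k[of s0] norm_triangle_ineq[of "(\<i> * complex_of_real s) *\<^sub>C v + A v" "(\<i> * complex_of_real (s0 - s)) *\<^sub>C v"]
      by (intro mult_left_mono) (auto simp: norm_scaleC norm_mult simp del: of_real_diff)
    also have "\<dots> = k s0 * norm ((\<i> * complex_of_real s) *\<^sub>C v + A v) + (k s0 * \<bar>s0 - s\<bar>) * norm v"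
      by (simp add: algebra_simps)
    also have "\<dots> \<le> k s0 * norm ((\<i> * complex_of_real s) *\<^sub>C v + A v) + 1 / 2 * norm v"
      using s k[of s0] by (intro add_left_mono mult_right_mono) (auto simp: dist_real_def field_simps)
    finally show ?thesis by simp
  qed
  have "compact (S \<inter> {-\<eta>..\<eta>})" using S(1) by (simp add: closed_Int_compact)
  then obtain C where C: "C \<subseteq> S \<inter> {-\<eta>..\<eta>}" "finite C" "S \<inter> {-\<eta>..\<eta>} \<subseteq> (\<Union>c\<in>C. ball c (1 / (2 * k c)))"
  proof (rule compactE_image)
    show "open (ball c (1 / (2 * k c)))" for c by simp
    show "S \<inter> {-\<eta>..\<eta>} \<subseteq> (\<Union>c\<in>S \<inter> {-\<eta>..\<eta>}. ball c (1 / (2 * k c)))"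
      using k by fastforce
  qed
  define K where "K = \<bar>K0\<bar> + 1 + (\<Sum>c\<in>C. 2 * k c)"
  have sum_nn: "0 \<le> (\<Sum>c\<in>C. 2 * k c)" using k by (intro sum_nonneg) (simp add: less_imp_le)
  have "norm v \<le> K * norm ((\<i> * complex_of_real s) *\<^sub>C v + A v)" if s: "s \<in> S" and v: "v \<in> D" for s v
  proof (cases "\<bar>s\<bar> \<ge> \<eta>")
    case True
    have "norm v \<le> onorm (shift_inverse D A (\<i> * complex_of_real s)) * norm ((\<i> * complex_of_real s) *\<^sub>C v + A v)"
      by (rule shift_inverse_lower_bound[OF not_boundary_spectrum[OF S(2)[OF s]] v])
    also have "\<dots> \<le> K * norm ((\<i> * complex_of_real s) *\<^sub>C v + A v)"
      using K0[OF True] sum_nn by (intro mult_right_mono) (auto simp: K_def)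
    finally show ?thesis .
  next
    case False
    then have "s \<in> S \<inter> {-\<eta>..\<eta>}" using s by auto
    then obtain c where c: "c \<in> C" "s \<in> ball c (1 / (2 * k c))" using C(3) by blast
    have "norm v \<le> (2 * k c) * norm ((\<i> * complex_of_real s) *\<^sub>C v + A v)"
      using near[OF _ c(2) v] C(1) c(1) by blast
    also have "\<dots> \<le> K * norm ((\<i> * complex_of_real s) *\<^sub>C v + A v)"
      using member_le_sum[of c C "\<lambda>c. 2 * k c"] C(2) c(1) k
      by (intro mult_right_mono) (auto simp: K_def less_imp_le)
    finally show ?thesis .
  qed
  moreover have "0 < K" using sum_nn by (simp add: K_def)
  ultimately show thesis using that by blast
qed

section \<open>The Katznelson-Tzafriri theorem\<close>

lemma half_at_top: "filterlim (\<lambda>t::real. t / 2) at_top at_top"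
  unfolding filterlim_at_top
proof
  fix Z :: real
  show "\<forall>\<^sub>F t in at_top. Z \<le> t / 2"
    using eventually_ge_at_top[of "2 * Z"] by eventually_elim simp
qed

lemma sqrt_over_tendsto: "((\<lambda>t. sqrt (K / (t / 2))) \<longlongrightarrow> 0) at_top"
proof -
  have "((\<lambda>t. K / (t / 2)) \<longlongrightarrow> 0) at_top"
    by (rule real_tendsto_divide_at_top[OF tendsto_const half_at_top])
  from tendsto_real_sqrt[OF this] show ?thesis by simp
qed

lemma (in bounded_c0_semigroup) norm_vint_damped:
  assumes "integrable lborel g"
  shows "norm (vint lborel g (\<lambda>s. damped 0 (t + s) x)) \<le> (\<integral>s. cmod (g s) \<partial>lborel) * (M * norm x)"
proof -
  have tm: "tame (\<lambda>s. damped 0 (t + s) x)" by (rule tame_shift[OF tame_damped]) simp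
  have "norm (vint lborel g (\<lambda>s. damped 0 (t + s) x)) \<le> (\<integral>s. cmod (g s) * norm (damped 0 (t + s) x) \<partial>lborel)"
    by (rule norm_vint_le[OF _ assms tm]) auto
  also have "\<dots> \<le> (\<integral>s. cmod (g s) * (M * norm x) \<partial>lborel)"
    using integrable_weighted_norm[OF _ assms tm] assms
    by (intro integral_mono mult_left_mono norm_damped_le) auto
  finally show ?thesis by simp
qed

context bounded_c0_semigroup
begin

text \<open>
  The splitting of the semigroup into high and low frequencies, \<open>\<delta>\<^sub>0 = (\<delta>\<^sub>0 - P) + P\<close>.
\<close>

lemma T_split:
  assumes t: "0 \<le> t" and P: "integrable lborel P"
  shows "T t x = multiplier 1 (\<lambda>s. - P s) 0 t x + vint lborel P (\<lambda>s. damped 0 (t + s) x)"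
proof -
  have tm: "tame (\<lambda>s. damped 0 (t + s) x)" by (rule tame_shift[OF tame_damped[OF order_refl]])
  have "vint lborel (\<lambda>s. - P s) (\<lambda>s. damped 0 (t + s) x) = - vint lborel P (\<lambda>s. damped 0 (t + s) x)"
  proof (rule cinner_ext)
    fix y
    have m: "integrable lborel (\<lambda>s. - P s)" using P by simp
    show "cinner (vint lborel (\<lambda>s. - P s) (\<lambda>s. damped 0 (t + s) x)) y = cinner (- vint lborel P (\<lambda>s. damped 0 (t + s) x)) y"
      unfolding cinner.minus_left cinner_vint[OF sets_lborel m tm] cinner_vint[OF sets_lborel P tm] by simp
  qed
  then show ?thesis using t by (simp add: multiplier_def damped_def scaleC_one)
qed

text \<open>
  The transform of \<open>\<delta>\<^sub>0\<close> minus the dilated kernel vanishes on \<open>[-r, r]\<close>, so resolvents are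
  only needed for \<open>|s| \<ge> r\<close>.
\<close>

lemma high_frequency_decay:
  assumes r: "0 < r" and K: "0 < K" and t: "0 < t"
    and high: "\<And>s v. r \<le> \<bar>s\<bar> \<Longrightarrow> v \<in> D \<Longrightarrow> norm v \<le> K * norm (axis_shift s v)"
  shows "norm (multiplier 1 (\<lambda>s. - dilated_kernel r s) 0 (2 * t) x)
    \<le> (3 * (1 + (\<integral>s. \<bar>vp_kernel s\<bar> \<partial>lborel)) * M\<^sup>2 * sqrt (K / t) + M * (vp_const / (r * t))) * norm x"
proof -
  have int: "integrable lborel (\<lambda>s. - dilated_kernel r s)" using dilated_kernel_integrable[OF r] by simp
  have "fourier (\<lambda>s. - dilated_kernel r s) \<xi> = - fourier (dilated_kernel r) \<xi>" for \<xi>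
    by (simp add: fourier_def)
  then have mult: "1 + fourier (\<lambda>s. - dilated_kernel r s) (- s) = 0
      \<or> (\<forall>v\<in>D. norm v \<le> K * norm (axis_shift s v))" for s
    using fourier_dilated_kernel[OF r, of "- s"] high[of s] by (cases "\<bar>s\<bar> \<le> r") auto
  have "norm (multiplier 1 (\<lambda>s. - dilated_kernel r s) 0 (2 * t) x)
    \<le> (3 * (cmod 1 + (\<integral>s. cmod (- dilated_kernel r s) \<partial>lborel)) * M\<^sup>2 * sqrt (K / t) + M * tail (\<lambda>s. - dilated_kernel r s) t) * norm x"
    by (rule multiplier_decay[OF int K mult t])
  also have "(\<integral>s. cmod (- dilated_kernel r s) \<partial>lborel) = (\<integral>s. \<bar>vp_kernel s\<bar> \<partial>lborel)"
    using dilated_kernel_mass[OF r] by simp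
  also have "tail (\<lambda>s. - dilated_kernel r s) t = tail (dilated_kernel r) t" by (simp add: tail_def)
  also have "(3 * (cmod 1 + (\<integral>s. \<bar>vp_kernel s\<bar> \<partial>lborel)) * M\<^sup>2 * sqrt (K / t) + M * tail (dilated_kernel r) t) * norm x
    \<le> (3 * (1 + (\<integral>s. \<bar>vp_kernel s\<bar> \<partial>lborel)) * M\<^sup>2 * sqrt (K / t) + M * (vp_const / (r * t))) * norm x"
    using tail_dilated_kernel[OF r t] M1 K t by (intro mult_right_mono add_mono mult_left_mono) auto
  finally show ?thesis .
qed

lemma multiplier_tendsto:
  assumes g: "integrable lborel g" and K: "0 < K"
    and mult: "\<And>s. fourier g (- s) = 0 \<or> (\<forall>v\<in>D. norm v \<le> K * norm (axis_shift s v))"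
    and e: "0 < e"
  shows "\<forall>\<^sub>F t in at_top. \<forall>x. norm (vint lborel g (\<lambda>s. damped 0 (t + s) x)) \<le> e * norm x"
proof -
  define R where "R t = 3 * (cmod 0 + (\<integral>s. cmod (g s) \<partial>lborel)) * M\<^sup>2 * sqrt (K / (t / 2)) + M * tail g (t / 2)" for t
  have "(R \<longlongrightarrow> 3 * (cmod 0 + (\<integral>s. cmod (g s) \<partial>lborel)) * M\<^sup>2 * 0 + M * 0) at_top"
    unfolding R_def
    by (intro tendsto_intros sqrt_over_tendsto filterlim_compose[OF tail_tendsto[OF g] half_at_top])
  then have "\<forall>\<^sub>F t in at_top. R t < e"
    by (rule order_tendstoD(2)) (use e in simp)
  with eventually_gt_at_top[of 0] show ?thesis
  proof eventually_elim
    case (elim t)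
    show ?case
    proof
      fix x
      have "norm (multiplier 0 g 0 (2 * (t / 2)) x) \<le> R t * norm x"
        unfolding R_def by (rule multiplier_decay[OF g K]) (use mult elim in auto)
      then have "norm (vint lborel g (\<lambda>s. damped 0 (t + s) x)) \<le> R t * norm x"
        by (simp add: multiplier_def scaleC.zero_left)
      also have "\<dots> \<le> e * norm x" using elim by (intro mult_right_mono) auto
      finally show "norm (vint lborel g (\<lambda>s. damped 0 (t + s) x)) \<le> e * norm x" .
    qed
  qed
qed

context
  fixes N :: "nat \<Rightarrow> real measure" and c :: "nat \<Rightarrow> complex"
  assumes fin: "\<And>j. finite_measure (N j)" and N_sets: "\<And>j. sets (N j) = sets borel"
    and N_pos: "\<And>j. AE u in N j. 0 \<le> u"
begin

text \<open>
  The operator \<open>\<integral> T(s) d\<mu>(s)\<close>, where \<open>\<mu>\<close> is given as a combination of four finite measures on the half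
  line, as in its Jordan decomposition.
\<close>

definition measure_transform :: "'a \<Rightarrow> 'a" where "measure_transform x = (\<Sum>j<4::nat. vint (N j) (\<lambda>_. c j) (\<lambda>s. damped 0 s x))"

private definition mass where "mass = (\<Sum>j<4::nat. cmod (c j) * measure (N j) UNIV)"

private lemma mass_nonneg: "0 \<le> mass"
  unfolding mass_def by (intro sum_nonneg) auto

private lemma N_space: "space (N j) = UNIV"
  using sets_eq_imp_space_eq[OF N_sets] by simp

private lemma c_int: "integrable (N j) (\<lambda>_. c j)"
  using finite_measure.integrable_const[OF fin] .

private lemma cinner_measure_transform:
  "cinner (measure_transform x) y = (\<Sum>j<4::nat. \<integral>u. c j * cinner (damped 0 u x) y \<partial>N j)"
  unfolding measure_transform_def cinner.sum_left
  by (intro sum.cong refl) (subst cinner_vint[OF N_sets c_int tame_damped], auto)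

private lemma integral_bound:
  assumes "\<And>u. cmod (f u) \<le> b"
  shows "cmod (\<integral>u. c j * f u \<partial>N j) \<le> cmod (c j) * measure (N j) UNIV * b"
proof -
  interpret finite_measure "N j" by (rule fin)
  have b: "0 \<le> b" using assms[of 0] norm_ge_zero order_trans by blast
  have "cmod (\<integral>u. c j * f u \<partial>N j) \<le> (\<integral>u. cmod (c j * f u) \<partial>N j)"
    by (rule integral_norm_bound)
  also have "\<dots> \<le> (\<integral>u. cmod (c j) * b \<partial>N j)"
    using assms b by (intro integral_mono') (auto simp: norm_mult intro!: mult_left_mono)
  finally show ?thesis by (simp add: N_space mult_ac)
qed

private lemma integral_bound_sum:
  assumes "\<And>j u. cmod (f j u) \<le> b"
  shows "cmod (\<Sum>j<4::nat. \<integral>u. c j * f j u \<partial>N j) \<le> mass * b"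
proof -
  have "cmod (\<Sum>j<4::nat. \<integral>u. c j * f j u \<partial>N j) \<le> (\<Sum>j<4::nat. cmod (c j) * measure (N j) UNIV * b)"
    by (rule order_trans[OF norm_sum sum_mono]) (intro integral_bound assms)
  then show ?thesis by (simp add: mass_def sum_distrib_right)
qed

private lemma cinner_damped_le: "cmod (cinner (damped 0 u x) y) \<le> M * norm x * norm y"
  using cinner_cauchy_schwarz[of "damped 0 u x" y] mult_right_mono[OF norm_damped_le[of 0 u x], of "norm y"] by simp

private lemma norm_measure_transform: "norm (measure_transform x) \<le> mass * M * norm x"
proof (rule norm_le_of_cinner)
  show "cmod (cinner (measure_transform x) y) \<le> mass * M * norm x * norm y" for y
    unfolding cinner_measure_transform using integral_bound_sum[OF cinner_damped_le, of "\<lambda>_ u. u"] by (simp add: mult_ac)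
  show "0 \<le> mass * M * norm x" using mass_nonneg M1 by simp
qed

private lemma cinner_T_measure_transform:
  assumes a: "0 \<le> a"
  shows "cinner (T a (measure_transform x)) y = (\<Sum>j<4::nat. \<integral>u. c j * cinner (damped 0 (a + u) x) y \<partial>N j)"
proof -
  have "T a (measure_transform x) = (\<Sum>j<4::nat. T a (vint (N j) (\<lambda>_. c j) (\<lambda>s. damped 0 s x)))"
    unfolding measure_transform_def by (rule linear_sum[OF bounded_linear.linear[OF T_linear[OF a]]])
  then have "cinner (T a (measure_transform x)) y = (\<Sum>j<4::nat. cinner (T a (vint (N j) (\<lambda>_. c j) (\<lambda>s. damped 0 s x))) y)"
    by (simp add: cinner.sum_left)
  also have "\<dots> = (\<Sum>j<4::nat. \<integral>u. c j * cinner (damped 0 (a + u) x) y \<partial>N j)"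
  proof (intro sum.cong refl)
    fix j
    have tm: "tame (\<lambda>s. T a (damped 0 s x))" by (rule tame_linear[OF T_linear[OF a] tame_damped[OF order_refl]])
    have meas: "(\<lambda>u. cinner (damped 0 (a + u) x) y) \<in> borel_measurable (N j)"
      using tame_borel_measurable[OF tame_linear[OF cinner.bounded_linear_left tame_shift[OF tame_damped]], of 0]
        N_sets[of j] by (simp cong: measurable_cong_sets)
    have meas': "(\<lambda>u. cinner (T a (damped 0 u x)) y) \<in> borel_measurable (N j)"
      using tame_borel_measurable[OF tame_linear[OF cinner.bounded_linear_left tm]]
        N_sets[of j] by (simp cong: measurable_cong_sets)
    have "cinner (T a (vint (N j) (\<lambda>_. c j) (\<lambda>s. damped 0 s x))) y = (\<integral>u. c j * cinner (T a (damped 0 u x)) y \<partial>N j)"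
      by (subst vint_linear[OF N_sets c_int tame_damped T_clinear[OF a]], simp)
         (rule cinner_vint[OF N_sets c_int tm])
    also have "\<dots> = (\<integral>u. c j * cinner (damped 0 (a + u) x) y \<partial>N j)"
    proof (rule integral_cong_AE)
      show "AE u in N j. c j * cinner (T a (damped 0 u x)) y = c j * cinner (damped 0 (a + u) x) y"
        using N_pos[of j] by eventually_elim (simp add: T_damped[OF a])
    qed (use meas meas' in simp_all)
    finally show "cinner (T a (vint (N j) (\<lambda>_. c j) (\<lambda>s. damped 0 s x))) y
      = (\<integral>u. c j * cinner (damped 0 (a + u) x) y \<partial>N j)" .
  qed
  finally show ?thesis .
qed

private definition fourier_sum where
  "fourier_sum \<xi> = (\<Sum>j<4::nat. \<integral>u. c j * wave \<xi> u \<partial>N j)"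

context
  fixes P :: "real \<Rightarrow> complex"
  assumes P: "integrable lborel P"
begin

text \<open>
  The convolution of the measure with \<open>P\<close>, written as a correlation with the shift \<open>u \<mapsto> - u\<close>.
\<close>

definition mollified where "mollified v = (\<Sum>j<4::nat. \<integral>u. c j * P (v + - u) \<partial>N j)"

lemma mollified_integrable: "integrable lborel mollified"
  unfolding mollified_def
  by (intro Bochner_Integration.integrable_sum convolution_integrable_snd N_sets c_int P
      finite_measure.axioms(1) fin) auto

lemma fourier_mollified: "fourier mollified \<xi> = fourier_sum \<xi> * fourier P \<xi>"
proof -
  have int: "integrable lborel (\<lambda>v. \<integral>u. c j * P (v + - u) \<partial>N j)" for j
    by (intro convolution_integrable_snd N_sets c_int P finite_measure.axioms(1) fin) auto
  have E_int: "integrable lborel (\<lambda>t. wave \<xi> t * h t)"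
    if "integrable lborel h" for h
    by (rule Bochner_Integration.integrable_bound[OF that]) (use that in \<open>auto simp: norm_mult norm_exp_eq_Re\<close>)
  have "fourier mollified \<xi> = (\<integral>t. (\<Sum>j<4::nat. wave \<xi> t * (\<integral>u. c j * P (t + - u) \<partial>N j)) \<partial>lborel)"
    unfolding fourier_def mollified_def sum_distrib_left ..
  also have "\<dots> = (\<Sum>j<4::nat. fourier (\<lambda>v. \<integral>u. c j * P (v + - u) \<partial>N j) \<xi>)"
    unfolding fourier_def by (rule Bochner_Integration.integral_sum) (rule E_int[OF int])
  also have "\<dots> = (\<Sum>j<4::nat. (\<integral>u. c j * exp (\<i> * complex_of_real \<xi> * complex_of_real (- u)) \<partial>N j) * fourier P \<xi>)"
    by (intro sum.cong refl convolution_fourier N_sets c_int P finite_measure.axioms(1) fin) auto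
  finally show ?thesis by (simp add: fourier_sum_def sum_distrib_right)
qed

text \<open>
  The semigroup law would give equality, but the product \<open>T(t + v) T(u)\<close> vanishes for \<open>t + v < 0\<close>, and
  \<open>T(t + v + u)\<close> need not. Only values of \<open>P\<close> below \<open>-t\<close> are affected.
\<close>

lemma convolution_defect:
  assumes t: "0 \<le> t"
  shows "norm (vint lborel P (\<lambda>s. damped 0 (t + s) (measure_transform x)) - vint lborel mollified (\<lambda>s. damped 0 (t + s) x))
    \<le> tail P t * (mass * M * norm x)"
proof (rule norm_le_of_cinner)
  fix y
  define b where "b v = cinner (damped 0 (t + v) x) y" for v
  define h where "h v = (\<Sum>j<4::nat. \<integral>u. c j * b (v + u) \<partial>N j)" for v
  have tm: "tame (\<lambda>s. damped 0 (t + s) z)" for z by (rule tame_shift[OF tame_damped[OF order_refl]])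
  have b_meas [measurable]: "b \<in> borel_measurable borel"
    unfolding b_def by (rule tame_borel_measurable[OF tame_linear[OF cinner.bounded_linear_left tm]])
  have b_le: "cmod (b v) \<le> M * norm x * norm y" for v unfolding b_def by (rule cinner_damped_le)
  have h_le: "cmod (h v) \<le> mass * (M * norm x * norm y)" for v
    unfolding h_def by (rule integral_bound_sum[OF b_le])
  have tail_int: "integrable lborel (\<lambda>s. indicator {..<-t} s * cmod (P s))"
    using integrable_mult_indicator[of "{..<-t}" lborel "\<lambda>s. cmod (P s)"] P by auto
  have pair: "(\<integral>v. b v * (\<integral>u. c j * P (v + - u) \<partial>N j) \<partial>lborel) = (\<integral>v. P v * (\<integral>u. c j * b (v + u) \<partial>N j) \<partial>lborel)"
    "integrable lborel (\<lambda>v. P v * (\<integral>u. c j * b (v + u) \<partial>N j))" for j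
    using convolution_pairing'[OF finite_measure.axioms(1)[OF fin] N_sets c_int P _ b_meas b_le, of uminus j] by auto
  have bc_int: "integrable lborel (\<lambda>v. b v * (\<integral>u. c j * P (v + - u) \<partial>N j))" for j
  proof (rule Bochner_Integration.integrable_bound)
    show "integrable lborel (\<lambda>v. complex_of_real (M * norm x * norm y) * (\<integral>u. c j * P (v + - u) \<partial>N j))"
      by (intro integrable_mult_right convolution_integrable_snd N_sets c_int P finite_measure.axioms(1) fin) auto
    then show "(\<lambda>v. b v * (\<integral>u. c j * P (v + - u) \<partial>N j)) \<in> borel_measurable lborel"
      using convolution_integrable_snd[OF finite_measure.axioms(1)[OF fin] N_sets c_int P, of uminus j] by auto
    show "AE v in lborel. norm (b v * (\<integral>u. c j * P (v + - u) \<partial>N j))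
        \<le> norm (complex_of_real (M * norm x * norm y) * (\<integral>u. c j * P (v + - u) \<partial>N j))"
      using b_le M1 by (intro AE_I2) (simp add: norm_mult mult_right_mono abs_mult)
  qed
  have "cinner (vint lborel mollified (\<lambda>s. damped 0 (t + s) x)) y = (\<integral>v. mollified v * b v \<partial>lborel)"
    unfolding b_def by (rule cinner_vint[OF _ mollified_integrable tm]) auto
  also have "\<dots> = (\<integral>v. (\<Sum>j<4::nat. b v * (\<integral>u. c j * P (v + - u) \<partial>N j)) \<partial>lborel)"
    by (simp add: mollified_def sum_distrib_left mult.commute)
  also have "\<dots> = (\<Sum>j<4::nat. \<integral>v. b v * (\<integral>u. c j * P (v + - u) \<partial>N j) \<partial>lborel)"
    by (rule Bochner_Integration.integral_sum) (rule bc_int)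
  also have "\<dots> = (\<Sum>j<4::nat. \<integral>v. P v * (\<integral>u. c j * b (v + u) \<partial>N j) \<partial>lborel)"
    by (simp only: pair(1))
  also have "\<dots> = (\<integral>v. (\<Sum>j<4::nat. P v * (\<integral>u. c j * b (v + u) \<partial>N j)) \<partial>lborel)"
    by (rule Bochner_Integration.integral_sum[symmetric]) (rule pair(2))
  finally have 1: "cinner (vint lborel mollified (\<lambda>s. damped 0 (t + s) x)) y = (\<integral>v. P v * h v \<partial>lborel)"
    by (simp add: h_def sum_distrib_left)
  have Ph_int: "integrable lborel (\<lambda>v. P v * h v)"
    unfolding h_def sum_distrib_left by (intro Bochner_Integration.integrable_sum pair(2))
  have 2: "cinner (vint lborel P (\<lambda>s. damped 0 (t + s) (measure_transform x))) y = (\<integral>v. P v * cinner (damped 0 (t + v) (measure_transform x)) y \<partial>lborel)"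
    by (rule cinner_vint[OF _ P tm]) auto
  have 3: "cinner (damped 0 (t + v) (measure_transform x)) y = (if 0 \<le> t + v then h v else 0)" for v
    using cinner_T_measure_transform[of "t + v" x y] by (auto simp: damped_def h_def b_def add.assoc cinner.zero_left)
  have "cinner (vint lborel P (\<lambda>s. damped 0 (t + s) (measure_transform x)) - vint lborel mollified (\<lambda>s. damped 0 (t + s) x)) y
    = (\<integral>v. P v * cinner (damped 0 (t + v) (measure_transform x)) y - P v * h v \<partial>lborel)"
    unfolding cinner.diff_left 1 2
    by (rule Bochner_Integration.integral_diff[symmetric, OF integrable_weighted_cinner[OF _ P tm] Ph_int]) auto
  also have "cmod \<dots> \<le> (\<integral>v. (indicator {..<-t} v * cmod (P v)) * (mass * (M * norm x * norm y)) \<partial>lborel)"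
  proof (rule Bochner_Integration.integral_norm_bound_integral)
    show "integrable lborel (\<lambda>v. P v * cinner (damped 0 (t + v) (measure_transform x)) y - P v * h v)"
      by (rule Bochner_Integration.integrable_diff[OF integrable_weighted_cinner[OF _ P tm] Ph_int]) auto
    show "integrable lborel (\<lambda>v. (indicator {..<-t} v * cmod (P v)) * (mass * (M * norm x * norm y)))"
      by (rule integrable_mult_left) (rule tail_int)
    show "cmod (P v * cinner (damped 0 (t + v) (measure_transform x)) y - P v * h v) \<le> (indicator {..<-t} v * cmod (P v)) * (mass * (M * norm x * norm y))" for v
      unfolding 3 using h_le[of v] by (auto simp: indicator_def norm_mult mult_left_mono)
  qed
  also have "\<dots> = tail P t * (mass * M * norm x) * norm y"
    unfolding integral_mult_left_zero tail_def by (simp add: mult_ac)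
  finally show "cmod (cinner (vint lborel P (\<lambda>s. damped 0 (t + s) (measure_transform x)) - vint lborel mollified (\<lambda>s. damped 0 (t + s) x)) y)
    \<le> tail P t * (mass * M * norm x) * norm y" .
qed (use mass_nonneg M1 in \<open>auto simp: tail_def intro!: mult_nonneg_nonneg integral_nonneg_AE\<close>)

end

text \<open>
  The operator \<open>T(t) \<mu>(T)\<close> is split into four parts, each of norm at most \<open>e / 4\<close> for
  large \<open>t\<close>: high frequencies, the defect of the semigroup law, the error of spectral synthesis,
  and a function whose transform vanishes near \<open>E\<close>.
\<close>

theorem katznelson_tzafriri:
  assumes \<eta>: "0 < \<eta>" and K: "0 < K"
    and high: "\<And>s v. \<eta> \<le> \<bar>s\<bar> \<Longrightarrow> v \<in> D \<Longrightarrow> norm v \<le> K * norm (axis_shift s v)"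
    and low: "\<And>U. open U \<Longrightarrow> E \<subseteq> U \<Longrightarrow>
      \<exists>K>0. \<forall>s v. - s \<notin> U \<longrightarrow> v \<in> D \<longrightarrow> norm v \<le> K * norm (axis_shift s v)"
    and synth: "spectral_synthesis E"
    and zero: "\<And>\<xi>. \<xi> \<in> E \<Longrightarrow>
      (\<Sum>j<4::nat. \<integral>u. c j * wave \<xi> u \<partial>N j) = 0"
    and e: "0 < e"
  shows "\<forall>\<^sub>F t in at_top. \<forall>x. norm (T t (measure_transform x)) \<le> e * norm x"
proof -
  define P where "P = dilated_kernel \<eta>"
  have P: "integrable lborel P" unfolding P_def by (rule dilated_kernel_integrable[OF \<eta>])
  have "\<forall>\<xi>\<in>E. fourier (mollified P) \<xi> = 0"
    using zero by (simp add: fourier_mollified[OF P] fourier_sum_def)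
  moreover have "integrable lborel (mollified P) \<longrightarrow> (\<forall>\<xi>\<in>E. fourier (mollified P) \<xi> = 0) \<longrightarrow>
      (\<exists>g :: nat \<Rightarrow> real \<Rightarrow> complex. (\<forall>n. integrable lborel (g n)) \<and>
        (\<lambda>n. \<integral>t. cmod (mollified P t - g n t) \<partial>lborel) \<longlonglongrightarrow> 0 \<and>
        (\<forall>n. \<exists>U. open U \<and> E \<subseteq> U \<and> (\<forall>\<xi>\<in>U. fourier (g n) \<xi> = 0)))"
    using synth unfolding spectral_synthesis_def by (elim conjE allE)
  ultimately have "\<exists>g :: nat \<Rightarrow> real \<Rightarrow> complex. (\<forall>n. integrable lborel (g n)) \<and>
        (\<lambda>n. \<integral>t. cmod (mollified P t - g n t) \<partial>lborel) \<longlonglongrightarrow> 0 \<and>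
        (\<forall>n. \<exists>U. open U \<and> E \<subseteq> U \<and> (\<forall>\<xi>\<in>U. fourier (g n) \<xi> = 0))"
    using mollified_integrable[OF P] by blast
  then obtain g :: "nat \<Rightarrow> real \<Rightarrow> complex" where g: "\<And>n. integrable lborel (g n)"
    "(\<lambda>n. \<integral>t. cmod (mollified P t - g n t) \<partial>lborel) \<longlonglongrightarrow> 0"
    "\<And>n. \<exists>U. open U \<and> E \<subseteq> U \<and> (\<forall>\<xi>\<in>U. fourier (g n) \<xi> = 0)"
    by (elim exE conjE) blast
  have "(\<lambda>n. (\<integral>t. cmod (mollified P t - g n t) \<partial>lborel) * M) \<longlonglongrightarrow> 0 * M"
    by (intro tendsto_intros g(2))
  then have "\<forall>\<^sub>F n in sequentially. (\<integral>t. cmod (mollified P t - g n t) \<partial>lborel) * M < e / 4"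
    by (rule order_tendstoD(2)) (use e in simp)
  then obtain n where n: "(\<integral>t. cmod (mollified P t - g n t) \<partial>lborel) * M < e / 4"
    by (auto simp: eventually_sequentially)
  obtain U where "open U \<and> E \<subseteq> U \<and> (\<forall>\<xi>\<in>U. fourier (g n) \<xi> = 0)"
    using g(3)[of n] by (rule exE)
  then have U: "open U" "E \<subseteq> U" "\<And>\<xi>. \<xi> \<in> U \<Longrightarrow> fourier (g n) \<xi> = 0" by simp_all
  obtain Kn where Kn: "0 < Kn"
    "\<And>s v. - s \<notin> U \<Longrightarrow> v \<in> D \<Longrightarrow> norm v \<le> Kn * norm (axis_shift s v)"
    using low[OF U(1,2)] by (elim exE conjE) simp
  have ev3: "\<forall>\<^sub>F t in at_top. \<forall>x. norm (vint lborel (g n) (\<lambda>s. damped 0 (t + s) x)) \<le> e / 4 * norm x"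
    by (rule multiplier_tendsto[OF g(1) Kn(1)]) (use U(3) Kn(2) e in auto)
  define R where "R t = (3 * (1 + (\<integral>s. \<bar>vp_kernel s\<bar> \<partial>lborel)) * M\<^sup>2 * sqrt (K / (t / 2)) + M * (vp_const / (\<eta> * (t / 2)))) * (mass * M)" for t
  have "(R \<longlongrightarrow> (3 * (1 + (\<integral>s. \<bar>vp_kernel s\<bar> \<partial>lborel)) * M\<^sup>2 * 0 + M * 0) * (mass * M)) at_top"
    unfolding R_def
    by (intro tendsto_intros sqrt_over_tendsto real_tendsto_divide_at_top[OF tendsto_const]
        filterlim_tendsto_pos_mult_at_top[OF tendsto_const \<eta>] half_at_top)
  then have ev1: "\<forall>\<^sub>F t in at_top. R t < e / 4"
    by (rule order_tendstoD(2)) (use e in simp)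
  have "((\<lambda>t. tail P t * (mass * M)) \<longlongrightarrow> 0 * (mass * M)) at_top"
    by (intro tendsto_intros tail_tendsto[OF P])
  then have ev2: "\<forall>\<^sub>F t in at_top. tail P t * (mass * M) < e / 4"
    by (rule order_tendstoD(2)) (use e in simp)
  show ?thesis
    using ev1 ev2 ev3 eventually_gt_at_top[of 0]
  proof eventually_elim
    case (elim t)
    show ?case
    proof
      fix x
      have tm: "tame (\<lambda>s. damped 0 (t + s) x)" by (rule tame_shift[OF tame_damped[OF order_refl]])
      let ?V = "vint lborel P (\<lambda>s. damped 0 (t + s) (measure_transform x))" and ?F = "vint lborel (mollified P) (\<lambda>s. damped 0 (t + s) x)"
        and ?G = "vint lborel (g n) (\<lambda>s. damped 0 (t + s) x)" and ?H = "multiplier 1 (\<lambda>s. - P s) 0 t (measure_transform x)"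
      have "T t (measure_transform x) = ?H + (?V - ?F) + (?F - ?G) + ?G"
        using T_split[OF _ P, of t "measure_transform x"] elim by simp
      then have "norm (T t (measure_transform x)) \<le> norm ?H + norm (?V - ?F) + norm (?F - ?G) + norm ?G"
        using norm_triangle_ineq[of "?H + (?V - ?F) + (?F - ?G)" ?G]
          norm_triangle_ineq[of "?H + (?V - ?F)" "?F - ?G"] norm_triangle_ineq[of ?H "?V - ?F"] by simp
      moreover have "norm ?H \<le> e / 4 * norm x"
      proof -
        have "norm (multiplier 1 (\<lambda>s. - dilated_kernel \<eta> s) 0 (2 * (t / 2)) (measure_transform x))
          \<le> (3 * (1 + (\<integral>s. \<bar>vp_kernel s\<bar> \<partial>lborel)) * M\<^sup>2 * sqrt (K / (t / 2)) + M * (vp_const / (\<eta> * (t / 2)))) * norm (measure_transform x)"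
          by (rule high_frequency_decay[OF \<eta> K]) (use elim high in auto)
        also have "\<dots> \<le> (3 * (1 + (\<integral>s. \<bar>vp_kernel s\<bar> \<partial>lborel)) * M\<^sup>2 * sqrt (K / (t / 2)) + M * (vp_const / (\<eta> * (t / 2)))) * (mass * M * norm x)"
          using elim K \<eta> vp_const_pos M1 by (intro mult_left_mono norm_measure_transform add_nonneg_nonneg mult_nonneg_nonneg) (auto intro!: integral_nonneg_AE)
        also have "\<dots> = R t * norm x" by (simp add: R_def)
        also have "\<dots> \<le> e / 4 * norm x" using elim by (intro mult_right_mono) auto
        finally show ?thesis by (simp add: P_def)
      qed
      moreover have "norm (?V - ?F) \<le> e / 4 * norm x"
      proof -
        have "norm (?V - ?F) \<le> tail P t * (mass * M * norm x)"
          by (rule convolution_defect[OF P]) (use elim in auto)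
        also have "\<dots> = (tail P t * (mass * M)) * norm x" by simp
        also have "\<dots> \<le> e / 4 * norm x" using elim by (intro mult_right_mono) auto
        finally show ?thesis .
      qed
      moreover have "norm (?F - ?G) \<le> e / 4 * norm x"
      proof -
        have "norm (?F - ?G) \<le> (\<integral>s. cmod (mollified P s - g n s) \<partial>lborel) * (M * norm x)"
          unfolding vint_diff_weight[OF sets_lborel mollified_integrable[OF P] g(1) tm]
          by (rule norm_vint_damped) (use mollified_integrable[OF P] g(1) in auto)
        also have "\<dots> = ((\<integral>s. cmod (mollified P s - g n s) \<partial>lborel) * M) * norm x" by simp
        also have "\<dots> \<le> e / 4 * norm x" using n by (intro mult_right_mono) auto
        finally show ?thesis .
      qed
      moreover have "norm ?G \<le> e / 4 * norm x" using elim by blast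
      ultimately show "norm (T t (measure_transform x)) \<le> e * norm x" by (simp add: field_simps)
    qed
  qed
qed

end

end

section \<open>Rates of decay\<close>

lemma onorm_between:
  fixes f :: "'a::real_normed_vector \<Rightarrow> 'b::real_normed_vector"
  assumes b: "\<And>x. norm (f x) \<le> b * norm x" and "0 \<le> b"
  shows "onorm f \<le> b" "0 \<le> onorm f"
proof -
  show "onorm f \<le> b" by (rule onorm_bound[OF assms(2) b])
  have "bdd_above (range (\<lambda>x. norm (f x) / norm x))"
    using b assms(2) by (auto simp: bdd_above_def divide_le_eq intro!: exI[of _ b])
  then show "0 \<le> onorm f"
    unfolding onorm_def by (rule cSUP_upper2[of _ _ 0]) auto
qed

context bounded_c0_semigroup
begin

text \<open>
  If \<open>w + A w = 0\<close> then \<open>T(t) w = e\<^sup>t w\<close>, which is unbounded unless \<open>w = 0\<close>.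
\<close>

lemma shift_one_injective:
  assumes "u \<in> D" "v \<in> D" "1 *\<^sub>C u + A u = 1 *\<^sub>C v + A v"
  shows "u = v"
proof -
  define w where "w = u - v"
  have w: "w \<in> D" "1 *\<^sub>C w + A w = 0"
  proof -
    show "w \<in> D" unfolding w_def by (rule D_diff(1)[OF assms(1,2)])
    have "1 *\<^sub>C w + A w = (1 *\<^sub>C u + A u) - (1 *\<^sub>C v + A v)"
      unfolding w_def D_diff(2)[OF assms(1,2)] scaleC.diff_right by simp
    then show "1 *\<^sub>C w + A w = 0" using assms(3) by simp
  qed
  have le: "norm w \<le> exp (- t) * (M * norm w)" if t: "0 \<le> t" for t
  proof -
    have "exp (- (1 * complex_of_real t)) *\<^sub>C T t w = w"
      using T_exp_bound[OF w(1), of 1 t] t w(2) by simp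
    then have "norm w = norm (exp (- (1 * complex_of_real t)) *\<^sub>C T t w)" by simp
    also have "\<dots> = exp (- t) * norm (T t w)" by (simp add: norm_scaleC norm_exp_eq_Re)
    also have "\<dots> \<le> exp (- t) * (M * norm w)" by (intro mult_left_mono norm_T t) simp
    finally show ?thesis .
  qed
  have "((\<lambda>t. exp (- t) * (M * norm w)) \<longlongrightarrow> 0) at_top" by real_asymp
  moreover have "\<forall>\<^sub>F t in at_top. norm w \<le> exp (- t) * (M * norm w)"
    using eventually_ge_at_top[of 0] by eventually_elim (rule le)
  ultimately have "norm w \<le> 0"
    by (intro tendsto_le[OF _ _ tendsto_const]) auto
  then show ?thesis by (simp add: w_def)
qed

lemma shift_inverse_one: "shift_inverse D A 1 x = laplace 1 x"
  unfolding shift_inverse_def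
proof (rule inv_into_f_eq)
  show "inj_on (\<lambda>x. 1 *\<^sub>C x + A x) D" by (rule inj_onI) (rule shift_one_injective)
qed (use laplace_resolvent[of 1 x] in auto)

lemma A_laplace_one: "A (laplace 1 x) = x - laplace 1 x"
  using laplace_resolvent(2)[of 1 x] by (simp add: scaleC_one algebra_simps)

lemma A_eq_laplace:
  assumes "y \<in> D" shows "A y = A (laplace 1 (y + A y))"
proof -
  have "laplace 1 (y + A y) = y"
    by (rule shift_one_injective) (use assms laplace_resolvent[of 1 "y + A y"] in \<open>auto simp: scaleC_one\<close>)
  then show ?thesis by simp
qed

lemma laplace_one_kernel: "integrable lborel (\<lambda>t. laplace_kernel 1 t)"
  by (rule integrable_laplace_kernel) simp

lemma norm_laplace_one: "norm (laplace 1 x) \<le> M * norm x"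
proof -
  have "norm (laplace 1 x) \<le> (\<integral>t. cmod (laplace_kernel 1 t) * norm (damped 0 t x) \<partial>lborel)"
    unfolding laplace_def by (rule norm_vint_le[OF _ laplace_one_kernel tame_damped]) auto
  also have "\<dots> \<le> (\<integral>t. exp_decay 1 t * (M * norm x) \<partial>lborel)"
  proof (rule integral_mono)
    show "integrable lborel (\<lambda>t. cmod (laplace_kernel 1 t) * norm (damped 0 t x))"
      by (rule integrable_weighted_norm[OF _ laplace_one_kernel tame_damped]) auto
    show "integrable lborel (\<lambda>t. exp_decay 1 t * (M * norm x))"
      using integral_exp_decay(1)[of 1] by (intro integrable_mult_left) auto
    show "cmod (laplace_kernel 1 t) * norm (damped 0 t x)
        \<le> exp_decay 1 t * (M * norm x)" for t
      using norm_damped_le[of 0 t x] by (auto simp: norm_exp_eq_Re)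
  qed
  also have "\<dots> = M * norm x"
    unfolding integral_mult_left_zero using integral_exp_decay(2)[of 1] by simp
  finally show ?thesis .
qed

lemma laplace_one_linear: "bounded_linear (laplace 1)"
proof (rule bounded_linear_intro)
  have ci: "integrable lborel (\<lambda>t. laplace_kernel 1 t * cinner (damped 0 t x) w)" for x w
    by (rule integrable_weighted_cinner[OF _ laplace_one_kernel tame_damped]) auto
  show "laplace 1 (x + y) = laplace 1 x + laplace 1 y" for x y
  proof (rule cinner_ext)
    fix w
    have "cinner (laplace 1 (x + y)) w = (\<integral>t. laplace_kernel 1 t * cinner (damped 0 t x) w
       + laplace_kernel 1 t * cinner (damped 0 t y) w \<partial>lborel)"
      by (subst cinner_laplace)
        (simp_all add: linear_add[OF bounded_linear.linear[OF damped_linear]] cinner.add_left distrib_left)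
    also have "\<dots> = cinner (laplace 1 x + laplace 1 y) w"
      by (subst Bochner_Integration.integral_add[OF ci ci]) (simp add: cinner.add_left cinner_laplace)
    finally show "cinner (laplace 1 (x + y)) w = cinner (laplace 1 x + laplace 1 y) w" .
  qed
  show "laplace 1 (r *\<^sub>R x) = r *\<^sub>R laplace 1 x" for r x
  proof (rule cinner_ext)
    fix w
    have damped_r: "cinner (damped 0 t (r *\<^sub>R x)) w = complex_of_real r * cinner (damped 0 t x) w" for t
      by (simp add: linear_scale[OF bounded_linear.linear[OF damped_linear]] cinner_scaleR_left scaleR_conv_of_real)
    show "cinner (laplace 1 (r *\<^sub>R x)) w = cinner (r *\<^sub>R laplace 1 x) w"
      by (simp only: cinner_laplace damped_r mult.left_commute[of _ "complex_of_real r"] integral_mult_right_zero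
          cinner_scaleR_left scaleR_conv_of_real one_complex.sel zero_less_one)
  qed
  show "norm (laplace 1 x) \<le> norm x * M" for x
    using norm_laplace_one[of x] by (simp add: mult.commute)
qed

lemma T_A_laplace_linear: "0 \<le> t \<Longrightarrow> bounded_linear (\<lambda>x. T t (A (laplace 1 x)))"
  unfolding A_laplace_one
  by (intro bounded_linear_compose[OF T_linear] bounded_linear_sub bounded_linear_ident laplace_one_linear)

lemma T_multiplier:
  assumes g: "integrable lborel g" and s: "0 \<le> s"
  shows "T s (multiplier c g 0 t x) = multiplier c g 0 t (T s x)"
  unfolding multiplier_def
  using s by (simp add: linear_add[OF bounded_linear.linear[OF T_linear]] T_scaleC T_damped_commute
      vint_linear[OF sets_lborel g tame_shift[OF tame_damped[OF order_refl]] T_clinear])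

text \<open>
  Each application of \<open>T(2t)\<close> is split into its high and low frequency parts. The high frequency part
  contributes a factor \<open>\<omega>\<close>, the low frequency part an additive error of order \<open>r\<close>, which is not
  amplified later because the semigroup is bounded.
\<close>

lemma iterated_decay:
  assumes r: "0 < r" and K: "0 < K" and t: "0 < t"
    and high: "\<And>s v. r \<le> \<bar>s\<bar> \<Longrightarrow> v \<in> D \<Longrightarrow> norm v \<le> K * norm (axis_shift s v)"
    and \<omega>: "3 * (1 + (\<integral>s. \<bar>vp_kernel s\<bar> \<partial>lborel)) * M\<^sup>2 * sqrt (K / t) + M * (vp_const / (r * t)) \<le> \<omega>" "0 \<le> \<omega>" "\<omega> \<le> 1"
  shows "norm (T (real n * (2 * t)) (A (laplace 1 x)))
    \<le> (\<omega> ^ n * (1 + M) + real n * (6 * vp_const * M ^ 3 * r)) * norm x"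
proof (induction n)
  case 0
  have "norm (A (laplace 1 x)) \<le> norm x + norm (laplace 1 x)"
    unfolding A_laplace_one by (rule norm_triangle_ineq4)
  then show ?case using norm_laplace_one[of x] by (simp add: algebra_simps)
next
  case (Suc n)
  let ?z = "A (laplace 1 x)" and ?s = "real n * (2 * t)" and ?E = "6 * vp_const * M ^ 3 * r"
  let ?V = "vint lborel (dilated_kernel r) (\<lambda>s. damped 0 (2 * t + s) ?z)"
  have s: "0 \<le> ?s" using t by simp
  have int: "integrable lborel (\<lambda>s. - dilated_kernel r s)" using dilated_kernel_integrable[OF r] by simp
  have "T (real (Suc n) * (2 * t)) ?z = T ?s (T (2 * t) ?z)"
    using T_add[of ?s "2 * t" ?z] t by (simp add: algebra_simps)
  also have "T (2 * t) ?z = multiplier 1 (\<lambda>s. - dilated_kernel r s) 0 (2 * t) ?z + ?V"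
    using t by (intro T_split dilated_kernel_integrable r) simp
  also have "T ?s (multiplier 1 (\<lambda>s. - dilated_kernel r s) 0 (2 * t) ?z + ?V) = multiplier 1 (\<lambda>s. - dilated_kernel r s) 0 (2 * t) (T ?s ?z) + T ?s ?V"
    by (simp add: linear_add[OF bounded_linear.linear[OF T_linear[OF s]]] T_multiplier[OF int s])
  finally have "norm (T (real (Suc n) * (2 * t)) ?z)
      \<le> norm (multiplier 1 (\<lambda>s. - dilated_kernel r s) 0 (2 * t) (T ?s ?z)) + norm (T ?s ?V)"
    by (simp add: norm_triangle_ineq)
  also have "norm (multiplier 1 (\<lambda>s. - dilated_kernel r s) 0 (2 * t) (T ?s ?z)) \<le> \<omega> * norm (T ?s ?z)"
    by (rule order_trans[OF high_frequency_decay[OF r K t high] mult_right_mono[OF \<omega>(1)]]) simp_all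
  also have "\<omega> * norm (T ?s ?z) \<le> \<omega> * ((\<omega> ^ n * (1 + M) + real n * ?E) * norm x)"
    using Suc.IH \<omega>(2) by (rule mult_left_mono)
  also have "norm (T ?s ?V) \<le> ?E * norm x"
  proof -
    have "norm (T ?s ?V) \<le> M * norm ?V" by (rule norm_T[OF s])
    also have "\<dots> \<le> M * (6 * vp_const * M * r * norm (laplace 1 x))"
      using t M1 by (intro mult_left_mono dilated_kernel_generator_bound r laplace_resolvent(1)) auto
    also have "\<dots> \<le> M * (6 * vp_const * M * r * (M * norm x))"
      using M1 r vp_const_pos by (intro mult_left_mono norm_laplace_one) auto
    finally show ?thesis by (simp add: power3_eq_cube mult_ac)
  qed
  also have "\<omega> * ((\<omega> ^ n * (1 + M) + real n * ?E) * norm x) + ?E * norm x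
    \<le> (\<omega> ^ Suc n * (1 + M) + real (Suc n) * ?E) * norm x"
  proof -
    have "\<omega> * (real n * ?E) \<le> 1 * (real n * ?E)"
      using \<omega>(3) vp_const_pos M1 r by (intro mult_right_mono) auto
    then have "\<omega> * (\<omega> ^ n * (1 + M) + real n * ?E) + ?E \<le> \<omega> ^ Suc n * (1 + M) + real (Suc n) * ?E"
      by (simp add: algebra_simps)
    then have "(\<omega> * (\<omega> ^ n * (1 + M) + real n * ?E) + ?E) * norm x \<le> (\<omega> ^ Suc n * (1 + M) + real (Suc n) * ?E) * norm x"
      by (rule mult_right_mono) simp
    then show ?thesis by (simp add: algebra_simps)
  qed
  finally show ?case by simp
qed

context
  fixes m minv :: "real \<Rightarrow> real"
  assumes growth: "\<And>s r v. 0 < s \<Longrightarrow> s \<le> \<bar>r\<bar> \<Longrightarrow> v \<in> D \<Longrightarrow> norm v \<le> m s * norm (axis_shift r v)"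
    and least: "\<And>s b. 0 < s \<Longrightarrow> 0 \<le> b \<Longrightarrow>
      (\<And>r v. s \<le> \<bar>r\<bar> \<Longrightarrow> v \<in> D \<Longrightarrow> norm v \<le> b * norm (axis_shift r v)) \<Longrightarrow> m s \<le> b"
    and anti: "\<And>s s'. 0 < s \<Longrightarrow> s \<le> s' \<Longrightarrow> m s' \<le> m s"
    and lim: "filterlim (\<lambda>s. s * m s) at_top (at_right 0)"
    and inv: "eventual_right_inverse m minv"
begin

private lemma minv_small:
  assumes "0 < \<delta>"
  shows "\<forall>\<^sub>F t in at_top. 0 < minv t \<and> minv t < \<delta> \<and> m (minv t) = t"
  using inv[unfolded eventual_right_inverse_def] eventually_gt_at_top[of "m \<delta>"]
proof eventually_elim
  case (elim t)
  then have "\<not> \<delta> \<le> minv t" using anti[OF assms, of "minv t"] by auto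
  with elim show ?case by auto
qed

private lemma lim_ge: obtains \<delta> where "0 < \<delta>" "\<And>s. 0 < s \<Longrightarrow> s < \<delta> \<Longrightarrow> L \<le> s * m s"
proof -
  have "\<forall>\<^sub>F s in at_right 0. L \<le> s * m s" using lim by (simp add: filterlim_at_top)
  then show thesis unfolding eventually_at_right_field using that by auto
qed

text \<open>
  If the decay were faster, the estimate of \<open>y\<close> by Duhamel's formula would hold for all frequencies
  \<open>|s| \<ge> \<rho>\<close> with \<open>\<rho> = m\<^sup>-\<^sup>1(8 M t)\<close>, and would give \<open>m(\<rho>) \<le> 4 M t\<close>.
\<close>

lemma lower_rate:
  "\<forall>\<^sub>F t in at_top. \<forall>n\<ge>0. (\<forall>x. norm (T t (A (laplace 1 x))) \<le> n * norm x) \<longrightarrow> minv (8 * M * t) \<le> 4 * n"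
proof -
  obtain \<delta> where \<delta>: "0 < \<delta>" "\<And>s. 0 < s \<Longrightarrow> s < \<delta> \<Longrightarrow> 4 * (M + 1) \<le> s * m s"
    by (rule lim_ge[of "4 * (M + 1)"]) blast
  have "filterlim (\<lambda>t. 8 * M * t) at_top at_top"
    using M1 by (intro filterlim_tendsto_pos_mult_at_top[OF tendsto_const _ filterlim_ident]) auto
  from eventually_compose_filterlim[OF minv_small[of "min \<delta> 1"] this] \<delta>(1)
  have "\<forall>\<^sub>F t in at_top. 0 < minv (8 * M * t) \<and> minv (8 * M * t) < min \<delta> 1 \<and> m (minv (8 * M * t)) = 8 * M * t"
    by simp
  then show ?thesis using eventually_gt_at_top[of 0]
  proof eventually_elim
    case (elim t)
    show ?case
    proof (intro allI impI, rule ccontr)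
      fix n :: real
      assume n: "0 \<le> n" "\<forall>x. norm (T t (A (laplace 1 x))) \<le> n * norm x" and "\<not> minv (8 * M * t) \<le> 4 * n"
      define \<rho> where "\<rho> = minv (8 * M * t)"
      have \<rho>: "0 < \<rho>" "\<rho> < \<delta>" "\<rho> < 1" "m \<rho> = 8 * M * t" "4 * n < \<rho>"
        using elim \<open>\<not> _\<close> by (auto simp: \<rho>_def)
      have t: "0 < t" using elim by simp
      have "m \<rho> \<le> 2 * M * t + 2 * (M + 1) / \<rho>"
      proof (rule least[OF \<rho>(1)])
        show "0 \<le> 2 * M * t + 2 * (M + 1) / \<rho>" using M1 t \<rho>(1) by simp
        fix s y assume s: "\<rho> \<le> \<bar>s\<bar>" and y: "y \<in> D"
        define x where "x = (\<i> * complex_of_real s) *\<^sub>C y + A y"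
        have s0: "0 < \<bar>s\<bar>" using s \<rho>(1) by linarith
        have "norm (exp (- ((\<i> * complex_of_real s) * complex_of_real t)) *\<^sub>C T t y - y) \<le> M * t * norm x"
          unfolding x_def by (rule T_exp_bound[OF y]) (use t in auto)
        moreover have "norm (exp (- ((\<i> * complex_of_real s) * complex_of_real t)) *\<^sub>C T t y) = norm (T t y)"
          by (simp add: norm_scaleC norm_exp_eq_Re)
        ultimately have 1: "norm y \<le> norm (T t y) + M * t * norm x"
          using norm_triangle_ineq2[of y "exp (- ((\<i> * complex_of_real s) * complex_of_real t)) *\<^sub>C T t y"]
          by (simp add: norm_minus_commute)
        have "y + A y = x + (1 - \<i> * complex_of_real s) *\<^sub>C y"
          by (simp add: x_def scaleC.diff_left scaleC_one)
        then have "norm (y + A y) \<le> norm x + norm ((1 - \<i> * complex_of_real s) *\<^sub>C y)"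
          by (simp add: norm_triangle_ineq)
        also have "\<dots> \<le> norm x + (1 + \<bar>s\<bar>) * norm y"
          unfolding norm_scaleC using norm_triangle_ineq4[of 1 "\<i> * complex_of_real s"]
          by (intro add_left_mono mult_right_mono) (auto simp: norm_mult)
        finally have "norm (T t (A y)) \<le> n * (norm x + (1 + \<bar>s\<bar>) * norm y)"
          using n(2) A_eq_laplace[OF y] order_trans[OF _ mult_left_mono[OF _ n(1)]] by metis
        moreover have "(\<i> * complex_of_real s) *\<^sub>C T t y = T t x - T t (A y)"
          using t by (simp add: x_def T_scaleC linear_add[OF bounded_linear.linear[OF T_linear]])
        then have "\<bar>s\<bar> * norm (T t y) = norm (T t x - T t (A y))"
          using norm_scaleC[of "\<i> * complex_of_real s" "T t y"] by (simp add: norm_mult)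
        then have "\<bar>s\<bar> * norm (T t y) \<le> norm (T t x) + norm (T t (A y))"
          using norm_triangle_ineq4[of "T t x" "T t (A y)"] by simp
        moreover have "norm (T t x) \<le> M * norm x" using t by (intro norm_T) simp
        ultimately have 2: "\<bar>s\<bar> * norm (T t y) \<le> M * norm x + n * norm x + (n * (1 + \<bar>s\<bar>)) * norm y"
          by (simp add: algebra_simps)
        have "n * (1 + \<bar>s\<bar>) \<le> \<bar>s\<bar> / 2"
        proof -
          have "n * \<bar>s\<bar> \<le> (1 / 4) * \<bar>s\<bar>" using \<rho> by (intro mult_right_mono) auto
          then show ?thesis using \<rho>(5) s by (simp add: algebra_simps)
        qed
        then have "(n * (1 + \<bar>s\<bar>)) * norm y \<le> (\<bar>s\<bar> / 2) * norm y" by (rule mult_right_mono) simp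
        moreover have "n * norm x \<le> 1 * norm x" using \<rho> by (intro mult_right_mono) auto
        moreover have "\<bar>s\<bar> * norm y \<le> \<bar>s\<bar> * norm (T t y) + \<bar>s\<bar> * (M * t * norm x)"
          using mult_left_mono[OF 1, of "\<bar>s\<bar>"] by (simp add: algebra_simps)
        ultimately have "\<bar>s\<bar> * norm y \<le> \<bar>s\<bar> * (2 * (M * t * norm x)) + 2 * (M + 1) * norm x"
          using 2 by (simp add: algebra_simps)
        then have "norm y \<le> 2 * (M * t * norm x) + 2 * (M + 1) * norm x / \<bar>s\<bar>"
          using s0 by (simp add: field_simps)
        also have "\<dots> \<le> 2 * (M * t * norm x) + 2 * (M + 1) * norm x / \<rho>"
          using s \<rho>(1) s0 M1 by (intro add_left_mono divide_left_mono) auto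
        finally show "norm y \<le> (2 * M * t + 2 * (M + 1) / \<rho>) * norm (axis_shift s y)"
          by (simp add: x_def algebra_simps)
      qed
      moreover have "4 * (M + 1) / \<rho> \<le> m \<rho>"
        using \<delta>(2)[OF \<rho>(1,2)] \<rho>(1) by (simp add: field_simps)
      moreover have "4 * (M + 1) / \<rho> = 2 * (2 * (M + 1) / \<rho>)" by simp
      ultimately have "m \<rho> \<le> 4 * M * t" by linarith
      then show False using \<rho>(4) M1 t by simp
    qed
  qed
qed

text \<open>
  The scale is \<open>r = m\<^sup>-\<^sup>1(t\<^sup>1\<^sup>-\<^sup>\<epsilon>)\<close>, for which the high frequency factor over the time \<open>t / k\<close> is
  \<open>O(t\<^sup>-\<^sup>\<epsilon>\<^sup>/\<^sup>2)\<close>; its \<open>k\<close>-th power is at most of order \<open>r\<close>, because \<open>r\<close> is at least \<open>t\<^sup>-\<^sup>(\<^sup>1\<^sup>-\<^sup>\<epsilon>\<^sup>)\<close>.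
\<close>

lemma upper_rate:
  assumes \<epsilon>: "0 < \<epsilon>" "\<epsilon> < 1"
  shows "\<exists>C>0. \<forall>\<^sub>F t in at_top. 0 < minv (t powr (1 - \<epsilon>)) \<and>
    (\<forall>x. norm (T t (A (laplace 1 x))) \<le> C * minv (t powr (1 - \<epsilon>)) * norm x)"
proof -
  \<comment> \<open>The number of factors: \<open>k \<epsilon> / 2 \<ge> 1\<close>.\<close>
  define k where "k = nat \<lceil>2 / \<epsilon>\<rceil>"
  have k: "2 / \<epsilon> \<le> real k" unfolding k_def by linarith
  then have k_pos: "0 < real k" using \<epsilon> by (smt (verit) divide_pos_pos)
  have k\<epsilon>: "2 \<le> real k * \<epsilon>" using k \<epsilon> by (simp add: field_simps)
  define I where "I = 3 * (1 + (\<integral>s. \<bar>vp_kernel s\<bar> \<partial>lborel)) * M\<^sup>2"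
  have I: "0 \<le> I" unfolding I_def by (intro mult_nonneg_nonneg add_nonneg_nonneg integral_nonneg_AE) auto
  define C1 where "C1 = I * sqrt (2 * real k) + 2 * real k * (M * vp_const)"
  have C1: "0 \<le> C1" unfolding C1_def using I M1 vp_const_pos by simp
  define C where "C = C1 ^ k * (1 + M) + real k * (6 * vp_const * M ^ 3)"
  have C: "0 < C" unfolding C_def using C1 M1 vp_const_pos k_pos
    by (intro add_nonneg_pos mult_pos_pos mult_nonneg_nonneg) auto
  obtain \<delta> where \<delta>: "0 < \<delta>" "\<And>s. 0 < s \<Longrightarrow> s < \<delta> \<Longrightarrow> 1 \<le> s * m s"
    by (rule lim_ge[of 1]) blast
  have "filterlim (\<lambda>t. t powr (1 - \<epsilon>)) at_top at_top" using \<epsilon> by real_asymp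
  from eventually_compose_filterlim[OF minv_small[OF \<delta>(1)] this]
  have ev1: "\<forall>\<^sub>F t in at_top. 0 < minv (t powr (1 - \<epsilon>)) \<and> minv (t powr (1 - \<epsilon>)) < \<delta>
      \<and> m (minv (t powr (1 - \<epsilon>))) = t powr (1 - \<epsilon>)" .
  have "((\<lambda>t. C1 * t powr (- \<epsilon> / 2)) \<longlongrightarrow> 0) at_top" using \<epsilon> by real_asymp
  then have ev2: "\<forall>\<^sub>F t in at_top. C1 * t powr (- \<epsilon> / 2) < 1"
    by (rule order_tendstoD(2)) simp
  have "\<forall>\<^sub>F t in at_top. 0 < minv (t powr (1 - \<epsilon>)) \<and>
    (\<forall>x. norm (T t (A (laplace 1 x))) \<le> C * minv (t powr (1 - \<epsilon>)) * norm x)"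
    using ev1 ev2 eventually_ge_at_top[of 1]
  proof eventually_elim
    case (elim t)
    define r where "r = minv (t powr (1 - \<epsilon>))"
    define q where "q = t powr (- \<epsilon> / 2)"
    \<comment> \<open>The time of each of the \<open>k\<close> factors is twice \<open>t'\<close>.\<close>
    define t' where "t' = t / (2 * real k)"
    have t: "1 \<le> t" using elim by simp
    have r: "0 < r" "r < \<delta>" "m r = t powr (1 - \<epsilon>)" using elim by (auto simp: r_def)
    have t': "0 < t'" using t k_pos by (simp add: t'_def)
    have q: "0 < q" using t by (simp add: q_def)
    have q2: "t powr (1 - \<epsilon>) / t = q\<^sup>2"
    proof -
      have "q\<^sup>2 = t powr (- \<epsilon>)" unfolding q_def using t by (simp add: powr_power)
      also have "- \<epsilon> = (1 - \<epsilon>) - 1" by simp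
      also have "t powr ((1 - \<epsilon>) - 1) = t powr (1 - \<epsilon>) / t powr 1" by (rule powr_diff)
      finally show ?thesis using t by simp
    qed
    \<comment> \<open>Weakens the rate \<open>t\<^sup>-\<^sup>\<epsilon>\<close> of the tail to the rate \<open>t\<^sup>-\<^sup>\<epsilon>\<^sup>/\<^sup>2\<close> of the square root.\<close>
    have q_le: "q \<le> 1" unfolding q_def using t \<epsilon> powr_mono[of "- \<epsilon> / 2" 0 t] by simp
    have rm: "1 / r \<le> t powr (1 - \<epsilon>)" using \<delta>(2)[OF r(1,2)] r(1,3) by (simp add: field_simps)
    have w1: "sqrt (m r / t') = sqrt (2 * real k) * q"
    proof -
      have "m r / t' = 2 * real k * (t powr (1 - \<epsilon>) / t)" using t k_pos by (simp add: r(3) t'_def)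
      then show ?thesis using q by (simp add: q2 real_sqrt_mult)
    qed
    have w2: "vp_const / (r * t') \<le> 2 * real k * vp_const * q"
    proof -
      have "vp_const / (r * t') = 2 * real k * vp_const * ((1 / r) / t)"
        using t k_pos r(1) by (simp add: t'_def)
      also have "\<dots> \<le> 2 * real k * vp_const * (t powr (1 - \<epsilon>) / t)"
        using rm t k_pos vp_const_pos by (intro mult_left_mono divide_right_mono) auto
      also have "\<dots> \<le> 2 * real k * vp_const * q"
        unfolding q2 using q q_le k_pos vp_const_pos
        by (intro mult_left_mono) (auto simp: power2_eq_square mult_left_le)
      finally show ?thesis .
    qed
    have \<omega>: "I * sqrt (m r / t') + M * (vp_const / (r * t')) \<le> C1 * q"
      unfolding w1 using mult_left_mono[OF w2, of M] M1 by (simp add: C1_def algebra_simps)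
    have decay: "norm (T (real k * (2 * t')) (A (laplace 1 x)))
        \<le> ((C1 * q) ^ k * (1 + M) + real k * (6 * vp_const * M ^ 3 * r)) * norm x" for x
    proof (rule iterated_decay[OF r(1) _ t'])
      show "0 < m r" using r(3) t by simp
      show "3 * (1 + (\<integral>s. \<bar>vp_kernel s\<bar> \<partial>lborel)) * M\<^sup>2 * sqrt (m r / t') + M * (vp_const / (r * t')) \<le> C1 * q"
        using \<omega> by (simp add: I_def)
    qed (use growth[OF r(1)] C1 q elim in \<open>auto simp: q_def\<close>)
    have "q ^ k \<le> r"
    proof -
      have "q ^ k = t powr (- (real k * \<epsilon> / 2))" unfolding q_def using t by (simp add: powr_power mult.commute)
      also have "\<dots> \<le> t powr (- (1 - \<epsilon>))"
        using t k\<epsilon> \<epsilon> by (intro powr_mono) auto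
      also have "\<dots> = 1 / t powr (1 - \<epsilon>)" by (simp only: powr_minus_divide)
      also have "\<dots> \<le> r" using rm r(1) t by (simp add: field_simps)
      finally show ?thesis .
    qed
    then have "(C1 * q) ^ k \<le> C1 ^ k * r"
      unfolding power_mult_distrib using C1 by (intro mult_left_mono) auto
    then have "(C1 * q) ^ k * (1 + M) + real k * (6 * vp_const * M ^ 3 * r) \<le> C * r"
      using mult_right_mono[of "(C1 * q) ^ k" "C1 ^ k * r" "1 + M"] M1 by (simp add: C_def algebra_simps)
    moreover have "real k * (2 * t') = t" using k_pos by (simp add: t'_def)
    ultimately have "norm (T t (A (laplace 1 x))) \<le> C * r * norm x" for x
      using decay[of x] mult_right_mono[of _ "C * r" "norm x"] by (metis norm_ge_zero order_trans)
    then show ?case using r(1) by (simp add: r_def)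
  qed
  with C show ?thesis by blast
qed

end

end

section \<open>Integration against a complex measure\<close>

text \<open>
  The four real set functions, and below their coefficients, from whose positive variations the
  integral against a complex measure is assembled.
\<close>

definition jordan_part :: "(real set \<Rightarrow> complex) \<Rightarrow> nat \<Rightarrow> real set \<Rightarrow> real" where
  "jordan_part \<mu> j B = (if j = 0 then Re (\<mu> B) else if j = 1 then - Re (\<mu> B)
    else if j = 2 then Im (\<mu> B) else - Im (\<mu> B))"

definition jordan_coeff :: "nat \<Rightarrow> complex" where
  "jordan_coeff j = (if j = 0 then 1 else if j = 1 then -1 else if j = 2 then \<i> else - \<i>)"

context
  fixes \<mu> :: "real set \<Rightarrow> complex"
  assumes \<mu>: "complex_borel_measure \<mu>"
begin

private lemma jordan_part_sums:
  assumes "range B \<subseteq> sets borel" "disjoint_family B"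
  shows "(\<lambda>i::nat. jordan_part \<mu> j (B i)) sums jordan_part \<mu> j (\<Union>i. B i)"
proof -
  have s: "(\<lambda>i. \<mu> (B i)) sums \<mu> (\<Union>i. B i)"
    using \<mu> assms unfolding complex_borel_measure_def by blast
  show ?thesis unfolding jordan_part_def
    using sums_Re[OF s] sums_Im[OF s] sums_minus[OF sums_Re[OF s]] sums_minus[OF sums_Im[OF s]] by auto
qed

lemma jordan_finite: "finite_measure (positive_variation (jordan_part \<mu> j))"
  by (rule finite_positive_variation) (rule jordan_part_sums)

lemma jordan_sets: "sets (positive_variation (jordan_part \<mu> j)) = sets borel"
  by (rule sets_positive_variation) (rule jordan_part_sums)

lemma jordan_AE:
  assumes "concentrated_on \<mu> {0..}"
  shows "AE u in positive_variation (jordan_part \<mu> j). 0 \<le> u"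
proof -
  have "AE u in positive_variation (jordan_part \<mu> j). u \<in> {0..}"
  proof (rule AE_positive_variation)
    fix B :: "real set" assume "B \<in> sets borel" "B \<inter> {0..} = {}"
    then show "jordan_part \<mu> j B = 0"
      using assms by (simp add: concentrated_on_def jordan_part_def)
  qed (auto intro: jordan_part_sums)
  then show ?thesis by simp
qed

lemma complex_integral_jordan:
  fixes f :: "real \<Rightarrow> 'a::complex_hilbert_space"
  assumes f: "tame f"
  shows "complex_integral \<mu> f
    = (\<Sum>j<4::nat. vint (positive_variation (jordan_part \<mu> j)) (\<lambda>_. jordan_coeff j) f)"
proof -
  have eq: "vint (positive_variation (jordan_part \<mu> j)) (\<lambda>_. c) f
      = c *\<^sub>C strong_integral (positive_variation (jordan_part \<mu> j)) f" for j c
  proof -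
    interpret finite_measure "positive_variation (jordan_part \<mu> j)" by (rule jordan_finite)
    have one: "integrable (positive_variation (jordan_part \<mu> j)) (\<lambda>_. 1::complex)" by simp
    let ?N = "positive_variation (jordan_part \<mu> j)"
    have hs: "has_strong_integral ?N f (vint ?N (\<lambda>_. 1) f)"
      using has_strong_integral_vint[OF jordan_sets one f] by (simp only: scaleC_one)
    have "strong_integral ?N (\<lambda>s. c *\<^sub>C f s) = c *\<^sub>C vint ?N (\<lambda>_. 1) f"
      by (rule strong_integral_eqI) (rule has_strong_integral_linear[OF scaleC.bounded_linear_right hs])
    then show ?thesis
      unfolding vint_def[of _ "\<lambda>_. c"] strong_integral_eqI[OF hs] .
  qed
  have [simp]: "{..<4::nat} = {0, 1, 2, 3}" by auto
  show ?thesis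
    unfolding eq complex_integral_def
    by (simp add: jordan_part_def[abs_def] jordan_coeff_def scaleC_one scaleC.minus_left scaleC.diff_right)
qed

lemma fourier_measure_jordan:
  "fourier_measure \<mu> \<xi> = (\<Sum>j<4::nat.
    \<integral>u. jordan_coeff j * wave \<xi> u \<partial>positive_variation (jordan_part \<mu> j))"
proof -
  have "tame (\<lambda>t. wave \<xi> t)"
    by (rule tameI[of "{}" _ 1]) (auto intro!: continuous_intros simp: norm_exp_eq_Re)
  then show ?thesis
    unfolding fourier_measure_def complex_integral_jordan[OF \<open>tame _\<close>]
    by (simp add: vint_def strong_integral_eq_lebesgue_integral scaleC_complex_def)
qed

end

section \<open>Decay of the semigroup\<close>

theorem theorem1p4:
  fixes T :: "real \<Rightarrow> 'a::complex_hilbert_space \<Rightarrow> 'a"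
    and D :: "'a set"
    and A :: "'a \<Rightarrow> 'a"
  assumes semigroup: "c0_semigroup T"
    and bounded: "bounded_semigroup T"
    and generator: "is_generator T D (\<lambda>x. - A x)"
    and compact: "compact (boundary_spectrum D A)"
    and synthesis: "spectral_synthesis (boundary_spectrum D A)"
    and resolvent: "\<exists>\<eta>>0. resolvent_bounded_off D A \<eta>"
  shows
    "(\<forall>\<mu>. complex_borel_measure \<mu> \<longrightarrow> concentrated_on \<mu> {0..} \<longrightarrow>
        (\<forall>\<xi>\<in>boundary_spectrum D A. fourier_measure \<mu> \<xi> = 0) \<longrightarrow>
        ((\<lambda>t. onorm (\<lambda>x. T t (semigroup_transform \<mu> T x))) \<longlongrightarrow> 0) at_top)
     \<and>
     (boundary_spectrum D A = {0} \<longrightarrow>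
        filterlim (\<lambda>s. s * resolvent_growth D A s) at_top (at_right 0) \<longrightarrow>
        (\<forall>\<epsilon> minv. 0 < \<epsilon> \<longrightarrow> \<epsilon> < 1 \<longrightarrow>
          eventual_right_inverse (resolvent_growth D A) minv \<longrightarrow>
          (\<exists>c>0. \<exists>C>0. \<exists>C\<^sub>\<epsilon>>0. \<forall>\<^sub>F t in at_top.
            c * minv (C * t) \<le> onorm (\<lambda>x. T t (A (shift_inverse D A 1 x))) \<and>
            onorm (\<lambda>x. T t (A (shift_inverse D A 1 x))) \<le> C\<^sub>\<epsilon> * minv (t powr (1 - \<epsilon>)))))"
proof -
  obtain K0 where K0: "\<And>t. 0 \<le> t \<Longrightarrow> onorm (T t) \<le> K0"
    using bounded by (auto simp: bounded_semigroup_def)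
  define M where "M = max 1 K0"
  interpret bounded_c0_semigroup T M D A
  proof
    show "norm (T t x) \<le> M * norm x" if "0 \<le> t" for t x
    proof -
      have "bounded_linear (T t)" using semigroup that by (simp add: c0_semigroup_def bounded_clinear_def)
      then have "norm (T t x) \<le> onorm (T t) * norm x" by (rule onorm)
      also have "\<dots> \<le> M * norm x" using K0[OF that] by (intro mult_right_mono) (auto simp: M_def)
      finally show ?thesis .
    qed
  qed (use semigroup generator in \<open>auto simp: M_def\<close>)
  obtain \<eta> where \<eta>: "0 < \<eta>" "resolvent_bounded_off D A \<eta>" using resolvent by blast
  have E_off: "- s \<notin> boundary_spectrum D A" if "\<eta> \<le> \<bar>s\<bar>" for s
  proof
    assume "- s \<in> boundary_spectrum D A"
    then obtain z where z: "z \<in> op_spectrum D A" "complex_of_real (- s) = - \<i> * z"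
      by (auto simp: boundary_spectrum_def)
    then have "z = - (\<i> * complex_of_real s)" by (auto simp: complex_eq_iff)
    moreover have "- (\<i> * complex_of_real s) \<in> resolvent_set D A"
      using \<eta>(2) that by (simp add: resolvent_bounded_off_def)
    ultimately show False using z(1) by (simp add: op_spectrum_def)
  qed
  have a: "((\<lambda>t. onorm (\<lambda>x. T t (semigroup_transform \<mu> T x))) \<longlongrightarrow> 0) at_top"
    if \<mu>: "complex_borel_measure \<mu>" "concentrated_on \<mu> {0..}"
      and zero: "\<forall>\<xi>\<in>boundary_spectrum D A. fourier_measure \<mu> \<xi> = 0" for \<mu>
  proof -
    let ?N = "\<lambda>j. positive_variation (jordan_part \<mu> j)"
    have measure_transform_eq: "semigroup_transform \<mu> T x = measure_transform ?N jordan_coeff x" for x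
    proof -
      have "(\<lambda>s. indicator {0..} s *\<^sub>R T s x) = (\<lambda>s. damped 0 s x)" by (auto simp: damped_def indicator_def)
      then show ?thesis
        unfolding semigroup_transform_def measure_transform_def[OF jordan_finite[OF \<mu>(1)] jordan_sets[OF \<mu>(1)] jordan_AE[OF \<mu>]]
        using complex_integral_jordan[OF \<mu>(1) tame_damped[OF order_refl]] by simp
    qed
    have closed: "closed {s. \<eta> \<le> \<bar>s\<bar>}" by (intro closed_Collect_le continuous_intros)
    obtain K where K: "0 < K" "\<And>s v. \<eta> \<le> \<bar>s\<bar> \<Longrightarrow> v \<in> D \<Longrightarrow> norm v \<le> K * norm ((\<i> * complex_of_real s) *\<^sub>C v + A v)"
      by (rule boundary_spectrum_closed_bound[OF closed _ \<eta>(2)]) (use E_off in auto)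
    have low: "\<exists>K>0. \<forall>s v. - s \<notin> U \<longrightarrow> v \<in> D \<longrightarrow> norm v \<le> K * norm ((\<i> * complex_of_real s) *\<^sub>C v + A v)"
      if U: "open U" "boundary_spectrum D A \<subseteq> U" for U
    proof -
      have cl: "closed (uminus -` (- U))" using U(1) by (intro closed_vimage continuous_intros) auto
      have off: "- s \<notin> boundary_spectrum D A" if "s \<in> uminus -` (- U)" for s using that U(2) by auto
      show ?thesis
        by (rule boundary_spectrum_closed_bound[OF cl off \<eta>(2)]) (simp, blast)
    qed
    show ?thesis
    proof (rule tendstoI)
      fix e :: real assume e: "0 < e"
      have "\<forall>\<^sub>F t in at_top. \<forall>x. norm (T t (measure_transform ?N jordan_coeff x)) \<le> (e / 2) * norm x"
        by (rule katznelson_tzafriri[OF jordan_finite[OF \<mu>(1)] jordan_sets[OF \<mu>(1)] jordan_AE[OF \<mu>] \<eta>(1) K low synthesis])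
           (use zero e in \<open>auto simp: fourier_measure_jordan[OF \<mu>(1)]\<close>)
      then show "\<forall>\<^sub>F t in at_top. dist (onorm (\<lambda>x. T t (semigroup_transform \<mu> T x))) 0 < e"
      proof eventually_elim
        case (elim t)
        then show ?case
          using onorm_between[of "\<lambda>x. T t (semigroup_transform \<mu> T x)" "e / 2"] e by (simp add: measure_transform_eq)
      qed
    qed
  qed
  have b: "\<exists>c>0. \<exists>C>0. \<exists>C\<^sub>\<epsilon>>0. \<forall>\<^sub>F t in at_top.
            c * minv (C * t) \<le> onorm (\<lambda>x. T t (A (shift_inverse D A 1 x))) \<and>
            onorm (\<lambda>x. T t (A (shift_inverse D A 1 x))) \<le> C\<^sub>\<epsilon> * minv (t powr (1 - \<epsilon>))"
    if E: "boundary_spectrum D A = {0}"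
      and lim: "filterlim (\<lambda>s. s * resolvent_growth D A s) at_top (at_right 0)"
      and \<epsilon>: "0 < \<epsilon>" "\<epsilon> < 1" and inv: "eventual_right_inverse (resolvent_growth D A) minv" for \<epsilon> minv
  proof -
    let ?m = "resolvent_growth D A"
    let ?R = "\<lambda>r. shift_inverse D A (\<i> * complex_of_real r)"
    have res: "- (\<i> * complex_of_real r) \<in> resolvent_set D A" if "r \<noteq> 0" for r
      using that by (intro not_boundary_spectrum) (simp add: E)
    have bdd: "bdd_above ((\<lambda>r. onorm (?R r)) ` {r. s \<le> \<bar>r\<bar>})" if s: "0 < s" for s
    proof -
      have "closed {r. s \<le> \<bar>r\<bar>}" by (intro closed_Collect_le continuous_intros)
      then obtain K where K: "0 < K"
        "\<And>r v. s \<le> \<bar>r\<bar> \<Longrightarrow> v \<in> D \<Longrightarrow> norm v \<le> K * norm ((\<i> * complex_of_real r) *\<^sub>C v + A v)"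
        by (rule boundary_spectrum_closed_bound[OF _ _ \<eta>(2)]) (use s E in auto)
      have "onorm (?R r) \<le> K" if "s \<le> \<bar>r\<bar>" for r
        using K that s by (intro onorm_bound shift_inverse_norm_le resolvent_set_shift(1) res) auto
      then show ?thesis by (auto simp: bdd_above_def)
    qed
    have growth: "norm v \<le> ?m s * norm ((\<i> * complex_of_real r) *\<^sub>C v + A v)"
      if "0 < s" "s \<le> \<bar>r\<bar>" "v \<in> D" for s r v
    proof -
      have "onorm (?R r) \<le> ?m s"
        unfolding resolvent_growth_def by (rule cSUP_upper[OF _ bdd]) (use that in auto)
      then have "onorm (?R r) * norm ((\<i> * complex_of_real r) *\<^sub>C v + A v) \<le> ?m s * norm ((\<i> * complex_of_real r) *\<^sub>C v + A v)"
        by (rule mult_right_mono) simp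
      then show ?thesis
        using shift_inverse_lower_bound[OF res that(3), of r] that by fastforce
    qed
    have ne: "{r. s \<le> \<bar>r\<bar>} \<noteq> {}" for s :: real
      using abs_ge_self[of s] by blast
    have least: "?m s \<le> b"
      if "0 < s" "0 \<le> b" "\<And>r v. s \<le> \<bar>r\<bar> \<Longrightarrow> v \<in> D \<Longrightarrow> norm v \<le> b * norm ((\<i> * complex_of_real r) *\<^sub>C v + A v)" for s b
      unfolding resolvent_growth_def
    proof (rule cSUP_least[OF ne])
      fix r assume r: "r \<in> {r. s \<le> \<bar>r\<bar>}"
      then show "onorm (?R r) \<le> b"
        using that by (intro onorm_bound shift_inverse_norm_le resolvent_set_shift(1) res) auto
    qed
    have anti: "?m s' \<le> ?m s" if "0 < s" "s \<le> s'" for s s'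
      unfolding resolvent_growth_def by (rule cSUP_subset_mono[OF ne bdd]) (use that in auto)
    obtain C where C: "0 < C" "\<forall>\<^sub>F t in at_top. 0 < minv (t powr (1 - \<epsilon>)) \<and>
        (\<forall>x. norm (T t (A (laplace 1 x))) \<le> C * minv (t powr (1 - \<epsilon>)) * norm x)"
    proof -
      have "\<exists>C>0. \<forall>\<^sub>F t in at_top. 0 < minv (t powr (1 - \<epsilon>)) \<and>
          (\<forall>x. norm (T t (A (laplace 1 x))) \<le> C * minv (t powr (1 - \<epsilon>)) * norm x)"
        by (rule upper_rate[where m = ?m]) (fact growth least anti lim inv \<epsilon>)+
      then show thesis using that by blast
    qed
    have lower: "\<forall>\<^sub>F t in at_top. \<forall>n\<ge>0. (\<forall>x. norm (T t (A (laplace 1 x))) \<le> n * norm x) \<longrightarrow>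
        minv (8 * M * t) \<le> 4 * n"
      by (rule lower_rate[where m = ?m]) (fact growth least anti lim inv)+
    have "\<forall>\<^sub>F t in at_top. (1 / 4) * minv ((8 * M) * t) \<le> onorm (\<lambda>x. T t (A (shift_inverse D A 1 x))) \<and>
        onorm (\<lambda>x. T t (A (shift_inverse D A 1 x))) \<le> C * minv (t powr (1 - \<epsilon>))"
      using C(2) lower eventually_ge_at_top[of 0]
    proof eventually_elim
      case (elim t)
      let ?n = "onorm (\<lambda>x. T t (A (laplace 1 x)))"
      have n: "?n \<le> C * minv (t powr (1 - \<epsilon>))" "0 \<le> ?n"
        using onorm_between[of "\<lambda>x. T t (A (laplace 1 x))" "C * minv (t powr (1 - \<epsilon>))"] elim C(1) by auto
      have "\<forall>x. norm (T t (A (laplace 1 x))) \<le> ?n * norm x"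
        using onorm[OF T_A_laplace_linear] elim by blast
      then have "minv (8 * M * t) \<le> 4 * ?n" using elim n(2) by blast
      with n show ?case by (simp add: shift_inverse_one)
    qed
    moreover have "0 < (1 / 4 :: real)" "0 < 8 * M" using M1 by auto
    ultimately show ?thesis using C(1) by blast
  qed
  show ?thesis using a b by blast
qed

end
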